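(* Let $R$ be an associative ring with identity and let $\mathcal{X}$ be a class of $R$-modules such that every $\mathcal{X}$-injective module and every $\mathcal{X}$-projective module belongs to $\mathcal{X}$. (i) If $\mathcal{X}$ is closed under direct sums and extensions and is a special precovering and special preenveloping class, then every left bounded complex has a monic exact $C(\mathcal{X}\text{-injective})$-preenvelope, and every right bounded complex has an epic exact $C(\mathcal{X}\text{-projective})$-precover. (ii) If $(\mathcal{X},\mathcal{X}^{\perp})$ is a complete cotorsion pair and $C(\mathcal{X}^* )$ is closed under inverse limits, then every complex has a monic exact $C(\mathcal{X}\text{-injective})$-preenvelope which is in $\varepsilon_{\mathcal{X}\text{-injective}}$, and every complex has an epic exact $C(\mathcal{X}\text{-projective})$-precover which is in $\varepsilon_{\mathcal{X}\text{-projective}}$.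
   Context: All modules are unitary; complexes are complexes of $R$-modules; $\operatorname{Ext}^1$ for complexes is computed in the abelian category of complexes and chain maps. A module $E$ is $\mathcal{X}$-injective if $\operatorname{Ext}^1(X,E)=0$ for all $X\in\mathcal{X}$; a module $P$ is $\mathcal{X}$-projective if $\operatorname{Ext}^1(P,X)=0$ for all $X\in\mathcal{X}$. $\mathcal{X}^{\perp}$ is the class of $\mathcal{X}$-injective modules and ${}^{\perp}\mathcal{X}$ the class of $\mathcal{X}$-projective modules. $C(\mathcal{X}^* )$ is the class of complexes all of whose terms are in $\mathcal{X}$. A complex $C$ is $\mathcal{X}$-injective if $\operatorname{Ext}^1(S,C)=0$ for all $S\in C(\mathcal{X}^* )$, and $\mathcal{X}$-projective if $\operatorname{Ext}^1(C,S)=0$ for all $S\in C(\mathcal{X}^* )$; $C(\mathcal{X}\text{-injective})$ and $C(\mathcal{X}\text{-projective})$ are the classes of such complexes. $\varepsilon_{\mathcal{X}\text{-injective}}$ (resp. $\varepsilon_{\mathcal{X}\text{-projective}}$) is the class of exact complexes all of whose kernels (cycle modules) are $\mathcal{X}$-injective (resp. $\mathcal{X}$-projective) modules. Left bounded complexes are those of the form $\cdots\to0\to Y^0\to Y^1\to\cdots$ up to shift; right bounded complexes are those of the form $\cdots\to Y_1\to Y_0\to0\to\cdots$ up to shift. For a class $\mathcal{F}$, an $\mathcal{F}$-precover of $M$ is a morphism $F\to M$ with $F\in\mathcal{F}$ through which every morphism $F'\to M$ with $F'\in\mathcal{F}$ factors; $\mathcal{F}$-preenvelopes are dual. A preenvelope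 $M\to F$ (precover $F\to M$) of complexes is exact if $F$ is an exact complex, and is "in" a class if $F$ is; monic/epic means the morphism is injective/surjective. $\mathcal{X}$ is special precovering if every module $M$ has an exact sequence $0\to K\to X\to M\to0$ with $X\in\mathcal{X}$, $K\in\mathcal{X}^{\perp}$, and special preenveloping if every $M$ has an exact sequence $0\to M\to X\to L\to0$ with $X\in\mathcal{X}$, $L\in{}^{\perp}\mathcal{X}$. A cotorsion pair $(\mathcal{A},\mathcal{B})$ is a pair with $\mathcal{A}^{\perp}=\mathcal{B}$, ${}^{\perp}\mathcal{B}=\mathcal{A}$; it is complete if every module $M$ admits exact sequences $0\to B\to A\to M\to0$ and $0\to M\to B'\to A'\to0$ with $A,A'\in\mathcal{A}$, $B,B'\in\mathcal{B}$. *)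

theory Defs
  imports "HOL-Algebra.Module" "HOL-Library.Equipollence"
begin

text \<open>
  HOL-Algebra's locale \<open>module\<close> demands a commutative ring of scalars, so modules over an
  arbitrary associative ring with identity are introduced here, on HOL-Algebra's record type
  \<open>module\<close>. The multiplicative fields \<open>mult\<close> and \<open>one\<close> of a module record are irrelevant.
  Modules are left modules; right modules are left modules over the opposite ring.
\<close>

locale left_module =
  R?: ring R + M?: abelian_group M
  for R :: "('r, 'k) ring_scheme" (structure) and M :: "('r, 'm) module" (structure) +
  assumes smult_closed:
      "\<lbrakk>r \<in> carrier R; x \<in> carrier M\<rbrakk> \<Longrightarrow> r \<odot>\<^bsub>M\<^esub> x \<in> carrier M"
    and smult_l_distr:
      "\<lbrakk>r \<in> carrier R; s \<in> carrier R; x \<in> carrier M\<rbrakk>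
        \<Longrightarrow> (r \<oplus>\<^bsub>R\<^esub> s) \<odot>\<^bsub>M\<^esub> x = r \<odot>\<^bsub>M\<^esub> x \<oplus>\<^bsub>M\<^esub> s \<odot>\<^bsub>M\<^esub> x"
    and smult_r_distr:
      "\<lbrakk>r \<in> carrier R; x \<in> carrier M; y \<in> carrier M\<rbrakk>
        \<Longrightarrow> r \<odot>\<^bsub>M\<^esub> (x \<oplus>\<^bsub>M\<^esub> y) = r \<odot>\<^bsub>M\<^esub> x \<oplus>\<^bsub>M\<^esub> r \<odot>\<^bsub>M\<^esub> y"
    and smult_assoc:
      "\<lbrakk>r \<in> carrier R; s \<in> carrier R; x \<in> carrier M\<rbrakk>
        \<Longrightarrow> (r \<otimes>\<^bsub>R\<^esub> s) \<odot>\<^bsub>M\<^esub> x = r \<odot>\<^bsub>M\<^esub> (s \<odot>\<^bsub>M\<^esub> x)"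
    and smult_one:
      "x \<in> carrier M \<Longrightarrow> \<one>\<^bsub>R\<^esub> \<odot>\<^bsub>M\<^esub> x = x"

definition rmod_hom ::
    "('r, 'k) ring_scheme \<Rightarrow> ('r, 'm) module \<Rightarrow> ('r, 'n) module \<Rightarrow> ('m \<Rightarrow> 'n) set" where
  "rmod_hom R M N = {f \<in> carrier M \<rightarrow> carrier N.
     (\<forall>x\<in>carrier M. \<forall>y\<in>carrier M. f (x \<oplus>\<^bsub>M\<^esub> y) = f x \<oplus>\<^bsub>N\<^esub> f y) \<and>
     (\<forall>r\<in>carrier R. \<forall>x\<in>carrier M. f (r \<odot>\<^bsub>M\<^esub> x) = r \<odot>\<^bsub>N\<^esub> f x)}"

definition rmod_iso ::
    "('r, 'k) ring_scheme \<Rightarrow> ('r, 'm) module \<Rightarrow> ('r, 'n) module \<Rightarrow> bool" where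
  "rmod_iso R M N \<longleftrightarrow> (\<exists>f\<in>rmod_hom R M N. bij_betw f (carrier M) (carrier N))"

text \<open>\<open>short_exact R A i B p C\<close> says that \<open>0 \<rightarrow> A \<rightarrow> B \<rightarrow> C \<rightarrow> 0\<close> (maps \<open>i\<close>, \<open>p\<close>) is exact.\<close>

definition short_exact ::
    "('r, 'k) ring_scheme \<Rightarrow> ('r, 'm) module \<Rightarrow> ('m \<Rightarrow> 'm) \<Rightarrow> ('r, 'm) module
      \<Rightarrow> ('m \<Rightarrow> 'm) \<Rightarrow> ('r, 'm) module \<Rightarrow> bool" where
  "short_exact R A i B p C \<longleftrightarrow>
     i \<in> rmod_hom R A B \<and> p \<in> rmod_hom R B C \<and>
     inj_on i (carrier A) \<and> p ` carrier B = carrier C \<and>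
     i ` carrier A = {b \<in> carrier B. p b = \<zero>\<^bsub>C\<^esub>}"


subsection \<open>The universe of sets\<close>

text \<open>
  A type cannot carry all modules, so ``set'' means ``member of \<open>U\<close>'', where \<open>U\<close> is a
  family of subsets of a type \<open>'m\<close>; ``all modules'', ``class of modules'' and
  ``family indexed by a set'' are understood relative to \<open>U\<close>. Up to bijection, \<open>U\<close> has to be
  closed under smaller sets and under disjoint unions indexed by members of \<open>U\<close>, to contain
  an infinite set and the carrier of \<open>R\<close>, and to be closed under maps from \<open>R\<close>. A Grothendieck
  universe to which \<open>R\<close> and an infinite set belong has these properties and gives the usual
  reading; so does the family of all subsets of an infinite type \<open>'m\<close> into which
  \<open>carrier R\<close> and \<open>carrier R \<rightarrow>\<^sub>E UNIV\<close> both inject.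
\<close>

definition set_universe :: "('r, 'k) ring_scheme \<Rightarrow> 'm set set \<Rightarrow> bool" where
  "set_universe R U \<longleftrightarrow>
     (\<forall>A\<in>U. \<forall>B::'m set. B \<lesssim> A \<longrightarrow> B \<in> U) \<and>
     (\<exists>A\<in>U. infinite A) \<and>
     (\<exists>A\<in>U. carrier R \<lesssim> A) \<and>
     (\<forall>I\<in>U. \<forall>F\<in>I \<rightarrow> U. \<exists>B\<in>U. Sigma I F \<lesssim> B) \<and>
     (\<forall>A\<in>U. \<exists>B\<in>U. (carrier R \<rightarrow>\<^sub>E A) \<lesssim> B)"

lemma set_universe_Pow_UNIV:
  assumes inf: "infinite (UNIV :: 'm set)"
    and emb: "carrier R \<lesssim> (UNIV :: 'm set)"
    and maps: "(carrier R \<rightarrow>\<^sub>E (UNIV :: 'm set)) \<lesssim> (UNIV :: 'm set)"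
  shows "set_universe R (UNIV :: 'm set set)"
proof -
  obtain f :: "'m \<times> 'm \<Rightarrow> 'm" where f: "bij_betw f (UNIV \<times> UNIV) UNIV"
    using card_of_Times_same_infinite[OF inf] card_of_ordIso by blast
  have "Sigma I F \<lesssim> (UNIV :: 'm set)" for I :: "'m set" and F :: "'m \<Rightarrow> 'm set"
    unfolding lepoll_def using f
    by (intro exI[of _ f]) (auto simp: bij_betw_def intro: inj_on_subset)
  moreover have "(carrier R \<rightarrow>\<^sub>E A) \<lesssim> (UNIV :: 'm set)" for A :: "'m set"
    by (rule lepoll_trans[OF subset_imp_lepoll maps]) (rule PiE_mono, simp)
  ultimately show ?thesis
    unfolding set_universe_def using inf emb by blast
qed

definition Mods :: "('r, 'k) ring_scheme \<Rightarrow> 'm set set \<Rightarrow> ('r, 'm) module set" where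
  "Mods R U = {M. left_module R M \<and> carrier M \<in> U}"


subsection \<open>\<open>Ext\<^sup>1\<close> and orthogonal classes of modules\<close>

text \<open>
  \<open>Ext1 R U A B\<close> is the set underlying Yoneda's group \<open>Ext\<^sup>1(A, B)\<close>: extensions
  \<open>0 \<rightarrow> B \<rightarrow> E \<rightarrow> A \<rightarrow> 0\<close> modulo commuting maps of middle terms that are the identity on \<open>A\<close>
  and \<open>B\<close> (these are isomorphisms by the five lemma). The group vanishes iff this set has
  exactly one element.
\<close>

definition extensions ::
    "('r, 'k) ring_scheme \<Rightarrow> 'm set set \<Rightarrow> ('r, 'm) module \<Rightarrow> ('r, 'm) module
      \<Rightarrow> (('r, 'm) module \<times> ('m \<Rightarrow> 'm) \<times> ('m \<Rightarrow> 'm)) set" where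
  "extensions R U A B = {(E, i, p). E \<in> Mods R U \<and> short_exact R B i E p A}"

definition ext_equiv ::
    "('r, 'k) ring_scheme \<Rightarrow> 'm set set \<Rightarrow> ('r, 'm) module \<Rightarrow> ('r, 'm) module
      \<Rightarrow> (('r, 'm) module \<times> ('m \<Rightarrow> 'm) \<times> ('m \<Rightarrow> 'm)) rel" where
  "ext_equiv R U A B = {((E, i, p), (E', i', p')).
     (E, i, p) \<in> extensions R U A B \<and> (E', i', p') \<in> extensions R U A B \<and>
     (\<exists>h\<in>rmod_hom R E E'.
        (\<forall>b\<in>carrier B. h (i b) = i' b) \<and> (\<forall>e\<in>carrier E. p' (h e) = p e))}"

definition Ext1 ::
    "('r, 'k) ring_scheme \<Rightarrow> 'm set set \<Rightarrow> ('r, 'm) module \<Rightarrow> ('r, 'm) module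
      \<Rightarrow> (('r, 'm) module \<times> ('m \<Rightarrow> 'm) \<times> ('m \<Rightarrow> 'm)) set set" where
  "Ext1 R U A B = extensions R U A B // ext_equiv R U A B"

definition right_perp ::
    "('r, 'k) ring_scheme \<Rightarrow> 'm set set \<Rightarrow> ('r, 'm) module set \<Rightarrow> ('r, 'm) module set" where
  "right_perp R U X = {E \<in> Mods R U. \<forall>A\<in>X. is_singleton (Ext1 R U A E)}"

definition left_perp ::
    "('r, 'k) ring_scheme \<Rightarrow> 'm set set \<Rightarrow> ('r, 'm) module set \<Rightarrow> ('r, 'm) module set" where
  "left_perp R U X = {P \<in> Mods R U. \<forall>B\<in>X. is_singleton (Ext1 R U P B)}"

definition special_precovering ::
    "('r, 'k) ring_scheme \<Rightarrow> 'm set set \<Rightarrow> ('r, 'm) module set \<Rightarrow> bool" where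
  "special_precovering R U X \<longleftrightarrow>
     (\<forall>M\<in>Mods R U. \<exists>K\<in>right_perp R U X. \<exists>A\<in>X. \<exists>i p. short_exact R K i A p M)"

definition special_preenveloping ::
    "('r, 'k) ring_scheme \<Rightarrow> 'm set set \<Rightarrow> ('r, 'm) module set \<Rightarrow> bool" where
  "special_preenveloping R U X \<longleftrightarrow>
     (\<forall>M\<in>Mods R U. \<exists>A\<in>X. \<exists>L\<in>left_perp R U X. \<exists>i p. short_exact R M i A p L)"

definition cotorsion_pair ::
    "('r, 'k) ring_scheme \<Rightarrow> 'm set set \<Rightarrow> ('r, 'm) module set \<Rightarrow> ('r, 'm) module set \<Rightarrow> bool" where
  "cotorsion_pair R U A B \<longleftrightarrow>
     A \<subseteq> Mods R U \<and> B \<subseteq> Mods R U \<and> right_perp R U A = B \<and> left_perp R U B = A"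

definition complete_cotorsion_pair ::
    "('r, 'k) ring_scheme \<Rightarrow> 'm set set \<Rightarrow> ('r, 'm) module set \<Rightarrow> ('r, 'm) module set \<Rightarrow> bool" where
  "complete_cotorsion_pair R U A B \<longleftrightarrow> cotorsion_pair R U A B \<and>
     (\<forall>M\<in>Mods R U.
        (\<exists>K\<in>B. \<exists>P\<in>A. \<exists>i p. short_exact R K i P p M) \<and>
        (\<exists>E\<in>B. \<exists>L\<in>A. \<exists>i p. short_exact R M i E p L))"

definition direct_sum :: "'i set \<Rightarrow> ('i \<Rightarrow> ('r, 'm) module) \<Rightarrow> ('r, 'i \<Rightarrow> 'm) module" where
  "direct_sum I F =
     \<lparr>carrier = {x \<in> (\<Pi>\<^sub>E i\<in>I. carrier (F i)). finite {i\<in>I. x i \<noteq> \<zero>\<^bsub>F i\<^esub>}},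
      mult = undefined, one = undefined,
      zero = (\<lambda>i\<in>I. \<zero>\<^bsub>F i\<^esub>),
      add = (\<lambda>x y. \<lambda>i\<in>I. x i \<oplus>\<^bsub>F i\<^esub> y i),
      smult = (\<lambda>r x. \<lambda>i\<in>I. r \<odot>\<^bsub>F i\<^esub> x i)\<rparr>"

definition closed_under_direct_sums ::
    "('r, 'k) ring_scheme \<Rightarrow> 'm set set \<Rightarrow> ('r, 'm) module set \<Rightarrow> bool" where
  "closed_under_direct_sums R U X \<longleftrightarrow>
     (\<forall>I\<in>U. \<forall>F\<in>I \<rightarrow> X. \<forall>M\<in>Mods R U. rmod_iso R M (direct_sum I F) \<longrightarrow> M \<in> X)"

definition closed_under_extensions ::
    "('r, 'k) ring_scheme \<Rightarrow> 'm set set \<Rightarrow> ('r, 'm) module set \<Rightarrow> bool" where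
  "closed_under_extensions R U X \<longleftrightarrow>
     (\<forall>A\<in>X. \<forall>C\<in>X. \<forall>B\<in>Mods R U. \<forall>i p. short_exact R A i B p C \<longrightarrow> B \<in> X)"


subsection \<open>Complexes\<close>

text \<open>Homological grading: \<open>dif C n\<close> maps \<open>obj C n\<close> to \<open>obj C (n - 1)\<close>; so \<open>Y\<^sup>n = obj Y (- n)\<close>.\<close>

record ('r, 'm) cplx =
  obj :: "int \<Rightarrow> ('r, 'm) module"
  dif :: "int \<Rightarrow> 'm \<Rightarrow> 'm"

definition is_cplx :: "('r, 'k) ring_scheme \<Rightarrow> ('r, 'm) cplx \<Rightarrow> bool" where
  "is_cplx R C \<longleftrightarrow>
     (\<forall>n. left_module R (obj C n) \<and> dif C n \<in> rmod_hom R (obj C n) (obj C (n - 1)) \<and>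
       (\<forall>x\<in>carrier (obj C n). dif C (n - 1) (dif C n x) = \<zero>\<^bsub>obj C (n - 1 - 1)\<^esub>))"

definition Cplxs :: "('r, 'k) ring_scheme \<Rightarrow> 'm set set \<Rightarrow> ('r, 'm) cplx set" where
  "Cplxs R U = {C. is_cplx R C \<and> (\<forall>n. obj C n \<in> Mods R U)}"

definition chain_maps ::
    "('r, 'k) ring_scheme \<Rightarrow> ('r, 'm) cplx \<Rightarrow> ('r, 'n) cplx \<Rightarrow> (int \<Rightarrow> 'm \<Rightarrow> 'n) set" where
  "chain_maps R C D = {f. \<forall>n. f n \<in> rmod_hom R (obj C n) (obj D n) \<and>
     (\<forall>x\<in>carrier (obj C n). dif D n (f n x) = f (n - 1) (dif C n x))}"

definition cplx_iso :: "('r, 'k) ring_scheme \<Rightarrow> ('r, 'm) cplx \<Rightarrow> ('r, 'n) cplx \<Rightarrow> bool" where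
  "cplx_iso R C D \<longleftrightarrow>
     (\<exists>f\<in>chain_maps R C D. \<forall>n. bij_betw (f n) (carrier (obj C n)) (carrier (obj D n)))"

definition monic_map :: "('r, 'm) cplx \<Rightarrow> (int \<Rightarrow> 'm \<Rightarrow> 'm) \<Rightarrow> bool" where
  "monic_map C f \<longleftrightarrow> (\<forall>n. inj_on (f n) (carrier (obj C n)))"

definition epic_map :: "('r, 'm) cplx \<Rightarrow> (int \<Rightarrow> 'm \<Rightarrow> 'm) \<Rightarrow> ('r, 'm) cplx \<Rightarrow> bool" where
  "epic_map C f D \<longleftrightarrow> (\<forall>n. f n ` carrier (obj C n) = carrier (obj D n))"

definition cycles :: "('r, 'm) cplx \<Rightarrow> int \<Rightarrow> ('r, 'm) module" where
  "cycles C n =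
     (obj C n)\<lparr>carrier := {x \<in> carrier (obj C n). dif C n x = \<zero>\<^bsub>obj C (n - 1)\<^esub>}\<rparr>"

definition exact_cplx :: "('r, 'm) cplx \<Rightarrow> bool" where
  "exact_cplx C \<longleftrightarrow> (\<forall>n. dif C (n + 1) ` carrier (obj C (n + 1)) = carrier (cycles C n))"

definition left_bounded :: "('r, 'm) cplx \<Rightarrow> bool" where
  "left_bounded C \<longleftrightarrow> (\<exists>N. \<forall>n>N. carrier (obj C n) = {\<zero>\<^bsub>obj C n\<^esub>})"

definition right_bounded :: "('r, 'm) cplx \<Rightarrow> bool" where
  "right_bounded C \<longleftrightarrow> (\<exists>N. \<forall>n<N. carrier (obj C n) = {\<zero>\<^bsub>obj C n\<^esub>})"

definition cplx_short_exact ::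
    "('r, 'k) ring_scheme \<Rightarrow> ('r, 'm) cplx \<Rightarrow> (int \<Rightarrow> 'm \<Rightarrow> 'm) \<Rightarrow> ('r, 'm) cplx
      \<Rightarrow> (int \<Rightarrow> 'm \<Rightarrow> 'm) \<Rightarrow> ('r, 'm) cplx \<Rightarrow> bool" where
  "cplx_short_exact R A i B p C \<longleftrightarrow>
     i \<in> chain_maps R A B \<and> p \<in> chain_maps R B C \<and>
     (\<forall>n. short_exact R (obj A n) (i n) (obj B n) (p n) (obj C n))"

definition cplx_extensions ::
    "('r, 'k) ring_scheme \<Rightarrow> 'm set set \<Rightarrow> ('r, 'm) cplx \<Rightarrow> ('r, 'm) cplx
      \<Rightarrow> (('r, 'm) cplx \<times> (int \<Rightarrow> 'm \<Rightarrow> 'm) \<times> (int \<Rightarrow> 'm \<Rightarrow> 'm)) set" where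
  "cplx_extensions R U A B = {(E, i, p). E \<in> Cplxs R U \<and> cplx_short_exact R B i E p A}"

definition cplx_ext_equiv ::
    "('r, 'k) ring_scheme \<Rightarrow> 'm set set \<Rightarrow> ('r, 'm) cplx \<Rightarrow> ('r, 'm) cplx
      \<Rightarrow> (('r, 'm) cplx \<times> (int \<Rightarrow> 'm \<Rightarrow> 'm) \<times> (int \<Rightarrow> 'm \<Rightarrow> 'm)) rel" where
  "cplx_ext_equiv R U A B = {((E, i, p), (E', i', p')).
     (E, i, p) \<in> cplx_extensions R U A B \<and> (E', i', p') \<in> cplx_extensions R U A B \<and>
     (\<exists>h\<in>chain_maps R E E'. \<forall>n.
        (\<forall>b\<in>carrier (obj B n). h n (i n b) = i' n b) \<and>
        (\<forall>e\<in>carrier (obj E n). p' n (h n e) = p n e))}"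

definition cplx_Ext1 ::
    "('r, 'k) ring_scheme \<Rightarrow> 'm set set \<Rightarrow> ('r, 'm) cplx \<Rightarrow> ('r, 'm) cplx
      \<Rightarrow> (('r, 'm) cplx \<times> (int \<Rightarrow> 'm \<Rightarrow> 'm) \<times> (int \<Rightarrow> 'm \<Rightarrow> 'm)) set set" where
  "cplx_Ext1 R U A B = cplx_extensions R U A B // cplx_ext_equiv R U A B"

definition C_star ::
    "('r, 'k) ring_scheme \<Rightarrow> 'm set set \<Rightarrow> ('r, 'm) module set \<Rightarrow> ('r, 'm) cplx set" where
  "C_star R U X = {C \<in> Cplxs R U. \<forall>n. obj C n \<in> X}"

definition C_injective ::
    "('r, 'k) ring_scheme \<Rightarrow> 'm set set \<Rightarrow> ('r, 'm) module set \<Rightarrow> ('r, 'm) cplx set" where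
  "C_injective R U X = {C \<in> Cplxs R U. \<forall>S\<in>C_star R U X. is_singleton (cplx_Ext1 R U S C)}"

definition C_projective ::
    "('r, 'k) ring_scheme \<Rightarrow> 'm set set \<Rightarrow> ('r, 'm) module set \<Rightarrow> ('r, 'm) cplx set" where
  "C_projective R U X = {C \<in> Cplxs R U. \<forall>S\<in>C_star R U X. is_singleton (cplx_Ext1 R U C S)}"

definition eps_injective ::
    "('r, 'k) ring_scheme \<Rightarrow> 'm set set \<Rightarrow> ('r, 'm) module set \<Rightarrow> ('r, 'm) cplx set" where
  "eps_injective R U X =
     {C \<in> Cplxs R U. exact_cplx C \<and> (\<forall>n. cycles C n \<in> right_perp R U X)}"

definition eps_projective ::
    "('r, 'k) ring_scheme \<Rightarrow> 'm set set \<Rightarrow> ('r, 'm) module set \<Rightarrow> ('r, 'm) cplx set" where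
  "eps_projective R U X =
     {C \<in> Cplxs R U. exact_cplx C \<and> (\<forall>n. cycles C n \<in> left_perp R U X)}"

definition is_preenvelope ::
    "('r, 'k) ring_scheme \<Rightarrow> ('r, 'm) cplx set \<Rightarrow> ('r, 'm) cplx \<Rightarrow> (int \<Rightarrow> 'm \<Rightarrow> 'm)
      \<Rightarrow> ('r, 'm) cplx \<Rightarrow> bool" where
  "is_preenvelope R \<F> M f F \<longleftrightarrow> F \<in> \<F> \<and> f \<in> chain_maps R M F \<and>
     (\<forall>F'\<in>\<F>. \<forall>g\<in>chain_maps R M F'. \<exists>h\<in>chain_maps R F F'.
        \<forall>n. \<forall>x\<in>carrier (obj M n). h n (f n x) = g n x)"

definition is_precover ::
    "('r, 'k) ring_scheme \<Rightarrow> ('r, 'm) cplx set \<Rightarrow> ('r, 'm) cplx \<Rightarrow> (int \<Rightarrow> 'm \<Rightarrow> 'm)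
      \<Rightarrow> ('r, 'm) cplx \<Rightarrow> bool" where
  "is_precover R \<F> F f M \<longleftrightarrow> F \<in> \<F> \<and> f \<in> chain_maps R F M \<and>
     (\<forall>F'\<in>\<F>. \<forall>g\<in>chain_maps R F' M. \<exists>h\<in>chain_maps R F' F.
        \<forall>n. \<forall>x\<in>carrier (obj F' n). f n (h n x) = g n x)"


subsection \<open>Inverse limits of complexes\<close>

definition directed_poset :: "'i set \<Rightarrow> ('i \<Rightarrow> 'i \<Rightarrow> bool) \<Rightarrow> bool" where
  "directed_poset I leq \<longleftrightarrow> I \<noteq> {} \<and>
     (\<forall>i\<in>I. leq i i) \<and>
     (\<forall>i\<in>I. \<forall>j\<in>I. leq i j \<and> leq j i \<longrightarrow> i = j) \<and>
     (\<forall>i\<in>I. \<forall>j\<in>I. \<forall>k\<in>I. leq i j \<and> leq j k \<longrightarrow> leq i k) \<and>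
     (\<forall>i\<in>I. \<forall>j\<in>I. \<exists>k\<in>I. leq i k \<and> leq j k)"

text \<open>For \<open>leq i j\<close>, the transition map \<open>\<phi> i j\<close> goes from \<open>F j\<close> to \<open>F i\<close>.\<close>

definition inverse_system ::
    "('r, 'k) ring_scheme \<Rightarrow> 'i set \<Rightarrow> ('i \<Rightarrow> 'i \<Rightarrow> bool) \<Rightarrow> ('i \<Rightarrow> ('r, 'm) cplx)
      \<Rightarrow> ('i \<Rightarrow> 'i \<Rightarrow> int \<Rightarrow> 'm \<Rightarrow> 'm) \<Rightarrow> bool" where
  "inverse_system R I leq F \<phi> \<longleftrightarrow> directed_poset I leq \<and>
     (\<forall>i\<in>I. is_cplx R (F i)) \<and>
     (\<forall>i\<in>I. \<forall>j\<in>I. leq i j \<longrightarrow> \<phi> i j \<in> chain_maps R (F j) (F i)) \<and>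
     (\<forall>i\<in>I. \<forall>n. \<forall>x\<in>carrier (obj (F i) n). \<phi> i i n x = x) \<and>
     (\<forall>i\<in>I. \<forall>j\<in>I. \<forall>k\<in>I. leq i j \<and> leq j k \<longrightarrow>
        (\<forall>n. \<forall>x\<in>carrier (obj (F k) n). \<phi> i j n (\<phi> j k n x) = \<phi> i k n x))"

definition inverse_limit ::
    "'i set \<Rightarrow> ('i \<Rightarrow> 'i \<Rightarrow> bool) \<Rightarrow> ('i \<Rightarrow> ('r, 'm) cplx)
      \<Rightarrow> ('i \<Rightarrow> 'i \<Rightarrow> int \<Rightarrow> 'm \<Rightarrow> 'm) \<Rightarrow> ('r, 'i \<Rightarrow> 'm) cplx" where
  "inverse_limit I leq F \<phi> =
     \<lparr>obj = (\<lambda>n.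
        \<lparr>carrier = {x \<in> (\<Pi>\<^sub>E i\<in>I. carrier (obj (F i) n)).
                      \<forall>i\<in>I. \<forall>j\<in>I. leq i j \<longrightarrow> \<phi> i j n (x j) = x i},
         mult = undefined, one = undefined,
         zero = (\<lambda>i\<in>I. \<zero>\<^bsub>obj (F i) n\<^esub>),
         add = (\<lambda>x y. \<lambda>i\<in>I. x i \<oplus>\<^bsub>obj (F i) n\<^esub> y i),
         smult = (\<lambda>r x. \<lambda>i\<in>I. r \<odot>\<^bsub>obj (F i) n\<^esub> x i)\<rparr>),
      dif = (\<lambda>n x. \<lambda>i\<in>I. dif (F i) n (x i))\<rparr>"

definition closed_under_inverse_limits ::
    "('r, 'k) ring_scheme \<Rightarrow> 'm set set \<Rightarrow> ('r, 'm) cplx set \<Rightarrow> bool" where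
  "closed_under_inverse_limits R U \<C> \<longleftrightarrow>
     (\<forall>I\<in>U. \<forall>leq F \<phi>. inverse_system R I leq F \<phi> \<and> (\<forall>i\<in>I. F i \<in> \<C>) \<longrightarrow>
        (\<forall>L\<in>Cplxs R U. cplx_iso R L (inverse_limit I leq F \<phi>) \<longrightarrow> L \<in> \<C>))"

end

theory Submission
  imports "HOL-Algebra.Free_Abelian_Groups" "HOL-Algebra.IntRing" Defs
begin

text \<open>
  A complex \<open>C\<close> lies in \<open>C(X-injective)\<close> iff it is contractible with \<open>X\<close>-injective terms. Indeed,
  mapping into \<open>C\<close> from disc complexes shows that the terms are \<open>X\<close>-injective and hence belong to
  \<open>X\<close>; then a shift of \<open>C\<close> is an admissible test object, and the splitting of
  \<open>0 \<rightarrow> C \<rightarrow> cone (id\<^sub>C) \<rightarrow> C[1] \<rightarrow> 0\<close> is a contraction. Therefore a monic \<open>X\<close>-injective preenvelope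
  \<open>Y\<^sub>n \<rightarrow> E\<^sub>n\<close> of every term of \<open>Y\<close> yields the preenvelope of \<open>Y\<close> by the contractible complex with
  terms \<open>E\<^sub>n \<oplus> E\<^bsub>n-1\<^esub>\<close>. In (i) the preenvelopes of modules come
  from Salce's lemma and enough injectives; in (ii) they are part of completeness. The precovers are
  dual, except that in (ii) closure under inverse limits forces \<open>X\<close> to be the class of all modules,
  so that \<open>X\<close>-projective means projective.
\<close>

section \<open>Modules and homomorphisms\<close>

text \<open>The type \<open>'m\<close> shapes the formalisation. Pushouts, quotients, direct sums
  and groups of additive maps live on other types, whereas \<open>Ext1\<close> and the classes speak
  only of modules on members of \<open>U\<close>. So exact sequences are heterogeneous
  (\<open>ses\<close>, \<open>cplx_ses\<close>), each construction is shown to be small and replaced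
  by a copy in the universe, and vanishing of Ext^1 is used as splitting of extensions with a middle
  term of any type. The order of the two steps for \<open>C(X-injective)\<close> is forced: the cone
  sequence is a legitimate test only if the shift of \<open>C\<close> has terms in \<open>X\<close>,
  which is known only after the disc argument. In (ii), completeness gives surjections from a module
  in \<open>X\<close> with \<open>X\<close>-injective kernel, whereas precovers call for an
  \<open>X\<close>-projective source and a kernel in \<open>X\<close>. Once \<open>X\<close> is
  everything, free modules provide both. The inverse limit that proves this uses direct sums, under
  which a left orthogonal class such as \<open>X\<close> is closed; finiteness of supports is what
  cuts the limit down to the given module.\<close>

lemma left_moduleI:
  assumes "ring R" "abelian_group M"
    and "\<And>r x. \<lbrakk>r \<in> carrier R; x \<in> carrier M\<rbrakk> \<Longrightarrow> r \<odot>\<^bsub>M\<^esub> x \<in> carrier M"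
    and "\<And>r s x. \<lbrakk>r \<in> carrier R; s \<in> carrier R; x \<in> carrier M\<rbrakk>
        \<Longrightarrow> (r \<oplus>\<^bsub>R\<^esub> s) \<odot>\<^bsub>M\<^esub> x = r \<odot>\<^bsub>M\<^esub> x \<oplus>\<^bsub>M\<^esub> s \<odot>\<^bsub>M\<^esub> x"
    and "\<And>r x y. \<lbrakk>r \<in> carrier R; x \<in> carrier M; y \<in> carrier M\<rbrakk>
        \<Longrightarrow> r \<odot>\<^bsub>M\<^esub> (x \<oplus>\<^bsub>M\<^esub> y) = r \<odot>\<^bsub>M\<^esub> x \<oplus>\<^bsub>M\<^esub> r \<odot>\<^bsub>M\<^esub> y"
    and "\<And>r s x. \<lbrakk>r \<in> carrier R; s \<in> carrier R; x \<in> carrier M\<rbrakk>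
        \<Longrightarrow> (r \<otimes>\<^bsub>R\<^esub> s) \<odot>\<^bsub>M\<^esub> x = r \<odot>\<^bsub>M\<^esub> (s \<odot>\<^bsub>M\<^esub> x)"
    and "\<And>x. x \<in> carrier M \<Longrightarrow> \<one>\<^bsub>R\<^esub> \<odot>\<^bsub>M\<^esub> x = x"
  shows "left_module R M"
  using assms by (intro left_module.intro left_module_axioms.intro) auto

lemma left_module_ring: "left_module R M \<Longrightarrow> ring R"
  and left_module_group: "left_module R M \<Longrightarrow> abelian_group M"
  by (simp_all add: left_module_def)

context left_module
begin

lemma smult_zero_right: assumes r: "r \<in> carrier R" shows "r \<odot>\<^bsub>M\<^esub> \<zero>\<^bsub>M\<^esub> = \<zero>\<^bsub>M\<^esub>"
  by (metis M.add.l_cancel_one M.l_zero M.zero_closed r smult_closed smult_r_distr)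

lemma smult_zero_left: assumes x: "x \<in> carrier M" shows "\<zero>\<^bsub>R\<^esub> \<odot>\<^bsub>M\<^esub> x = \<zero>\<^bsub>M\<^esub>"
  by (metis M.add.l_cancel_one R.l_zero R.zero_closed smult_closed smult_l_distr x)

lemma smult_neg_right:
  assumes r: "r \<in> carrier R" and x: "x \<in> carrier M"
  shows "r \<odot>\<^bsub>M\<^esub> (\<ominus>\<^bsub>M\<^esub> x) = \<ominus>\<^bsub>M\<^esub> (r \<odot>\<^bsub>M\<^esub> x)"
  by (metis M.add.inv_closed M.add.inv_equality M.l_neg r smult_closed smult_r_distr smult_zero_right x)

lemma neg_eq_smult: assumes x: "x \<in> carrier M" shows "\<ominus>\<^bsub>M\<^esub> x = (\<ominus>\<^bsub>R\<^esub> \<one>\<^bsub>R\<^esub>) \<odot>\<^bsub>M\<^esub> x"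
  by (metis M.minus_equality R.add.inv_closed R.l_neg R.one_closed smult_closed smult_l_distr
      smult_one smult_zero_left x)

lemma minus_eq_zero_iff [simp]:
  assumes "x \<in> carrier M" "y \<in> carrier M"
  shows "x \<ominus>\<^bsub>M\<^esub> y = \<zero>\<^bsub>M\<^esub> \<longleftrightarrow> x = y"
  using assms by (metis M.add.inv_closed M.minus_eq M.minus_equality M.minus_minus M.r_neg)

lemma neg_zero [simp]: "\<ominus>\<^bsub>M\<^esub> \<zero>\<^bsub>M\<^esub> = \<zero>\<^bsub>M\<^esub>"
  using M.minus_equality M.r_zero by blast

lemma diff_zero [simp]: "x \<in> carrier M \<Longrightarrow> x \<ominus>\<^bsub>M\<^esub> \<zero>\<^bsub>M\<^esub> = x"
  by (simp add: a_minus_def)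

lemma neg_diff:
  assumes "x \<in> carrier M" "y \<in> carrier M"
  shows "\<ominus>\<^bsub>M\<^esub> (x \<ominus>\<^bsub>M\<^esub> y) = y \<ominus>\<^bsub>M\<^esub> x"
  using assms by (simp add: a_minus_def M.minus_add M.a_comm)

lemma diff_add_diff:
  assumes "x \<in> carrier M" "y \<in> carrier M" "z \<in> carrier M"
  shows "(x \<ominus>\<^bsub>M\<^esub> y) \<oplus>\<^bsub>M\<^esub> (y \<ominus>\<^bsub>M\<^esub> z) = x \<ominus>\<^bsub>M\<^esub> z"
  using assms by (simp add: a_minus_def M.a_assoc M.r_neg1)

lemma diff_add_cancel:
  assumes "x \<in> carrier M" "y \<in> carrier M"
  shows "(x \<ominus>\<^bsub>M\<^esub> y) \<oplus>\<^bsub>M\<^esub> y = x"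
  using assms by (simp add: a_minus_def M.a_assoc M.l_neg)

end

lemma hom_closed: "\<lbrakk>f \<in> rmod_hom R M N; x \<in> carrier M\<rbrakk> \<Longrightarrow> f x \<in> carrier N"
  and hom_add: "\<lbrakk>f \<in> rmod_hom R M N; x \<in> carrier M; y \<in> carrier M\<rbrakk>
      \<Longrightarrow> f (x \<oplus>\<^bsub>M\<^esub> y) = f x \<oplus>\<^bsub>N\<^esub> f y"
  and hom_smult: "\<lbrakk>f \<in> rmod_hom R M N; r \<in> carrier R; x \<in> carrier M\<rbrakk>
      \<Longrightarrow> f (r \<odot>\<^bsub>M\<^esub> x) = r \<odot>\<^bsub>N\<^esub> f x"
  by (auto simp: rmod_hom_def)

lemma homI:
  assumes "\<And>x. x \<in> carrier M \<Longrightarrow> f x \<in> carrier N"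
    and "\<And>x y. \<lbrakk>x \<in> carrier M; y \<in> carrier M\<rbrakk> \<Longrightarrow> f (x \<oplus>\<^bsub>M\<^esub> y) = f x \<oplus>\<^bsub>N\<^esub> f y"
    and "\<And>r x. \<lbrakk>r \<in> carrier R; x \<in> carrier M\<rbrakk> \<Longrightarrow> f (r \<odot>\<^bsub>M\<^esub> x) = r \<odot>\<^bsub>N\<^esub> f x"
  shows "f \<in> rmod_hom R M N"
  using assms by (auto simp: rmod_hom_def)

lemma hom_zero:
  assumes f: "f \<in> rmod_hom R M N" and M: "left_module R M" and N: "left_module R N"
  shows "f \<zero>\<^bsub>M\<^esub> = \<zero>\<^bsub>N\<^esub>"
proof -
  interpret M: left_module R M by fact
  interpret N: left_module R N by fact
  have "f \<zero>\<^bsub>M\<^esub> = f (\<zero>\<^bsub>R\<^esub> \<odot>\<^bsub>M\<^esub> \<zero>\<^bsub>M\<^esub>)" by (simp add: M.smult_zero_left)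
  also have "\<dots> = \<zero>\<^bsub>N\<^esub>" using f by (simp add: hom_smult N.smult_zero_left hom_closed)
  finally show ?thesis .
qed

lemma hom_neg:
  assumes f: "f \<in> rmod_hom R M N" and M: "left_module R M" and N: "left_module R N"
    and x: "x \<in> carrier M"
  shows "f (\<ominus>\<^bsub>M\<^esub> x) = \<ominus>\<^bsub>N\<^esub> f x"
proof -
  interpret M: left_module R M by fact
  interpret N: left_module R N by fact
  show ?thesis using f x by (simp add: M.neg_eq_smult N.neg_eq_smult hom_smult hom_closed)
qed

lemma hom_minus:
  assumes f: "f \<in> rmod_hom R M N" and M: "left_module R M" and N: "left_module R N"
    and x: "x \<in> carrier M" and y: "y \<in> carrier M"
  shows "f (x \<ominus>\<^bsub>M\<^esub> y) = f x \<ominus>\<^bsub>N\<^esub> f y"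
proof -
  interpret M: left_module R M by fact
  interpret N: left_module R N by fact
  show ?thesis using hom_add[OF f] hom_neg[OF f M N] x y by (simp add: a_minus_def)
qed

lemma hom_comp: "\<lbrakk>f \<in> rmod_hom R M N; g \<in> rmod_hom R N L\<rbrakk> \<Longrightarrow> (\<lambda>x. g (f x)) \<in> rmod_hom R M L"
  by (rule homI) (auto simp: hom_closed hom_add hom_smult)

lemma hom_id: "(\<lambda>x. x) \<in> rmod_hom R M M"
  by (rule homI) auto

lemma hom_const_zero: "left_module R N \<Longrightarrow> (\<lambda>x. \<zero>\<^bsub>N\<^esub>) \<in> rmod_hom R M N"
  using left_module.smult_zero_right[of R N]
  by (intro homI)
    (auto simp: abelian_monoid.zero_closed abelian_monoid.l_zero abelian_group.axioms(1)
      left_module_group)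

lemma hom_plus:
  assumes f: "f \<in> rmod_hom R M N" and g: "g \<in> rmod_hom R M N" and N: "left_module R N"
  shows "(\<lambda>x. f x \<oplus>\<^bsub>N\<^esub> g x) \<in> rmod_hom R M N"
proof -
  interpret N: left_module R N by fact
  show ?thesis
    using f g by (intro homI) (auto simp: hom_closed hom_add hom_smult N.smult_r_distr N.add.m_ac)
qed

lemma hom_uminus:
  assumes f: "f \<in> rmod_hom R M N" and N: "left_module R N"
  shows "(\<lambda>x. \<ominus>\<^bsub>N\<^esub> f x) \<in> rmod_hom R M N"
proof -
  interpret N: left_module R N by fact
  show ?thesis
    using f by (intro homI)
     (auto simp: hom_closed hom_add hom_smult N.smult_neg_right N.minus_add)
qed

lemma hom_diff:
  assumes f: "f \<in> rmod_hom R M N" and g: "g \<in> rmod_hom R M N" and N: "left_module R N"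
  shows "(\<lambda>x. f x \<ominus>\<^bsub>N\<^esub> g x) \<in> rmod_hom R M N"
  using hom_plus[OF f hom_uminus[OF g N] N] by (simp add: a_minus_def)

lemma hom_inj_iff:
  assumes f: "f \<in> rmod_hom R M N" and M: "left_module R M" and N: "left_module R N"
  shows "inj_on f (carrier M) \<longleftrightarrow> (\<forall>x\<in>carrier M. f x = \<zero>\<^bsub>N\<^esub> \<longrightarrow> x = \<zero>\<^bsub>M\<^esub>)"
proof -
  interpret M: left_module R M by fact
  interpret N: left_module R N by fact
  show ?thesis
  proof
    assume "inj_on f (carrier M)"
    then show "\<forall>x\<in>carrier M. f x = \<zero>\<^bsub>N\<^esub> \<longrightarrow> x = \<zero>\<^bsub>M\<^esub>"
      by (metis M.zero_closed hom_zero[OF f M N] inj_onD)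
  next
    assume *: "\<forall>x\<in>carrier M. f x = \<zero>\<^bsub>N\<^esub> \<longrightarrow> x = \<zero>\<^bsub>M\<^esub>"
    show "inj_on f (carrier M)"
    proof (rule inj_onI)
      fix x y assume xy: "x \<in> carrier M" "y \<in> carrier M" "f x = f y"
      then have "f (x \<ominus>\<^bsub>M\<^esub> y) = \<zero>\<^bsub>N\<^esub>"
        using hom_minus[OF f M N] hom_closed[OF f] by simp
      then have "x \<ominus>\<^bsub>M\<^esub> y = \<zero>\<^bsub>M\<^esub>" using * xy by blast
      then show "x = y" using xy by simp
    qed
  qed
qed

section \<open>Products, submodules, transport of structure and quotients\<close>

definition dprod :: "('r, 'a) module \<Rightarrow> ('r, 'b) module \<Rightarrow> ('r, 'a \<times> 'b) module" where
  "dprod M N = \<lparr>carrier = carrier M \<times> carrier N, monoid.mult = undefined, one = undefined,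
     zero = (\<zero>\<^bsub>M\<^esub>, \<zero>\<^bsub>N\<^esub>),
     add = (\<lambda>x y. (fst x \<oplus>\<^bsub>M\<^esub> fst y, snd x \<oplus>\<^bsub>N\<^esub> snd y)),
     smult = (\<lambda>r x. (r \<odot>\<^bsub>M\<^esub> fst x, r \<odot>\<^bsub>N\<^esub> snd x))\<rparr>"

lemma dprod_simps [simp]:
  "carrier (dprod M N) = carrier M \<times> carrier N"
  "\<zero>\<^bsub>dprod M N\<^esub> = (\<zero>\<^bsub>M\<^esub>, \<zero>\<^bsub>N\<^esub>)"
  "x \<oplus>\<^bsub>dprod M N\<^esub> y = (fst x \<oplus>\<^bsub>M\<^esub> fst y, snd x \<oplus>\<^bsub>N\<^esub> snd y)"
  "r \<odot>\<^bsub>dprod M N\<^esub> x = (r \<odot>\<^bsub>M\<^esub> fst x, r \<odot>\<^bsub>N\<^esub> snd x)"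
  by (simp_all add: dprod_def)

lemma dprod_left_module:
  assumes "left_module R M" "left_module R N"
  shows "left_module R (dprod M N)"
proof -
  interpret M: left_module R M by fact
  interpret N: left_module R N by fact
  show ?thesis
  proof (rule left_moduleI)
    show "abelian_group (dprod M N)"
    proof (rule abelian_groupI)
      fix x assume "x \<in> carrier (dprod M N)"
      then show "\<exists>y\<in>carrier (dprod M N). y \<oplus>\<^bsub>dprod M N\<^esub> x = \<zero>\<^bsub>dprod M N\<^esub>"
        by (intro bexI[of _ "(\<ominus>\<^bsub>M\<^esub> fst x, \<ominus>\<^bsub>N\<^esub> snd x)"]) (auto simp: M.l_neg N.l_neg)
    qed (auto simp: M.add.m_ac N.add.m_ac)
  qed (auto simp: M.smult_closed N.smult_closed M.smult_l_distr N.smult_l_distr M.smult_r_distr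
      N.smult_r_distr M.smult_assoc N.smult_assoc M.smult_one N.smult_one M.R.ring_axioms)
qed

lemma hom_fst: "fst \<in> rmod_hom R (dprod M N) M"
  and hom_snd: "snd \<in> rmod_hom R (dprod M N) N"
  by (rule homI; auto)+

lemma hom_Pair: "\<lbrakk>f \<in> rmod_hom R L M; g \<in> rmod_hom R L N\<rbrakk> \<Longrightarrow> (\<lambda>x. (f x, g x)) \<in> rmod_hom R L (dprod M N)"
  by (rule homI) (auto simp: hom_closed hom_add hom_smult)

lemma submodule_left_module:
  assumes "left_module R M" and "S \<subseteq> carrier M" and "\<zero>\<^bsub>M\<^esub> \<in> S"
    and add: "\<And>x y. \<lbrakk>x \<in> S; y \<in> S\<rbrakk> \<Longrightarrow> x \<oplus>\<^bsub>M\<^esub> y \<in> S"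
    and smult: "\<And>r x. \<lbrakk>r \<in> carrier R; x \<in> S\<rbrakk> \<Longrightarrow> r \<odot>\<^bsub>M\<^esub> x \<in> S"
  shows "left_module R (M\<lparr>carrier := S\<rparr>)"
proof -
  interpret M: left_module R M by fact
  have S: "x \<in> S \<Longrightarrow> x \<in> carrier M" for x using assms(2) by auto
  show ?thesis
  proof (rule left_moduleI)
    show "abelian_group (M\<lparr>carrier := S\<rparr>)"
    proof (rule abelian_groupI)
      fix x assume "x \<in> carrier (M\<lparr>carrier := S\<rparr>)"
      then have x: "x \<in> S" by simp
      then have "\<ominus>\<^bsub>M\<^esub> x \<in> S" using smult[of "\<ominus>\<^bsub>R\<^esub> \<one>\<^bsub>R\<^esub>" x] by (simp add: M.neg_eq_smult S)
      then show "\<exists>y\<in>carrier (M\<lparr>carrier := S\<rparr>). y \<oplus>\<^bsub>M\<lparr>carrier := S\<rparr>\<^esub> x = \<zero>\<^bsub>M\<lparr>carrier := S\<rparr>\<^esub>"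
        using x by (intro bexI[of _ "\<ominus>\<^bsub>M\<^esub> x"]) (auto simp: S M.l_neg)
    qed (use assms(3) in \<open>auto simp: add S M.add.m_ac\<close>)
  qed (auto simp: S smult add M.smult_closed M.smult_l_distr M.smult_r_distr M.smult_assoc M.smult_one M.R.ring_axioms)
qed

text \<open>
  The structure that a map \<open>q\<close> on \<open>M\<close> carries over to its image. It serves both as transport
  along an injective \<open>q\<close> and, when the fibres of \<open>q\<close> are the cosets of a submodule, as quotient.
\<close>

definition image_mod :: "('a \<Rightarrow> 'b) \<Rightarrow> ('r, 'a) module \<Rightarrow> ('r, 'b) module" where
  "image_mod q M = \<lparr>carrier = q ` carrier M, monoid.mult = undefined, one = undefined,
     zero = q \<zero>\<^bsub>M\<^esub>,
     add = (\<lambda>x y. q (inv_into (carrier M) q x \<oplus>\<^bsub>M\<^esub> inv_into (carrier M) q y)),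
     smult = (\<lambda>r x. q (r \<odot>\<^bsub>M\<^esub> inv_into (carrier M) q x))\<rparr>"

lemma image_mod:
  assumes "left_module R M"
    and add: "\<And>x x' y y'. \<lbrakk>x \<in> carrier M; x' \<in> carrier M; y \<in> carrier M; y' \<in> carrier M; q x = q x'; q y = q y'\<rbrakk>
       \<Longrightarrow> q (x \<oplus>\<^bsub>M\<^esub> y) = q (x' \<oplus>\<^bsub>M\<^esub> y')"
    and smult: "\<And>r x x'. \<lbrakk>r \<in> carrier R; x \<in> carrier M; x' \<in> carrier M; q x = q x'\<rbrakk>
       \<Longrightarrow> q (r \<odot>\<^bsub>M\<^esub> x) = q (r \<odot>\<^bsub>M\<^esub> x')"
  shows "left_module R (image_mod q M)"
    and "q \<in> rmod_hom R M (image_mod q M)"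
    and "carrier (image_mod q M) = q ` carrier M"
proof -
  interpret M: left_module R M by fact
  let ?Q = "image_mod q M"
  let ?g = "inv_into (carrier M) q"
  show c: "carrier ?Q = q ` carrier M" by (simp add: image_mod_def)
  have g: "?g (q x) \<in> carrier M" "q (?g (q x)) = q x" if "x \<in> carrier M" for x
    using that by (auto intro: inv_into_into f_inv_into_f)
  have z: "\<zero>\<^bsub>?Q\<^esub> = q \<zero>\<^bsub>M\<^esub>" by (simp add: image_mod_def)
  have a: "q x \<oplus>\<^bsub>?Q\<^esub> q y = q (x \<oplus>\<^bsub>M\<^esub> y)" if "x \<in> carrier M" "y \<in> carrier M" for x y
    using that g by (auto simp: image_mod_def intro: add)
  have s: "r \<odot>\<^bsub>?Q\<^esub> q x = q (r \<odot>\<^bsub>M\<^esub> x)" if "r \<in> carrier R" "x \<in> carrier M" for r x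
    using that g by (auto simp: image_mod_def intro: smult)
  show "q \<in> rmod_hom R M ?Q" by (rule homI) (auto simp: c a s)
  show "left_module R ?Q"
  proof (rule left_moduleI)
    show "abelian_group ?Q"
    proof (rule abelian_groupI)
      fix x assume "x \<in> carrier ?Q"
      then obtain u where u: "u \<in> carrier M" "x = q u" by (auto simp: c)
      then show "\<exists>y\<in>carrier ?Q. y \<oplus>\<^bsub>?Q\<^esub> x = \<zero>\<^bsub>?Q\<^esub>"
        by (intro bexI[of _ "q (\<ominus>\<^bsub>M\<^esub> u)"]) (auto simp: a z c M.l_neg)
    qed (auto simp: c z a M.add.m_ac)
  qed (auto simp: c a s M.smult_closed M.smult_l_distr M.smult_r_distr M.smult_assoc M.smult_one M.R.ring_axioms)
qed

text \<open>Over an injective map the fibres are points, so the compatibility conditions of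
  \<open>image_mod\<close> hold trivially and the inverse is linear too. This is how a module is
  moved to another type.\<close>

lemma image_mod_inj:
  assumes M: "left_module R M" and q: "inj_on q (carrier M)"
  shows "left_module R (image_mod q M)"
    and "q \<in> rmod_hom R M (image_mod q M)"
    and "carrier (image_mod q M) = q ` carrier M"
    and "inv_into (carrier M) q \<in> rmod_hom R (image_mod q M) M"
proof -
  interpret M: left_module R M by fact
  have qD: "x = x'" if "q x = q x'" "x \<in> carrier M" "x' \<in> carrier M" for x x'
    using that inj_onD[OF q] by blast
  note im = image_mod[OF M, of q]
  show Q: "left_module R (image_mod q M)" by (rule im; metis qD)
  show h: "q \<in> rmod_hom R M (image_mod q M)" by (rule im; metis qD)
  show c: "carrier (image_mod q M) = q ` carrier M" by (rule im; metis qD)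
  show "inv_into (carrier M) q \<in> rmod_hom R (image_mod q M) M"
    by (rule homI)
      (auto simp: c q hom_add[OF h, symmetric] hom_smult[OF h, symmetric] M.smult_closed)
qed

text \<open>The class of \<open>x\<close> is represented by its coset, a subset of the carrier,
  which explains the type \<open>'a set\<close>. Cosets add and scale independently of
  representatives, so \<open>image_mod\<close> puts the module structure on the set of
  cosets.\<close>

lemma quotient_module:
  fixes M :: "('r, 'a) module"
  assumes M: "left_module R M" and "K \<subseteq> carrier M" and "\<zero>\<^bsub>M\<^esub> \<in> K"
    and add: "\<And>x y. \<lbrakk>x \<in> K; y \<in> K\<rbrakk> \<Longrightarrow> x \<oplus>\<^bsub>M\<^esub> y \<in> K"
    and smult: "\<And>r x. \<lbrakk>r \<in> carrier R; x \<in> K\<rbrakk> \<Longrightarrow> r \<odot>\<^bsub>M\<^esub> x \<in> K"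
  obtains Q :: "('r, 'a set) module" and q where "left_module R Q" "q \<in> rmod_hom R M Q"
    "q ` carrier M = carrier Q" "\<And>x. x \<in> carrier M \<Longrightarrow> q x = \<zero>\<^bsub>Q\<^esub> \<longleftrightarrow> x \<in> K"
proof -
  interpret M: left_module R M by fact
  define q where "q x = {y \<in> carrier M. y \<ominus>\<^bsub>M\<^esub> x \<in> K}" for x
  have K: "x \<in> K \<Longrightarrow> x \<in> carrier M" for x using assms(2) by auto
  have neg: "\<ominus>\<^bsub>M\<^esub> x \<in> K" if "x \<in> K" for x using that smult[of "\<ominus>\<^bsub>R\<^esub> \<one>\<^bsub>R\<^esub>"] by (simp add: M.neg_eq_smult K)
  have q_eq: "q x = q y \<longleftrightarrow> x \<ominus>\<^bsub>M\<^esub> y \<in> K" if xy: "x \<in> carrier M" "y \<in> carrier M" for x y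
  proof
    assume "q x = q y"
    moreover have "x \<in> q x" using xy assms(3) by (simp add: q_def del: M.minus_eq_zero_iff) (metis M.minus_eq_zero_iff)
    ultimately show "x \<ominus>\<^bsub>M\<^esub> y \<in> K" by (simp add: q_def)
  next
    assume d: "x \<ominus>\<^bsub>M\<^esub> y \<in> K"
    have "z \<ominus>\<^bsub>M\<^esub> y = (z \<ominus>\<^bsub>M\<^esub> x) \<oplus>\<^bsub>M\<^esub> (x \<ominus>\<^bsub>M\<^esub> y)"
      "z \<ominus>\<^bsub>M\<^esub> x = (z \<ominus>\<^bsub>M\<^esub> y) \<oplus>\<^bsub>M\<^esub> (\<ominus>\<^bsub>M\<^esub> (x \<ominus>\<^bsub>M\<^esub> y))" if "z \<in> carrier M" for z
      using that xy by (simp_all add: M.diff_add_diff M.neg_diff)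
    then have "z \<ominus>\<^bsub>M\<^esub> y \<in> K \<longleftrightarrow> z \<ominus>\<^bsub>M\<^esub> x \<in> K" if "z \<in> carrier M" for z
      using that add d neg by metis
    then show "q x = q y" by (auto simp: q_def)
  qed
  have qa: "q (x \<oplus>\<^bsub>M\<^esub> y) = q (x' \<oplus>\<^bsub>M\<^esub> y')"
    if "x \<in> carrier M" "x' \<in> carrier M" "y \<in> carrier M" "y' \<in> carrier M" "q x = q x'" "q y = q y'" for x x' y y'
  proof -
    have "(x \<oplus>\<^bsub>M\<^esub> y) \<ominus>\<^bsub>M\<^esub> (x' \<oplus>\<^bsub>M\<^esub> y') = (x \<ominus>\<^bsub>M\<^esub> x') \<oplus>\<^bsub>M\<^esub> (y \<ominus>\<^bsub>M\<^esub> y')"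
      using that by (simp add: a_minus_def M.minus_add M.add.m_ac)
    then show ?thesis using that add by (simp add: q_eq)
  qed
  have qs: "q (r \<odot>\<^bsub>M\<^esub> x) = q (r \<odot>\<^bsub>M\<^esub> x')"
    if "r \<in> carrier R" "x \<in> carrier M" "x' \<in> carrier M" "q x = q x'" for r x x'
  proof -
    have "r \<odot>\<^bsub>M\<^esub> x \<ominus>\<^bsub>M\<^esub> r \<odot>\<^bsub>M\<^esub> x' = r \<odot>\<^bsub>M\<^esub> (x \<ominus>\<^bsub>M\<^esub> x')"
      using that by (simp add: a_minus_def M.smult_r_distr M.smult_neg_right)
    then show ?thesis using that smult by (simp add: q_eq M.smult_closed)
  qed
  show thesis
  proof (rule that[of "image_mod q M" q])
    show Q: "left_module R (image_mod q M)"
      by (rule image_mod(1)[OF M]) (erule (5) qa, erule (3) qs)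
    show h: "q \<in> rmod_hom R M (image_mod q M)"
      by (rule image_mod(2)[OF M]) (erule (5) qa, erule (3) qs)
    show "q ` carrier M = carrier (image_mod q M)"
      by (rule image_mod(3)[OF M, symmetric]) (erule (5) qa, erule (3) qs)
    show "q x = \<zero>\<^bsub>image_mod q M\<^esub> \<longleftrightarrow> x \<in> K" if "x \<in> carrier M" for x
      using that q_eq[OF that M.zero_closed] hom_zero[OF h M Q] by simp
  qed
qed

text \<open>The value at \<open>y\<close> is \<open>h\<close> of a chosen preimage. Two preimages
  differ by an element of the kernel of \<open>q\<close>, on which \<open>h\<close> vanishes, so the
  choice does not matter and linearity is inherited from \<open>q\<close> and
  \<open>h\<close>.\<close>

lemma factor_hom:
  assumes q: "q \<in> rmod_hom R T Q" and surj: "q ` carrier T = carrier Q"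
    and h: "h \<in> rmod_hom R T N" and ker: "\<And>t. \<lbrakk>t \<in> carrier T; q t = \<zero>\<^bsub>Q\<^esub>\<rbrakk> \<Longrightarrow> h t = \<zero>\<^bsub>N\<^esub>"
    and T: "left_module R T" and Q: "left_module R Q" and N: "left_module R N"
  obtains h' where "h' \<in> rmod_hom R Q N" "\<And>t. t \<in> carrier T \<Longrightarrow> h' (q t) = h t"
proof
  interpret T: left_module R T by fact
  interpret Q: left_module R Q by fact
  interpret N: left_module R N by fact
  define h' where "h' y = h (inv_into (carrier T) q y)" for y
  show eq: "h' (q t) = h t" if t: "t \<in> carrier T" for t
  proof -
    let ?u = "inv_into (carrier T) q (q t)"
    have u: "?u \<in> carrier T" "q ?u = q t" using t by (auto intro: inv_into_into f_inv_into_f)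
    have "q (?u \<ominus>\<^bsub>T\<^esub> t) = \<zero>\<^bsub>Q\<^esub>" using u t by (simp add: hom_minus[OF q T Q] hom_closed[OF q])
    then have "h (?u \<ominus>\<^bsub>T\<^esub> t) = \<zero>\<^bsub>N\<^esub>" using u t by (intro ker) auto
    then show ?thesis using u t by (simp add: hom_minus[OF h T N] h'_def hom_closed[OF h])
  qed
  show "h' \<in> rmod_hom R Q N"
    by (rule homI)
      (auto simp: surj[symmetric] eq hom_closed[OF h] hom_add[OF q, symmetric] hom_add[OF h]
        hom_smult[OF q, symmetric] hom_smult[OF h] T.smult_closed)
qed

section \<open>Smallness and extensions of modules\<close>

text \<open>\<open>short_exact\<close> puts all three modules on one type. Here the types are
  independent, because pushouts, fibre products and quotients occur as middle terms.\<close>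

definition ses ::
    "('r, 'k) ring_scheme \<Rightarrow> ('r, 'a) module \<Rightarrow> ('a \<Rightarrow> 'b) \<Rightarrow> ('r, 'b) module
      \<Rightarrow> ('b \<Rightarrow> 'c) \<Rightarrow> ('r, 'c) module \<Rightarrow> bool" where
  "ses R A i B p C \<longleftrightarrow>
     i \<in> rmod_hom R A B \<and> p \<in> rmod_hom R B C \<and>
     inj_on i (carrier A) \<and> p ` carrier B = carrier C \<and>
     i ` carrier A = {b \<in> carrier B. p b = \<zero>\<^bsub>C\<^esub>}"

lemma short_exact_eq_ses: "short_exact R A i B p C = ses R A i B p C"
  by (simp add: short_exact_def ses_def)

lemma sesI:
  assumes "i \<in> rmod_hom R A B" "p \<in> rmod_hom R B C" "left_module R A" "left_module R B"
    and "\<And>a. \<lbrakk>a \<in> carrier A; i a = \<zero>\<^bsub>B\<^esub>\<rbrakk> \<Longrightarrow> a = \<zero>\<^bsub>A\<^esub>"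
    and "\<And>c. c \<in> carrier C \<Longrightarrow> \<exists>b\<in>carrier B. p b = c"
    and "\<And>a. a \<in> carrier A \<Longrightarrow> p (i a) = \<zero>\<^bsub>C\<^esub>"
    and "\<And>b. \<lbrakk>b \<in> carrier B; p b = \<zero>\<^bsub>C\<^esub>\<rbrakk> \<Longrightarrow> \<exists>a\<in>carrier A. b = i a"
  shows "ses R A i B p C"
proof -
  have "inj_on i (carrier A)" using hom_inj_iff[OF assms(1,3,4)] assms(5) by blast
  moreover have "p ` carrier B = carrier C" using assms(6) hom_closed[OF assms(2)] by blast
  moreover have "i ` carrier A = {b \<in> carrier B. p b = \<zero>\<^bsub>C\<^esub>}"
    using assms(7,8) hom_closed[OF assms(1)] by blast
  ultimately show ?thesis using assms(1,2) by (simp add: ses_def)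
qed

lemma
  assumes "ses R A i B p C"
  shows ses_hom1: "i \<in> rmod_hom R A B" and ses_hom2: "p \<in> rmod_hom R B C"
    and ses_inj: "inj_on i (carrier A)"
    and ses_surj: "p ` carrier B = carrier C"
    and ses_zero: "\<And>a. a \<in> carrier A \<Longrightarrow> p (i a) = \<zero>\<^bsub>C\<^esub>"
    and ses_ker: "\<And>b. \<lbrakk>b \<in> carrier B; p b = \<zero>\<^bsub>C\<^esub>\<rbrakk> \<Longrightarrow> \<exists>a\<in>carrier A. b = i a"
  using assms unfolding ses_def by blast+

lemma ses_ex: "\<lbrakk>ses R A i B p C; c \<in> carrier C\<rbrakk> \<Longrightarrow> \<exists>b\<in>carrier B. p b = c"
  using ses_surj by (metis imageE)

text \<open>The dual of \<open>factor_hom\<close>: a map killed by \<open>p\<close> takes values in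
  the image of \<open>i\<close>, along which it can be pulled back because \<open>i\<close> is
  injective.\<close>

lemma ses_cofactor:
  assumes s: "ses R A i B p C" and h: "h \<in> rmod_hom R T B"
    and 0: "\<And>t. t \<in> carrier T \<Longrightarrow> p (h t) = \<zero>\<^bsub>C\<^esub>"
    and A: "left_module R A"
  obtains h' where "h' \<in> rmod_hom R T A" "\<And>t. t \<in> carrier T \<Longrightarrow> i (h' t) = h t"
proof
  interpret A: left_module R A by fact
  note i = ses_hom1[OF s]
  define h' where "h' t = inv_into (carrier A) i (h t)" for t
  have im: "h t \<in> i ` carrier A" if "t \<in> carrier T" for t
    using s 0[OF that] hom_closed[OF h that] by (simp add: ses_def)
  show eq: "i (h' t) = h t" if "t \<in> carrier T" for t
    using im[OF that] by (simp add: h'_def f_inv_into_f)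
  have cl: "h' t \<in> carrier A" if "t \<in> carrier T" for t
    using im[OF that] by (simp add: h'_def inv_into_into)
  have h'_i: "h' t = a" if "h t = i a" "a \<in> carrier A" for t a
    using that ses_inj[OF s] by (simp add: h'_def)
  show "h' \<in> rmod_hom R T A"
    by (rule homI)
      (auto intro!: h'_i simp: cl eq hom_add[OF i] hom_smult[OF i] hom_add[OF h] hom_smult[OF h] A.smult_closed)
qed

section \<open>Split exact sequences\<close>

definition splits ::
    "('r, 'k) ring_scheme \<Rightarrow> ('r, 'a) module \<Rightarrow> ('a \<Rightarrow> 'b) \<Rightarrow> ('r, 'b) module
      \<Rightarrow> ('b \<Rightarrow> 'c) \<Rightarrow> ('r, 'c) module \<Rightarrow> ('b \<Rightarrow> 'a) \<Rightarrow> ('c \<Rightarrow> 'b) \<Rightarrow> bool" where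
  "splits R A i B p C r s \<longleftrightarrow> r \<in> rmod_hom R B A \<and> s \<in> rmod_hom R C B \<and>
     (\<forall>a\<in>carrier A. r (i a) = a) \<and> (\<forall>c\<in>carrier C. p (s c) = c \<and> r (s c) = \<zero>\<^bsub>A\<^esub>) \<and>
     (\<forall>b\<in>carrier B. i (r b) \<oplus>\<^bsub>B\<^esub> s (p b) = b)"

text \<open>The endomorphism \<open>b - i (r b)\<close> kills the image of \<open>i\<close>, so it
  factors through \<open>p\<close>; the factor is the complementary section.\<close>

lemma ses_retraction_splits:
  assumes e: "ses R A i B p C" and A: "left_module R A" and B: "left_module R B" and C: "left_module R C"
    and r: "r \<in> rmod_hom R B A" "\<And>a. a \<in> carrier A \<Longrightarrow> r (i a) = a"
  obtains s where "splits R A i B p C r s"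
proof -
  interpret A: left_module R A by fact
  interpret B: left_module R B by fact
  interpret C: left_module R C by fact
  note i = ses_hom1[OF e] and p = ses_hom2[OF e]
  have h: "(\<lambda>b. b \<ominus>\<^bsub>B\<^esub> i (r b)) \<in> rmod_hom R B B"
    by (intro hom_diff hom_id hom_comp[OF r(1) i] B)
  have k: "b \<ominus>\<^bsub>B\<^esub> i (r b) = \<zero>\<^bsub>B\<^esub>" if "b \<in> carrier B" "p b = \<zero>\<^bsub>C\<^esub>" for b
    using ses_ker[OF e that] r(2) hom_closed[OF i] by auto
  obtain s where s: "s \<in> rmod_hom R C B" and sp: "\<And>b. b \<in> carrier B \<Longrightarrow> s (p b) = b \<ominus>\<^bsub>B\<^esub> i (r b)"
    using factor_hom[OF p ses_surj[OF e] h k B C B] by metis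
  have cl: "i (r b) \<in> carrier B" if "b \<in> carrier B" for b
    using that i r(1) by (simp add: hom_closed)
  have "splits R A i B p C r s"
    unfolding splits_def
  proof (intro conjI ballI)
    fix c assume c: "c \<in> carrier C"
    obtain b where b: "b \<in> carrier B" "p b = c" using ses_ex[OF e c] by blast
    then show "p (s c) = c" using cl sp[OF b(1)] hom_minus[OF p B C b(1) cl] ses_zero[OF e]
        hom_closed[OF r(1)] c by simp
    show "r (s c) = \<zero>\<^bsub>A\<^esub>" using b cl sp[OF b(1)] hom_minus[OF r(1) B A b(1) cl] r(2)
        hom_closed[OF r(1)] by simp
  next
    fix b assume b: "b \<in> carrier B"
    then show "i (r b) \<oplus>\<^bsub>B\<^esub> s (p b) = b"
      using cl by (simp add: sp B.a_comm[of "i (r b)"] B.diff_add_cancel)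
  qed (use r s in auto)
  then show thesis by (rule that)
qed

text \<open>The endomorphism \<open>b - s (p b)\<close> lands in the kernel of \<open>p\<close>, so
  it factors through \<open>i\<close>; the factor is the complementary retraction.\<close>

lemma ses_section_splits:
  assumes e: "ses R A i B p C" and A: "left_module R A" and B: "left_module R B" and C: "left_module R C"
    and s: "s \<in> rmod_hom R C B" "\<And>c. c \<in> carrier C \<Longrightarrow> p (s c) = c"
  obtains r where "splits R A i B p C r s"
proof -
  interpret A: left_module R A by fact
  interpret B: left_module R B by fact
  interpret C: left_module R C by fact
  note i = ses_hom1[OF e] and p = ses_hom2[OF e]
  have h: "(\<lambda>b. b \<ominus>\<^bsub>B\<^esub> s (p b)) \<in> rmod_hom R B B"
    by (intro hom_diff hom_id hom_comp[OF p s(1)] B)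
  have cl: "s (p b) \<in> carrier B" if "b \<in> carrier B" for b
    using that p s(1) by (simp add: hom_closed)
  have k: "p (b \<ominus>\<^bsub>B\<^esub> s (p b)) = \<zero>\<^bsub>C\<^esub>" if "b \<in> carrier B" for b
    using that s(2) hom_closed[OF p] by (simp add: hom_minus[OF p B C _ cl])
  obtain r where r: "r \<in> rmod_hom R B A" and ir: "\<And>b. b \<in> carrier B \<Longrightarrow> i (r b) = b \<ominus>\<^bsub>B\<^esub> s (p b)"
    using ses_cofactor[OF e h k A] by metis
  have inj: "a = a'" if "i a = i a'" "a \<in> carrier A" "a' \<in> carrier A" for a a'
    using that ses_inj[OF e] by (simp add: inj_on_eq_iff)
  have "splits R A i B p C r s"
    unfolding splits_def
  proof (intro conjI ballI)
    fix a assume a: "a \<in> carrier A"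
    show "r (i a) = a"
      using a by (intro inj) (simp_all add: hom_closed[OF i] hom_closed[OF r] ir ses_zero[OF e] hom_zero[OF s(1) C B])
  next
    fix c assume c: "c \<in> carrier C"
    show "p (s c) = c" using c s by simp
    show "r (s c) = \<zero>\<^bsub>A\<^esub>"
      using c s hom_closed[OF s(1) c]
      by (intro inj) (simp_all add: hom_closed[OF r] ir hom_zero[OF i A B])
  next
    fix b assume b: "b \<in> carrier B"
    then show "i (r b) \<oplus>\<^bsub>B\<^esub> s (p b) = b"
      using cl by (simp add: ir B.diff_add_cancel)
  qed (use r s in auto)
  then show thesis by (rule that)
qed

lemma ses_dprod:
  assumes "left_module R A" "left_module R B"
  shows "ses R A (\<lambda>a. (a, \<zero>\<^bsub>B\<^esub>)) (dprod A B) snd B"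
proof -
  interpret A: left_module R A by fact
  interpret B: left_module R B by fact
  show ?thesis
    by (rule sesI) (use assms in \<open>auto intro!: hom_snd hom_Pair hom_id hom_const_zero dprod_left_module A.zero_closed\<close>)
qed

text \<open>Replaces the middle term by an isomorphic copy, typically by one whose carrier belongs
  to \<open>U\<close>.\<close>

lemma ses_transport:
  assumes e: "ses R A i N p C" and A: "left_module R A" and M: "left_module R M" and N: "left_module R N"
    and h: "h \<in> rmod_hom R N M" "h' \<in> rmod_hom R M N"
    and inv: "\<And>x. x \<in> carrier N \<Longrightarrow> h' (h x) = x" "\<And>y. y \<in> carrier M \<Longrightarrow> h (h' y) = y"
  shows "ses R A (\<lambda>a. h (i a)) M (\<lambda>y. p (h' y)) C"
proof (rule sesI)
  note i = ses_hom1[OF e] and p = ses_hom2[OF e]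
  show "(\<lambda>a. h (i a)) \<in> rmod_hom R A M" by (rule hom_comp[OF i h(1)])
  show "(\<lambda>y. p (h' y)) \<in> rmod_hom R M C" by (rule hom_comp[OF h(2) p])
  show "a = \<zero>\<^bsub>A\<^esub>" if "a \<in> carrier A" "h (i a) = \<zero>\<^bsub>M\<^esub>" for a
  proof -
    have "i a = \<zero>\<^bsub>N\<^esub>" using that inv(1)[OF hom_closed[OF i that(1)]] hom_zero[OF h(2) M N] by simp
    then show ?thesis using ses_inj[OF e] hom_inj_iff[OF i A N] that by blast
  qed
  show "\<exists>b\<in>carrier M. p (h' b) = c" if "c \<in> carrier C" for c
    using ses_ex[OF e that] inv(1) hom_closed[OF h(1)] by metis
  show "p (h' (h (i a))) = \<zero>\<^bsub>C\<^esub>" if "a \<in> carrier A" for a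
    using that by (simp add: inv(1) hom_closed[OF i] ses_zero[OF e])
  show "\<exists>a\<in>carrier A. b = h (i a)" if "b \<in> carrier M" "p (h' b) = \<zero>\<^bsub>C\<^esub>" for b
    using ses_ker[OF e _ that(2)] that(1) inv(2) hom_closed[OF h(2)] by metis
qed (fact A M)+

text \<open>The substitute for membership in \<open>U\<close> on types other than \<open>'m\<close>:
  a module with small carrier has an isomorphic copy in \<open>Mods R U\<close>.\<close>

definition small :: "'m set set \<Rightarrow> 'a set \<Rightarrow> bool" where
  "small U S \<longleftrightarrow> (\<exists>A\<in>U. S \<lesssim> A)"

lemma small_lepoll: "\<lbrakk>small U T; S \<lesssim> T\<rbrakk> \<Longrightarrow> small U S"
  unfolding small_def using lepoll_trans by blast

lemma small_subset: "\<lbrakk>small U T; S \<subseteq> T\<rbrakk> \<Longrightarrow> small U S"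
  using small_lepoll subset_imp_lepoll by blast

lemma small_inj: "\<lbrakk>small U T; inj_on f S; f ` S \<subseteq> T\<rbrakk> \<Longrightarrow> small U S"
  by (rule small_lepoll) (auto simp: lepoll_def)

text \<open>By reflexivity each element lies in its own class; if all classes coincide, any element
  therefore lies in the class of any other one.\<close>

lemma singleton_quotient_iff:
  assumes "S \<noteq> {}" and refl: "\<And>x. x \<in> S \<Longrightarrow> (x, x) \<in> r" and "r \<subseteq> S \<times> S"
  shows "is_singleton (S // r) \<longleftrightarrow> (\<forall>x\<in>S. \<forall>y\<in>S. (x, y) \<in> r)"
proof
  assume "is_singleton (S // r)"
  then obtain K where K: "S // r = {K}" by (auto simp: is_singleton_def)
  then have "r `` {x} = K" if "x \<in> S" for x using quotientI[OF that, of r] by blast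
  then show "\<forall>x\<in>S. \<forall>y\<in>S. (x, y) \<in> r" using refl by blast
next
  assume *: "\<forall>x\<in>S. \<forall>y\<in>S. (x, y) \<in> r"
  then have "r `` {x} = S" if "x \<in> S" for x using that assms(3) by blast
  then have "S // r = {S}" using assms(1) by (auto simp: quotient_def)
  then show "is_singleton (S // r)" by (simp add: is_singleton_def)
qed

locale module_universe =
  fixes R :: "('r, 'k) ring_scheme" and U :: "'m set set"
  assumes ring: "ring R" and univ: "set_universe R U"
begin

lemma U_lepoll: "\<lbrakk>A \<in> U; B \<lesssim> A\<rbrakk> \<Longrightarrow> (B :: 'm set) \<in> U"
  using univ by (auto simp: set_universe_def)

lemma small_U [simp]: "A \<in> U \<Longrightarrow> small U A"
  by (auto simp: small_def)

lemma small_R: "small U (carrier R)"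
  using univ by (auto simp: set_universe_def small_def)

lemma obtain_infinite_U: obtains C where "C \<in> U" "infinite C"
  using univ by (auto simp: set_universe_def)

lemma small_infinite:
  assumes "small U S" obtains E where "E \<in> U" "infinite E" "S \<lesssim> E"
proof -
  obtain A where A: "A \<in> U" "S \<lesssim> A" using assms by (auto simp: small_def)
  obtain C where C: "C \<in> U" "infinite C" by (rule obtain_infinite_U)
  show thesis
  proof (cases "infinite A")
    case True then show thesis using A that by blast
  next
    case False
    then have "A \<lesssim> C" using C finite_lepoll_infinite by blast
    then show thesis using A C that lepoll_trans by blast
  qed
qed

lemma small_countable: "countable (S :: 'a set) \<Longrightarrow> small U S"
  by (metis obtain_infinite_U small_def infinite_le_lepoll lepoll_trans countable_def
      lepoll_def subset_UNIV)

lemma small_times: assumes "small U S" "small U T" shows "small U (S \<times> T)"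
proof -
  obtain A B where "A \<in> U" "S \<lesssim> A" "B \<in> U" "T \<lesssim> B" using assms by (auto simp: small_def)
  moreover have "\<forall>I\<in>U. \<forall>F\<in>I \<rightarrow> U. \<exists>B\<in>U. Sigma I F \<lesssim> B" using univ by (auto simp: set_universe_def)
  ultimately have "\<exists>C\<in>U. A \<times> B \<lesssim> C" by auto
  then show ?thesis
    unfolding small_def using times_lepoll_mono[OF \<open>S \<lesssim> A\<close> \<open>T \<lesssim> B\<close>] lepoll_trans by blast
qed

lemma small_Fpow: assumes "small U S" shows "small U (Fpow S)"
proof -
  obtain E where E: "E \<in> U" "infinite E" "S \<lesssim> E" using small_infinite[OF assms] .
  then obtain f where f: "inj_on f S" "f ` S \<subseteq> E" by (auto simp: lepoll_def)
  have "inj_on ((`) f) (Fpow S)"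
    by (rule inj_onI) (metis (no_types, lifting) Fpow_def f(1) inj_on_image_eq_iff mem_Collect_eq)
  moreover have "(`) f ` Fpow S \<subseteq> Fpow E" using f(2) by (auto simp: Fpow_def)
  ultimately have "Fpow S \<lesssim> Fpow E" by (auto simp: lepoll_def)
  also have "Fpow E \<approx> E" using E(2) by (rule eqpoll_Fpow)
  finally show ?thesis using E(1) by (auto simp: small_def)
qed

text \<open>Such a function is determined by its graph over the places where it differs from
  \<open>z\<close>. That graph is a finite subset of \<open>I \<times> A\<close>, and there are no
  more finite subsets than elements in an infinite set.\<close>

lemma small_finsupp:
  assumes I: "small U I" and A: "small U A" and F: "\<And>i. i \<in> I \<Longrightarrow> F i \<subseteq> A"
  shows "small U {x \<in> (\<Pi>\<^sub>E i\<in>I. F i). finite {i\<in>I. x i \<noteq> z i}}" (is "small U ?S")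
proof (rule small_inj[OF small_Fpow[OF small_times[OF I A]]])
  let ?g = "\<lambda>x. (\<lambda>i. (i, x i)) ` {i\<in>I. x i \<noteq> z i}"
  show "?g ` ?S \<subseteq> Fpow (I \<times> A)" using F by (fastforce simp: Fpow_def PiE_def Pi_def)
  show "inj_on ?g ?S"
  proof (rule inj_onI)
    fix x y assume xy: "x \<in> ?S" "y \<in> ?S" and eq: "?g x = ?g y"
    have mem: "(i, v) \<in> ?g w \<longleftrightarrow> i \<in> I \<and> v = w i \<and> w i \<noteq> z i" for i v w by auto
    have "x i = y i" if "i \<in> I" for i
      using mem[of i "x i" x] mem[of i "x i" y] mem[of i "y i" x] mem[of i "y i" y] that eq by metis
    then show "x = y" using xy by (auto intro: PiE_ext)
  qed
qed

text \<open>The place where closure of \<open>U\<close> under maps from \<open>R\<close> enters; it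
  bounds the coinduced modules from which injectives are made.\<close>

lemma small_PiE: assumes "small U S" shows "small U (carrier R \<rightarrow>\<^sub>E S)"
proof -
  obtain A where A: "A \<in> U" "S \<lesssim> A" using assms by (auto simp: small_def)
  then have "(carrier R \<rightarrow>\<^sub>E S) \<lesssim> (carrier R \<rightarrow>\<^sub>E A)" by (intro lepoll_funcset_right)
  moreover have "\<exists>B\<in>U. (carrier R \<rightarrow>\<^sub>E A) \<lesssim> B" using univ A(1) by (auto simp: set_universe_def)
  ultimately show ?thesis unfolding small_def using lepoll_trans by blast
qed

lemma Mods_left_module: "M \<in> Mods R U \<Longrightarrow> left_module R M"
  and Mods_small: "M \<in> Mods R U \<Longrightarrow> small U (carrier M)"
  by (auto simp: Mods_def)

text \<open>The way back into the universe: an embedding of the carrier into a member of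
  \<open>U\<close> transports the structure. The pair \<open>e\<close>, \<open>e'\<close> is kept
  because later sequences and chain maps are conjugated by it.\<close>

lemma obtain_Mods_iso:
  fixes N :: "('r, 'n) module"
  assumes N: "left_module R N" and sm: "small U (carrier N)"
  obtains M e e' where "M \<in> Mods R U" "e \<in> rmod_hom R N M" "e' \<in> rmod_hom R M N"
    "\<And>x. x \<in> carrier N \<Longrightarrow> e' (e x) = x" "\<And>y. y \<in> carrier M \<Longrightarrow> e (e' y) = y"
proof -
  obtain A where A: "A \<in> U" "carrier N \<lesssim> A" using sm by (auto simp: small_def)
  then obtain e where e: "inj_on e (carrier N)" "e ` carrier N \<subseteq> A" by (auto simp: lepoll_def)
  note im = image_mod_inj[OF N e(1)]
  show thesis
  proof (rule that[of "image_mod e N" e "inv_into (carrier N) e"])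
    show "image_mod e N \<in> Mods R U"
      unfolding Mods_def using im(1,3) U_lepoll[OF A(1) subset_imp_lepoll[OF e(2)]] by simp
    show "inv_into (carrier N) e (e x) = x" if "x \<in> carrier N" for x using that e by simp
    show "e (inv_into (carrier N) e y) = y" if "y \<in> carrier (image_mod e N)" for y
      using that im(3) by (simp add: f_inv_into_f)
  qed (use im in auto)
qed

text \<open>With a chosen set-theoretic section \<open>g\<close> of \<open>p\<close>, an element
  \<open>b\<close> is determined by \<open>p b\<close> and by the element of \<open>A\<close> that
  maps to \<open>b - g (p b)\<close>. Thus the middle term embeds into
  \<open>carrier A \<times> carrier C\<close>.\<close>

lemma ses_small:
  assumes e: "ses R A i B p C" and B: "left_module R B" and C: "left_module R C"
    and sm: "small U (carrier A)" "small U (carrier C)"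
  shows "small U (carrier B)"
proof -
  interpret B: left_module R B by fact
  interpret C: left_module R C by fact
  define g where "g c = (SOME b. b \<in> carrier B \<and> p b = c)" for c
  have g: "g c \<in> carrier B" "p (g c) = c" if "c \<in> carrier C" for c
    using someI_ex[of "\<lambda>b. b \<in> carrier B \<and> p b = c"] ses_ex[OF e that] unfolding g_def by blast+
  note pc = hom_closed[OF ses_hom2[OF e]]
  define f where "f b = (SOME a. a \<in> carrier A \<and> b \<ominus>\<^bsub>B\<^esub> g (p b) = i a)" for b
  have f: "f b \<in> carrier A" "b \<ominus>\<^bsub>B\<^esub> g (p b) = i (f b)" if b: "b \<in> carrier B" for b
  proof -
    have "p (b \<ominus>\<^bsub>B\<^esub> g (p b)) = \<zero>\<^bsub>C\<^esub>"
      using b g pc by (simp add: hom_minus[OF ses_hom2[OF e] B C])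
    then have "\<exists>a. a \<in> carrier A \<and> b \<ominus>\<^bsub>B\<^esub> g (p b) = i a"
      using ses_ker[OF e] b g pc by (metis B.minus_closed)
    then show "f b \<in> carrier A" "b \<ominus>\<^bsub>B\<^esub> g (p b) = i (f b)"
      using someI_ex[of "\<lambda>a. a \<in> carrier A \<and> b \<ominus>\<^bsub>B\<^esub> g (p b) = i a"] unfolding f_def by blast+
  qed
  show ?thesis
  proof (rule small_inj[OF small_times[OF sm]])
    show "(\<lambda>b. (f b, p b)) ` carrier B \<subseteq> carrier A \<times> carrier C" using f pc by auto
    show "inj_on (\<lambda>b. (f b, p b)) (carrier B)"
    proof (rule inj_onI)
      fix x y assume xy: "x \<in> carrier B" "y \<in> carrier B" "(f x, p x) = (f y, p y)"
      then have "x \<ominus>\<^bsub>B\<^esub> g (p x) = y \<ominus>\<^bsub>B\<^esub> g (p x)" using f by (metis Pair_inject)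
      then show "x = y" using xy g pc by (metis B.diff_add_cancel)
    qed
  qed
qed

lemma obtain_biproduct:
  assumes "A \<in> Mods R U" "B \<in> Mods R U"
  obtains T e e' where "T \<in> Mods R U" "e \<in> rmod_hom R (dprod A B) T" "e' \<in> rmod_hom R T (dprod A B)"
    "\<And>x. x \<in> carrier (dprod A B) \<Longrightarrow> e' (e x) = x" "\<And>y. y \<in> carrier T \<Longrightarrow> e (e' y) = y"
  using obtain_Mods_iso[OF dprod_left_module[OF Mods_left_module[OF assms(1)] Mods_left_module[OF assms(2)]]]
    small_times[OF Mods_small[OF assms(1)] Mods_small[OF assms(2)]] that by auto

section \<open>Vanishing of Ext^1 of modules as splitting of extensions\<close>

lemma extensions_iff: "(E, i, p) \<in> extensions R U A B \<longleftrightarrow> E \<in> Mods R U \<and> ses R B i E p A"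
  by (simp add: extensions_def short_exact_eq_ses)

text \<open>The split extension, on a copy of the direct sum in the universe, ensures that there is
  a class at all; otherwise the quotient would be empty instead of a singleton.\<close>

lemma Ext1_singleton_iff:
  assumes A: "A \<in> Mods R U" and B: "B \<in> Mods R U"
  shows "is_singleton (Ext1 R U A B) \<longleftrightarrow>
    (\<forall>x\<in>extensions R U A B. \<forall>y\<in>extensions R U A B. (x, y) \<in> ext_equiv R U A B)"
  unfolding Ext1_def
proof (rule singleton_quotient_iff)
  obtain T e e' where T: "T \<in> Mods R U" "e \<in> rmod_hom R (dprod B A) T" "e' \<in> rmod_hom R T (dprod B A)"
    "\<And>x. x \<in> carrier (dprod B A) \<Longrightarrow> e' (e x) = x" "\<And>y. y \<in> carrier T \<Longrightarrow> e (e' y) = y"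
    using obtain_biproduct[OF B A] by metis
  note mods = Mods_left_module[OF A] Mods_left_module[OF B] Mods_left_module[OF T(1)]
  have "ses R B (\<lambda>a. e (a, \<zero>\<^bsub>A\<^esub>)) T (\<lambda>y. snd (e' y)) A"
    by (rule ses_transport[OF ses_dprod _ _ _ T(2,3)]) (use mods T(4,5) in \<open>auto intro: dprod_left_module\<close>)
  then show "extensions R U A B \<noteq> {}" using T(1) extensions_iff by blast
  show "(x, x) \<in> ext_equiv R U A B" if "x \<in> extensions R U A B" for x
    using that hom_id by (cases x) (force simp: ext_equiv_def)
  show "ext_equiv R U A B \<subseteq> extensions R U A B \<times> extensions R U A B"
    by (auto simp: ext_equiv_def)
qed

text \<open>The type of \<open>N\<close> is arbitrary. A copy \<open>W\<close> of \<open>N\<close>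
  in the universe is equivalent to the split extension \<open>T\<close>, and the comparison map
  followed by the projection of \<open>T\<close> to \<open>B\<close> is a retraction of
  \<open>i\<close>.\<close>

lemma Ext1_splits:
  fixes N :: "('r, 'n) module"
  assumes A: "A \<in> Mods R U" and B: "B \<in> Mods R U" and sing: "is_singleton (Ext1 R U A B)"
    and N: "left_module R N" and e: "ses R B i N p A"
  obtains r s where "splits R B i N p A r s"
proof -
  note mA = Mods_left_module[OF A] and mB = Mods_left_module[OF B]
  obtain W f f' where W: "W \<in> Mods R U" and f: "f \<in> rmod_hom R N W" "f' \<in> rmod_hom R W N"
    "\<And>x. x \<in> carrier N \<Longrightarrow> f' (f x) = x" "\<And>y. y \<in> carrier W \<Longrightarrow> f (f' y) = y"
    using obtain_Mods_iso[OF N ses_small[OF e N mA]] Mods_small[OF A] Mods_small[OF B] by metis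
  obtain T t t' where T: "T \<in> Mods R U" and t: "t \<in> rmod_hom R (dprod B A) T" "t' \<in> rmod_hom R T (dprod B A)"
    "\<And>x. x \<in> carrier (dprod B A) \<Longrightarrow> t' (t x) = x" "\<And>y. y \<in> carrier T \<Longrightarrow> t (t' y) = y"
    using obtain_biproduct[OF B A] by metis
  note mW = Mods_left_module[OF W] and mT = Mods_left_module[OF T]
  interpret A: left_module R A by fact
  have "ses R B (\<lambda>a. t (a, \<zero>\<^bsub>A\<^esub>)) T (\<lambda>y. snd (t' y)) A"
    by (rule ses_transport[OF ses_dprod _ _ _ t(1,2)]) (use mA mB mT t in \<open>auto intro: dprod_left_module\<close>)
  moreover have "ses R B (\<lambda>b. f (i b)) W (\<lambda>y. p (f' y)) A"
    by (rule ses_transport[OF e mB mW N f])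
  ultimately have "((W, \<lambda>b. f (i b), \<lambda>y. p (f' y)), (T, \<lambda>a. t (a, \<zero>\<^bsub>A\<^esub>), \<lambda>y. snd (t' y))) \<in> ext_equiv R U A B"
    using sing W T unfolding Ext1_singleton_iff[OF A B] extensions_iff by (metis extensions_iff)
  then obtain h where h: "h \<in> rmod_hom R W T" "\<And>b. b \<in> carrier B \<Longrightarrow> h (f (i b)) = t (b, \<zero>\<^bsub>A\<^esub>)"
    by (auto simp: ext_equiv_def)
  have "(\<lambda>x. fst (t' (h (f x)))) \<in> rmod_hom R N B"
    by (rule hom_comp[OF f(1) hom_comp[OF h(1) hom_comp[OF t(2) hom_fst]]])
  moreover have "fst (t' (h (f (i b)))) = b" if "b \<in> carrier B" for b
    using that by (simp add: h(2) t(3))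
  ultimately show thesis using ses_retraction_splits[OF e mB N mA] that by metis
qed

lemma Ext1_singletonI:
  assumes A: "A \<in> Mods R U" and B: "B \<in> Mods R U"
    and sp: "\<And>W i p. \<lbrakk>W \<in> Mods R U; ses R B i W p A\<rbrakk> \<Longrightarrow> \<exists>r s. splits R B i W p A r s"
  shows "is_singleton (Ext1 R U A B)"
  unfolding Ext1_singleton_iff[OF A B]
proof (clarify)
  fix W i p V j q
  assume WV: "(W, i, p) \<in> extensions R U A B" "(V, j, q) \<in> extensions R U A B"
  then have W: "W \<in> Mods R U" "ses R B i W p A" and V: "V \<in> Mods R U" "ses R B j V q A"
    by (auto simp: extensions_iff)
  obtain r s where r: "splits R B i W p A r s" using sp[OF W] by blast
  obtain r' s' where s: "splits R B j V q A r' s'" using sp[OF V] by blast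
  note hom = ses_hom1[OF W(2)] ses_hom2[OF W(2)] ses_hom1[OF V(2)] ses_hom2[OF V(2)]
  note mods = Mods_left_module[OF A] Mods_left_module[OF B] Mods_left_module[OF W(1)] Mods_left_module[OF V(1)]
  interpret A: left_module R A by (fact mods)
  interpret B: left_module R B by (fact mods)
  interpret V: left_module R V by (fact mods)
  have rh: "r \<in> rmod_hom R W B" and sh: "s' \<in> rmod_hom R A V" using r s by (auto simp: splits_def)
  \<comment> \<open>With both extensions split, the comparison map is the sum of the paths
    \<open>W -> B -> V\<close> and \<open>W -> A -> V\<close>.\<close>
  define h where "h = (\<lambda>e. j (r e) \<oplus>\<^bsub>V\<^esub> s' (p e))"
  have "h \<in> rmod_hom R W V"
    unfolding h_def by (intro hom_plus hom_comp[OF rh hom(3)] hom_comp[OF hom(2) sh] mods)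
  moreover have "h (i b) = j b" if "b \<in> carrier B" for b
    using r that hom_closed[OF hom(3)] by (simp add: h_def splits_def ses_zero[OF W(2)] hom_zero[OF sh mods(1,4)])
  moreover have "q (h x) = p x" if "x \<in> carrier W" for x
    using s that hom_closed[OF hom(2)] hom_closed[OF hom(3)] hom_closed[OF rh] hom_closed[OF sh]
    by (simp add: h_def splits_def hom_add[OF hom(4)] ses_zero[OF V(2)])
  ultimately show "((W, i, p), (V, j, q)) \<in> ext_equiv R U A B"
    using WV by (auto simp: ext_equiv_def)
qed

end

section \<open>Pushouts, fibre products and orthogonal classes\<close>

text \<open>The quotient of the direct sum of \<open>F\<close> and \<open>A\<close> by the
  antidiagonal copy of \<open>K\<close>, described by the kernel of \<open>q\<close> rather than by
  a particular construction, so that the roles of \<open>F\<close> and \<open>A\<close> can be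
  exchanged on the same \<open>Q\<close>.\<close>

definition pushout ::
    "('r, 'k) ring_scheme \<Rightarrow> ('r, 'a) module \<Rightarrow> ('a \<Rightarrow> 'b) \<Rightarrow> ('r, 'b) module
      \<Rightarrow> ('a \<Rightarrow> 'c) \<Rightarrow> ('r, 'c) module \<Rightarrow> ('b \<times> 'c \<Rightarrow> 'd) \<Rightarrow> ('r, 'd) module \<Rightarrow> bool" where
  "pushout R K f F g A q Q \<longleftrightarrow> left_module R Q \<and> q \<in> rmod_hom R (dprod F A) Q \<and>
     q ` carrier (dprod F A) = carrier Q \<and>
     (\<forall>x\<in>carrier F. \<forall>y\<in>carrier A.
        q (x, y) = \<zero>\<^bsub>Q\<^esub> \<longleftrightarrow> (\<exists>k\<in>carrier K. x = f k \<and> y = \<ominus>\<^bsub>A\<^esub> g k))"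

lemma obtain_pushout:
  fixes F :: "('r, 'b) module" and A :: "('r, 'c) module"
  assumes K: "left_module R K" and F: "left_module R F" and A: "left_module R A"
    and f: "f \<in> rmod_hom R K F" and g: "g \<in> rmod_hom R K A"
  obtains Q :: "('r, ('b \<times> 'c) set) module" and q where "pushout R K f F g A q Q"
proof -
  interpret K: left_module R K by fact
  interpret A: left_module R A by fact
  let ?h = "\<lambda>k. (f k, \<ominus>\<^bsub>A\<^esub> g k)"
  have h: "?h \<in> rmod_hom R K (dprod F A)" by (intro hom_Pair hom_uminus f g A)
  note D = dprod_left_module[OF F A]
  obtain Q :: "('r, ('b \<times> 'c) set) module" and q where "left_module R Q" "q \<in> rmod_hom R (dprod F A) Q"
    "q ` carrier (dprod F A) = carrier Q"
    "\<And>x. x \<in> carrier (dprod F A) \<Longrightarrow> q x = \<zero>\<^bsub>Q\<^esub> \<longleftrightarrow> x \<in> ?h ` carrier K"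
  proof (rule quotient_module[OF D, of "?h ` carrier K"])
    show "?h ` carrier K \<subseteq> carrier (dprod F A)" using hom_closed[OF h] by blast
    show "\<zero>\<^bsub>dprod F A\<^esub> \<in> ?h ` carrier K" unfolding hom_zero[OF h K D, symmetric] by (intro imageI K.zero_closed)
    show "x \<oplus>\<^bsub>dprod F A\<^esub> y \<in> ?h ` carrier K" if "x \<in> ?h ` carrier K" "y \<in> ?h ` carrier K" for x y
    proof -
      obtain k l where kl: "k \<in> carrier K" "l \<in> carrier K" "x = ?h k" "y = ?h l" using \<open>x \<in> _\<close> \<open>y \<in> _\<close> by blast
      show ?thesis unfolding kl(3,4) hom_add[OF h kl(1,2), symmetric] using kl(1,2) by (intro imageI) simp
    qed
    show "r \<odot>\<^bsub>dprod F A\<^esub> x \<in> ?h ` carrier K" if "r \<in> carrier R" "x \<in> ?h ` carrier K" for r x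
    proof -
      obtain k where k: "k \<in> carrier K" "x = ?h k" using \<open>x \<in> _\<close> by blast
      show ?thesis unfolding k(2) hom_smult[OF h \<open>r \<in> _\<close> k(1), symmetric]
        using k(1) \<open>r \<in> _\<close> by (intro imageI K.smult_closed)
    qed
  qed blast
  then have "pushout R K f F g A q Q" by (auto simp: pushout_def)
  then show thesis by (rule that)
qed

text \<open>Passing from \<open>k\<close> to \<open>- k\<close> moves the minus sign in the kernel
  to the other component. Together with \<open>pushout_ses\<close> this gives the exact sequences
  along both edges of the square.\<close>

lemma pushout_swap:
  assumes K: "left_module R K" and F: "left_module R F" and A: "left_module R A"
    and f: "f \<in> rmod_hom R K F" and g: "g \<in> rmod_hom R K A" and po: "pushout R K f F g A q Q"
  shows "pushout R K g A f F (\<lambda>(y, x). q (x, y)) Q"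
proof -
  interpret K: left_module R K by fact
  interpret A: left_module R A by fact
  interpret F: left_module R F by fact
  have q: "q \<in> rmod_hom R (dprod F A) Q" using po by (simp add: pushout_def)
  have "(\<lambda>z. q (snd z, fst z)) \<in> rmod_hom R (dprod A F) Q"
    by (rule hom_comp[OF _ q]) (intro hom_Pair hom_fst hom_snd)
  then have 1: "(\<lambda>(y, x). q (x, y)) \<in> rmod_hom R (dprod A F) Q" by (simp add: case_prod_beta')
  have "(\<lambda>(y, x). q (x, y)) ` carrier (dprod A F) = q ` carrier (dprod F A)" by (force simp: image_iff)
  then have 2: "(\<lambda>(y, x). q (x, y)) ` carrier (dprod A F) = carrier Q" using po by (simp add: pushout_def)
  have 3: "(\<exists>k\<in>carrier K. x = f k \<and> y = \<ominus>\<^bsub>A\<^esub> g k) \<longleftrightarrow> (\<exists>k\<in>carrier K. y = g k \<and> x = \<ominus>\<^bsub>F\<^esub> f k)" for x y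
  proof
    assume "\<exists>k\<in>carrier K. x = f k \<and> y = \<ominus>\<^bsub>A\<^esub> g k"
    then obtain k where k: "k \<in> carrier K" "x = f k" "y = \<ominus>\<^bsub>A\<^esub> g k" by blast
    then show "\<exists>k\<in>carrier K. y = g k \<and> x = \<ominus>\<^bsub>F\<^esub> f k"
      by (intro bexI[of _ "\<ominus>\<^bsub>K\<^esub> k"]) (auto simp: hom_neg[OF f K F] hom_neg[OF g K A] hom_closed[OF f])
  next
    assume "\<exists>k\<in>carrier K. y = g k \<and> x = \<ominus>\<^bsub>F\<^esub> f k"
    then obtain k where k: "k \<in> carrier K" "y = g k" "x = \<ominus>\<^bsub>F\<^esub> f k" by blast
    then show "\<exists>k\<in>carrier K. x = f k \<and> y = \<ominus>\<^bsub>A\<^esub> g k"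
      by (intro bexI[of _ "\<ominus>\<^bsub>K\<^esub> k"]) (auto simp: hom_neg[OF f K F] hom_neg[OF g K A] hom_closed[OF g])
  qed
  show ?thesis using po 1 2 3 by (auto simp: pushout_def)
qed

lemma pushout_comm:
  assumes K: "left_module R K" and F: "left_module R F" and A: "left_module R A"
    and f: "f \<in> rmod_hom R K F" and g: "g \<in> rmod_hom R K A" and po: "pushout R K f F g A q Q"
    and k: "k \<in> carrier K"
  shows "q (f k, \<zero>\<^bsub>A\<^esub>) = q (\<zero>\<^bsub>F\<^esub>, g k)"
proof -
  interpret F: left_module R F by fact
  interpret A: left_module R A by fact
  interpret Q: left_module R Q using po by (simp add: pushout_def)
  have q: "q \<in> rmod_hom R (dprod F A) Q" using po by (simp add: pushout_def)
  note cl = hom_closed[OF f k] hom_closed[OF g k]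
  note add = hom_add[OF q, of "(f k, \<ominus>\<^bsub>A\<^esub> g k)" "(\<zero>\<^bsub>F\<^esub>, g k)"]
  have "q (f k, \<ominus>\<^bsub>A\<^esub> g k) = \<zero>\<^bsub>Q\<^esub>" using po k cl by (auto simp: pushout_def)
  moreover have "q (\<zero>\<^bsub>F\<^esub>, g k) \<in> carrier Q" using cl by (intro hom_closed[OF q]) auto
  ultimately show ?thesis using add cl by (simp add: A.l_neg)
qed

text \<open>Pushing out preserves the cokernel: \<open>p\<close> on the first component vanishes on
  the kernel of \<open>q\<close> and induces \<open>p'\<close>. If the class of
  \<open>(0, a)\<close> vanishes, injectivity of \<open>f\<close> forces \<open>k = 0\<close> and
  hence \<open>a = 0\<close>.\<close>

lemma pushout_ses:
  assumes e: "ses R K f F p M" and K: "left_module R K" and F: "left_module R F" and A: "left_module R A"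
    and M: "left_module R M" and g: "g \<in> rmod_hom R K A" and po: "pushout R K f F g A q Q"
  obtains p' where "ses R A (\<lambda>y. q (\<zero>\<^bsub>F\<^esub>, y)) Q p' M"
    "\<And>x y. \<lbrakk>x \<in> carrier F; y \<in> carrier A\<rbrakk> \<Longrightarrow> p' (q (x, y)) = p x"
proof -
  interpret K: left_module R K by fact
  interpret F: left_module R F by fact
  interpret A: left_module R A by fact
  note f = ses_hom1[OF e] and p = ses_hom2[OF e] and D = dprod_left_module[OF F A]
  have Q: "left_module R Q" and q: "q \<in> rmod_hom R (dprod F A) Q" "q ` carrier (dprod F A) = carrier Q"
    and q0: "\<And>x y. \<lbrakk>x \<in> carrier F; y \<in> carrier A\<rbrakk> \<Longrightarrow> 
        q (x, y) = \<zero>\<^bsub>Q\<^esub> \<longleftrightarrow> (\<exists>k\<in>carrier K. x = f k \<and> y = \<ominus>\<^bsub>A\<^esub> g k)"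
    using po by (auto simp: pushout_def)
  interpret Q: left_module R Q by fact
  have h: "(\<lambda>z. p (fst z)) \<in> rmod_hom R (dprod F A) M" by (rule hom_comp[OF hom_fst p])
  have k: "p (fst z) = \<zero>\<^bsub>M\<^esub>" if z: "z \<in> carrier (dprod F A)" "q z = \<zero>\<^bsub>Q\<^esub>" for z
    using z q0[of "fst z" "snd z"] ses_zero[OF e] by auto
  obtain p' where p': "p' \<in> rmod_hom R Q M" "\<And>z. z \<in> carrier (dprod F A) \<Longrightarrow> p' (q z) = p (fst z)"
    using factor_hom[OF q h k D Q M] by metis
  have in_hom: "(\<lambda>y. q (\<zero>\<^bsub>F\<^esub>, y)) \<in> rmod_hom R A Q"
    by (rule hom_comp[OF _ q(1)]) (intro hom_Pair hom_id hom_const_zero F)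
  have "ses R A (\<lambda>y. q (\<zero>\<^bsub>F\<^esub>, y)) Q p' M"
  proof (rule sesI)
    fix a assume "a \<in> carrier A" "q (\<zero>\<^bsub>F\<^esub>, a) = \<zero>\<^bsub>Q\<^esub>"
    then obtain k where "k \<in> carrier K" "\<zero>\<^bsub>F\<^esub> = f k" "a = \<ominus>\<^bsub>A\<^esub> g k" using q0 by auto
    moreover then have "k = \<zero>\<^bsub>K\<^esub>" using ses_inj[OF e] hom_inj_iff[OF f K F] by metis
    ultimately show "a = \<zero>\<^bsub>A\<^esub>" by (simp add: hom_zero[OF g K A])
  next
    fix c assume "c \<in> carrier M"
    then obtain x where "x \<in> carrier F" "p x = c" using ses_ex[OF e] by blast
    then show "\<exists>b\<in>carrier Q. p' b = c"
      using p'(2)[of "(x, \<zero>\<^bsub>A\<^esub>)"] hom_closed[OF q(1), of "(x, \<zero>\<^bsub>A\<^esub>)"] by auto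
  next
    fix a assume "a \<in> carrier A"
    then show "p' (q (\<zero>\<^bsub>F\<^esub>, a)) = \<zero>\<^bsub>M\<^esub>" using p'(2) hom_zero[OF p F M] by simp
  next
    fix b assume b: "b \<in> carrier Q" "p' b = \<zero>\<^bsub>M\<^esub>"
    then obtain x y where xy: "x \<in> carrier F" "y \<in> carrier A" "b = q (x, y)"
      unfolding q(2)[symmetric] by auto
    then have "p x = \<zero>\<^bsub>M\<^esub>" using b p'(2) by simp
    then obtain k where k: "k \<in> carrier K" "x = f k" using ses_ker[OF e] xy by blast
    note cl = hom_closed[OF f k(1)] hom_closed[OF g k(1)]
    have "b = q (f k, \<zero>\<^bsub>A\<^esub>) \<oplus>\<^bsub>Q\<^esub> q (\<zero>\<^bsub>F\<^esub>, y)"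
      using xy k cl hom_add[OF q(1), of "(f k, \<zero>\<^bsub>A\<^esub>)" "(\<zero>\<^bsub>F\<^esub>, y)"] by simp
    also have "\<dots> = q (\<zero>\<^bsub>F\<^esub>, g k \<oplus>\<^bsub>A\<^esub> y)"
      using xy k cl hom_add[OF in_hom cl(2) xy(2)] pushout_comm[OF K F A f g po k(1)] by simp
    finally show "\<exists>a\<in>carrier A. b = q (\<zero>\<^bsub>F\<^esub>, a)" using cl xy by blast
  qed (fact in_hom p'(1) A Q)+
  moreover have "p' (q (x, y)) = p x" if "x \<in> carrier F" "y \<in> carrier A" for x y
    using p'(2)[of "(x, y)"] that by simp
  ultimately show thesis by (rule that)
qed

section \<open>Fibre products\<close>

definition fibre_product ::
    "('r, 'a) module \<Rightarrow> ('a \<Rightarrow> 'c) \<Rightarrow> ('r, 'b) module \<Rightarrow> ('b \<Rightarrow> 'c) \<Rightarrow> ('r, 'a \<times> 'b) module" where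
  "fibre_product N p P g =
     (dprod N P)\<lparr>carrier := {z \<in> carrier N \<times> carrier P. p (fst z) = g (snd z)}\<rparr>"

lemma fibre_product_simps [simp]:
  "carrier (fibre_product N p P g) = {z \<in> carrier N \<times> carrier P. p (fst z) = g (snd z)}"
  "\<zero>\<^bsub>fibre_product N p P g\<^esub> = (\<zero>\<^bsub>N\<^esub>, \<zero>\<^bsub>P\<^esub>)"
  "x \<oplus>\<^bsub>fibre_product N p P g\<^esub> y = (fst x \<oplus>\<^bsub>N\<^esub> fst y, snd x \<oplus>\<^bsub>P\<^esub> snd y)"
  "r \<odot>\<^bsub>fibre_product N p P g\<^esub> x = (r \<odot>\<^bsub>N\<^esub> fst x, r \<odot>\<^bsub>P\<^esub> snd x)"
  by (simp_all add: fibre_product_def)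

lemma fibre_product_left_module:
  assumes N: "left_module R N" and P: "left_module R P" and M: "left_module R M"
    and p: "p \<in> rmod_hom R N M" and g: "g \<in> rmod_hom R P M"
  shows "left_module R (fibre_product N p P g)"
proof -
  interpret N: left_module R N by fact
  interpret P: left_module R P by fact
  show ?thesis
    unfolding fibre_product_def
    by (rule submodule_left_module[OF dprod_left_module[OF N P]])
      (auto simp: hom_zero[OF p N M] hom_zero[OF g P M] hom_add[OF p] hom_add[OF g] hom_smult[OF p]
        hom_smult[OF g] N.smult_closed P.smult_closed)
qed

lemma fibre_product_fst: "fst \<in> rmod_hom R (fibre_product N p P g) N"
  and fibre_product_snd: "snd \<in> rmod_hom R (fibre_product N p P g) P"
  by (rule homI; auto)+

lemma fibre_product_hom_Pair:
  assumes "f \<in> rmod_hom R L N" "h \<in> rmod_hom R L P" "\<And>x. x \<in> carrier L \<Longrightarrow> p (f x) = g (h x)"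
  shows "(\<lambda>x. (f x, h x)) \<in> rmod_hom R L (fibre_product N p P g)"
  using assms by (intro homI) (auto simp: hom_closed hom_add hom_smult)

text \<open>Pulling back preserves the kernel; surjectivity of the second projection comes from that
  of \<open>p\<close>.\<close>

lemma fibre_product_ses:
  assumes e: "ses R K i N p M" and K: "left_module R K" and N: "left_module R N" and P: "left_module R P"
    and M: "left_module R M" and g: "g \<in> rmod_hom R P M"
  shows "ses R K (\<lambda>k. (i k, \<zero>\<^bsub>P\<^esub>)) (fibre_product N p P g) snd P"
proof (rule sesI)
  interpret P: left_module R P by fact
  note i = ses_hom1[OF e] and p = ses_hom2[OF e]
  show "left_module R (fibre_product N p P g)" by (rule fibre_product_left_module[OF N P M p g])
  show "(\<lambda>k. (i k, \<zero>\<^bsub>P\<^esub>)) \<in> rmod_hom R K (fibre_product N p P g)"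
    by (intro fibre_product_hom_Pair i hom_const_zero P) (simp add: ses_zero[OF e] hom_zero[OF g P M])
  show "a = \<zero>\<^bsub>K\<^esub>" if "a \<in> carrier K" "(i a, \<zero>\<^bsub>P\<^esub>) = \<zero>\<^bsub>fibre_product N p P g\<^esub>" for a
    using that ses_inj[OF e] hom_inj_iff[OF i K N] by auto
  show "\<exists>b\<in>carrier (fibre_product N p P g). snd b = c" if "c \<in> carrier P" for c
    using that ses_ex[OF e hom_closed[OF g that]] by auto
  show "\<exists>a\<in>carrier K. b = (i a, \<zero>\<^bsub>P\<^esub>)" if b: "b \<in> carrier (fibre_product N p P g)" "snd b = \<zero>\<^bsub>P\<^esub>" for b
  proof -
    have "p (fst b) = \<zero>\<^bsub>M\<^esub>" using b by (auto simp: hom_zero[OF g P M])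
    moreover have "fst b \<in> carrier N" using b by auto
    ultimately obtain a where "a \<in> carrier K" "fst b = i a" using ses_ker[OF e] by blast
    then show ?thesis using b by (auto simp: prod_eq_iff)
  qed
qed (use K fibre_product_snd in auto)

section \<open>The classes orthogonal to \<open>X\<close>: extension and lifting properties,
  retracts, extensions\<close>

locale module_class = module_universe R U
  for R :: "('r, 'k) ring_scheme" and U :: "'m set set" +
  fixes X :: "('r, 'm) module set"
  assumes X_Mods: "X \<subseteq> Mods R U"
begin

lemma X_left_module: "A \<in> X \<Longrightarrow> left_module R A"
  and X_in_Mods: "A \<in> X \<Longrightarrow> A \<in> Mods R U"
  using X_Mods Mods_left_module by auto

lemma right_perp_Mods: "E \<in> right_perp R U X \<Longrightarrow> E \<in> Mods R U"
  and right_perp_left_module: "E \<in> right_perp R U X \<Longrightarrow> left_module R E"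
  by (auto simp: right_perp_def Mods_left_module)

lemma left_perp_Mods: "E \<in> left_perp R U X \<Longrightarrow> E \<in> Mods R U"
  and left_perp_left_module: "E \<in> left_perp R U X \<Longrightarrow> left_module R E"
  by (auto simp: left_perp_def Mods_left_module)

lemma right_perp_splits:
  assumes "E \<in> right_perp R U X" "A \<in> X" "left_module R N" "ses R E i N p A"
  obtains r s where "splits R E i N p A r s"
  using assms X_Mods by (auto simp: right_perp_def intro: Ext1_splits[of A E])

lemma left_perp_splits:
  assumes "P \<in> left_perp R U X" "B \<in> X" "left_module R N" "ses R B i N p P"
  obtains r s where "splits R B i N p P r s"
  using assms X_Mods by (auto simp: left_perp_def intro: Ext1_splits[of P B])

text \<open>Either half of a splitting suffices. Some applications produce a retraction and others a
  section, hence the disjunction.\<close>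

lemma right_perpI:
  assumes E: "E \<in> Mods R U"
    and sp: "\<And>A N i p. \<lbrakk>A \<in> X; N \<in> Mods R U; ses R E i N p A\<rbrakk> \<Longrightarrow>
      (\<exists>r\<in>rmod_hom R N E. \<forall>a\<in>carrier E. r (i a) = a) \<or> (\<exists>s\<in>rmod_hom R A N. \<forall>c\<in>carrier A. p (s c) = c)"
  shows "E \<in> right_perp R U X"
  unfolding right_perp_def mem_Collect_eq
proof (intro conjI ballI E)
  fix A assume A: "A \<in> X"
  show "is_singleton (Ext1 R U A E)"
  proof (rule Ext1_singletonI[OF X_in_Mods[OF A] E])
    fix W i p assume W: "W \<in> Mods R U" "ses R E i W p A"
    show "\<exists>r s. splits R E i W p A r s"
      using sp[OF A W] ses_retraction_splits[OF W(2)] ses_section_splits[OF W(2)]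
        Mods_left_module[OF E] Mods_left_module[OF W(1)] X_left_module[OF A] by metis
  qed
qed

lemma left_perpI:
  assumes E: "E \<in> Mods R U"
    and sp: "\<And>B N i p. \<lbrakk>B \<in> X; N \<in> Mods R U; ses R B i N p E\<rbrakk> \<Longrightarrow>
      (\<exists>r\<in>rmod_hom R N B. \<forall>a\<in>carrier B. r (i a) = a) \<or> (\<exists>s\<in>rmod_hom R E N. \<forall>c\<in>carrier E. p (s c) = c)"
  shows "E \<in> left_perp R U X"
  unfolding left_perp_def mem_Collect_eq
proof (intro conjI ballI E)
  fix B assume B: "B \<in> X"
  show "is_singleton (Ext1 R U E B)"
  proof (rule Ext1_singletonI[OF E X_in_Mods[OF B]])
    fix W i p assume W: "W \<in> Mods R U" "ses R B i W p E"
    show "\<exists>r s. splits R B i W p E r s"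
      using sp[OF B W] ses_retraction_splits[OF W(2)] ses_section_splits[OF W(2)]
        Mods_left_module[OF E] Mods_left_module[OF W(1)] X_left_module[OF B] by metis
  qed
qed

text \<open>Push the sequence out along \<open>g\<close>. The result is an extension of
  \<open>L\<close> by \<open>E\<close>, which splits, and its retraction restricted to
  \<open>N\<close> is the required extension of \<open>g\<close>.\<close>

lemma right_perp_extend:
  fixes N :: "('r, 'n) module"
  assumes E: "E \<in> right_perp R U X" and L: "L \<in> X" and e: "ses R M f N p L" and g: "g \<in> rmod_hom R M E"
    and M: "left_module R M" and N: "left_module R N"
  obtains h where "h \<in> rmod_hom R N E" "\<And>m. m \<in> carrier M \<Longrightarrow> h (f m) = g m"
proof -
  note mE = right_perp_left_module[OF E] and mL = X_left_module[OF L]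
  interpret M: left_module R M by fact
  interpret E: left_module R E by fact
  obtain Q q where po: "pushout R M f N g E q (Q :: ('r, ('n \<times> 'm) set) module)"
    by (rule obtain_pushout[OF M N mE ses_hom1[OF e] g])
  obtain p' where p': "ses R E (\<lambda>y. q (\<zero>\<^bsub>N\<^esub>, y)) Q p' L"
    using pushout_ses[OF e M N mE mL g po] .
  have Q: "left_module R Q" and q: "q \<in> rmod_hom R (dprod N E) Q" using po by (auto simp: pushout_def)
  obtain r s where rs: "splits R E (\<lambda>y. q (\<zero>\<^bsub>N\<^esub>, y)) Q p' L r s"
    using right_perp_splits[OF E L Q p'] .
  then have r: "r \<in> rmod_hom R Q E" "\<And>y. y \<in> carrier E \<Longrightarrow> r (q (\<zero>\<^bsub>N\<^esub>, y)) = y" by (auto simp: splits_def)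
  show thesis
  proof
    show "(\<lambda>n. r (q (n, \<zero>\<^bsub>E\<^esub>))) \<in> rmod_hom R N E"
      by (rule hom_comp[OF hom_comp[OF _ q] r(1)]) (intro hom_Pair hom_id hom_const_zero mE)
    show "r (q (f m, \<zero>\<^bsub>E\<^esub>)) = g m" if "m \<in> carrier M" for m
      using pushout_comm[OF M N mE ses_hom1[OF e] g po that] r(2) hom_closed[OF g that] by simp
  qed
qed

text \<open>Pull the sequence back along \<open>g\<close>. The result is an extension of
  \<open>P\<close> by \<open>K\<close>, which splits, and its section followed by the projection to
  \<open>N\<close> is the required lift of \<open>g\<close>.\<close>

lemma left_perp_lift:
  assumes P: "P \<in> left_perp R U X" and K: "K \<in> X" and e: "ses R K i N p M" and g: "g \<in> rmod_hom R P M"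
    and M: "left_module R M" and N: "left_module R N"
  obtains h where "h \<in> rmod_hom R P N" "\<And>x. x \<in> carrier P \<Longrightarrow> p (h x) = g x"
proof -
  note mP = left_perp_left_module[OF P] and mK = X_left_module[OF K]
  obtain r s where "splits R K (\<lambda>k. (i k, \<zero>\<^bsub>P\<^esub>)) (fibre_product N p P g) snd P r s"
    using left_perp_splits[OF P K fibre_product_left_module[OF N mP M ses_hom2[OF e] g]
        fibre_product_ses[OF e mK N mP M g]] .
  then have s: "s \<in> rmod_hom R P (fibre_product N p P g)" "\<And>x. x \<in> carrier P \<Longrightarrow> snd (s x) = x"
    by (auto simp: splits_def)
  show thesis
  proof
    show "(\<lambda>x. fst (s x)) \<in> rmod_hom R P N" by (rule hom_comp[OF s(1) fibre_product_fst])
    show "p (fst (s x)) = g x" if "x \<in> carrier P" for x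
      using hom_closed[OF s(1) that] s(2)[OF that] by auto
  qed
qed

text \<open>Extend \<open>i\<close> along \<open>j\<close> to \<open>h : N -> E\<close>; then
  \<open>r\<close> after \<open>h\<close> is a retraction of \<open>j\<close>.\<close>

lemma right_perp_retract:
  assumes E: "E \<in> right_perp R U X" and Z: "Z \<in> Mods R U" and i: "i \<in> rmod_hom R Z E"
    and r: "r \<in> rmod_hom R E Z" "\<And>z. z \<in> carrier Z \<Longrightarrow> r (i z) = z"
  shows "Z \<in> right_perp R U X"
proof (rule right_perpI[OF Z])
  fix A N j p assume *: "A \<in> X" "N \<in> Mods R U" "ses R Z j N p A"
  obtain h where h: "h \<in> rmod_hom R N E" "\<And>m. m \<in> carrier Z \<Longrightarrow> h (j m) = i m"
    using right_perp_extend[OF E *(1,3) i] Z *(2) Mods_left_module by metis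
  show "(\<exists>r\<in>rmod_hom R N Z. \<forall>a\<in>carrier Z. r (j a) = a) \<or> (\<exists>s\<in>rmod_hom R A N. \<forall>c\<in>carrier A. p (s c) = c)"
    using hom_comp[OF h(1) r(1)] h(2) r(2) by (intro disjI1 bexI[of _ "\<lambda>n. r (h n)"]) auto
qed

lemma left_perp_retract:
  assumes P: "P \<in> left_perp R U X" and Z: "Z \<in> Mods R U" and i: "i \<in> rmod_hom R Z P"
    and r: "r \<in> rmod_hom R P Z" "\<And>z. z \<in> carrier Z \<Longrightarrow> r (i z) = z"
  shows "Z \<in> left_perp R U X"
proof (rule left_perpI[OF Z])
  fix B N j p assume *: "B \<in> X" "N \<in> Mods R U" "ses R B j N p Z"
  obtain h where h: "h \<in> rmod_hom R P N" "\<And>m. m \<in> carrier P \<Longrightarrow> p (h m) = r m"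
    using left_perp_lift[OF P *(1,3) r(1)] Z *(2) Mods_left_module by metis
  show "(\<exists>r\<in>rmod_hom R N B. \<forall>a\<in>carrier B. r (j a) = a) \<or> (\<exists>s\<in>rmod_hom R Z N. \<forall>c\<in>carrier Z. p (s c) = c)"
    using hom_comp[OF i h(1)] h(2) r(2) hom_closed[OF i] by (intro disjI2 bexI[of _ "\<lambda>n. h (i n)"]) auto
qed

text \<open>Given an extension \<open>N\<close> of \<open>A\<close> by \<open>W\<close>, extend
  \<open>p : W -> J\<close> to \<open>P : N -> J\<close>. The kernel \<open>N0\<close> of
  \<open>P\<close> is an extension of \<open>A\<close> by \<open>K\<close>, and a section of it is a
  section of \<open>N -> A\<close>.\<close>

lemma right_perp_extension:
  assumes K: "K \<in> right_perp R U X" and J: "J \<in> right_perp R U X" and W: "W \<in> Mods R U"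
    and e: "ses R K i W p J"
  shows "W \<in> right_perp R U X"
proof (rule right_perpI[OF W])
  fix A N j q assume *: "A \<in> X" "N \<in> Mods R U" "ses R W j N q A"
  note mods = right_perp_left_module[OF K] right_perp_left_module[OF J] Mods_left_module[OF W]
    X_left_module[OF *(1)] Mods_left_module[OF *(2)]
  note i = ses_hom1[OF e] and p = ses_hom2[OF e] and j = ses_hom1[OF *(3)] and q = ses_hom2[OF *(3)]
  interpret N: left_module R N by (fact mods)
  interpret A: left_module R A by (fact mods)
  interpret J: left_module R J by (fact mods)
  obtain P where P: "P \<in> rmod_hom R N J" "\<And>w. w \<in> carrier W \<Longrightarrow> P (j w) = p w"
    using right_perp_extend[OF J *(1,3) p mods(3,5)] by blast
  define N0 where "N0 = N\<lparr>carrier := {n \<in> carrier N. P n = \<zero>\<^bsub>J\<^esub>}\<rparr>"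
  have N0: "left_module R N0" unfolding N0_def
    by (rule submodule_left_module[OF mods(5)])
      (auto simp: hom_zero[OF P(1) mods(5,2)] hom_add[OF P(1)] hom_smult[OF P(1)] N.smult_closed J.smult_zero_right)
  have inc: "(\<lambda>x. x) \<in> rmod_hom R N0 N" by (rule homI) (auto simp: N0_def)
  have "ses R K (\<lambda>k. j (i k)) N0 q A"
  proof (rule sesI)
    show "(\<lambda>k. j (i k)) \<in> rmod_hom R K N0"
      using hom_comp[OF i j] P(2) hom_closed[OF i] ses_zero[OF e]
      by (auto simp: rmod_hom_def N0_def)
    show "q \<in> rmod_hom R N0 A" using hom_comp[OF inc q] .
    show "a = \<zero>\<^bsub>K\<^esub>" if "a \<in> carrier K" "j (i a) = \<zero>\<^bsub>N0\<^esub>" for a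
      using that ses_inj[OF *(3)] ses_inj[OF e] hom_inj_iff[OF j mods(3,5)] hom_inj_iff[OF i mods(1,3)]
        hom_closed[OF i] by (simp add: N0_def)
    show "\<exists>b\<in>carrier N0. q b = c" if c: "c \<in> carrier A" for c
    proof -
      obtain n where n: "n \<in> carrier N" "q n = c" using ses_ex[OF *(3) c] by blast
      \<comment> \<open>A lift \<open>n\<close> of \<open>c\<close> need not lie in
        \<open>N0\<close>; subtracting \<open>j w\<close> with \<open>p w = P n\<close> corrects
        this without changing its image in \<open>A\<close>.\<close>
      obtain w where w: "w \<in> carrier W" "p w = P n" using ses_ex[OF e hom_closed[OF P(1) n(1)]] by blast
      have "n \<ominus>\<^bsub>N\<^esub> j w \<in> carrier N0" "q (n \<ominus>\<^bsub>N\<^esub> j w) = c"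
        using n w P(2) hom_closed[OF j w(1)] hom_closed[OF P(1)] c ses_zero[OF *(3)]
        by (simp_all add: N0_def hom_minus[OF P(1) mods(5,2)] hom_minus[OF q mods(5,4)])
      then show ?thesis by blast
    qed
    show "q (j (i a)) = \<zero>\<^bsub>A\<^esub>" if "a \<in> carrier K" for a
      using that by (simp add: ses_zero[OF *(3)] hom_closed[OF i])
    show "\<exists>a\<in>carrier K. b = j (i a)" if b: "b \<in> carrier N0" "q b = \<zero>\<^bsub>A\<^esub>" for b
    proof -
      obtain w where w: "w \<in> carrier W" "b = j w" using ses_ker[OF *(3)] b by (auto simp: N0_def)
      then have "p w = \<zero>\<^bsub>J\<^esub>" using b P(2) by (auto simp: N0_def)
      then show ?thesis using ses_ker[OF e w(1)] w(2) by blast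
    qed
  qed (fact mods N0)+
  then obtain r s where "splits R K (\<lambda>k. j (i k)) N0 q A r s"
    using right_perp_splits[OF K *(1) N0] by metis
  then have "(\<lambda>c. s c) \<in> rmod_hom R A N" "\<forall>c\<in>carrier A. q (s c) = c"
    using hom_comp[OF _ inc, of s A] by (auto simp: splits_def)
  then show "(\<exists>r\<in>rmod_hom R N W. \<forall>a\<in>carrier W. r (j a) = a) \<or> (\<exists>s\<in>rmod_hom R A N. \<forall>c\<in>carrier A. q (s c) = c)"
    by blast
qed

text \<open>Given an extension \<open>N\<close> of \<open>W\<close> by \<open>B\<close>, lift
  \<open>i : F -> W\<close> to \<open>\<phi> : F -> N\<close>. The quotient of \<open>N\<close> by
  the image of \<open>\<phi>\<close> is an extension of \<open>L\<close> by \<open>B\<close>, and a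
  retraction of it, composed with \<open>\<pi>\<close>, retracts \<open>N\<close> onto
  \<open>B\<close>.\<close>

lemma left_perp_extension:
  assumes F: "F \<in> left_perp R U X" and L: "L \<in> left_perp R U X" and W: "W \<in> Mods R U"
    and e: "ses R F i W p L"
  shows "W \<in> left_perp R U X"
proof (rule left_perpI[OF W])
  fix B N j q assume *: "B \<in> X" "N \<in> Mods R U" "ses R B j N q W"
  note mods = left_perp_left_module[OF F] left_perp_left_module[OF L] Mods_left_module[OF W]
    X_left_module[OF *(1)] Mods_left_module[OF *(2)]
  note i = ses_hom1[OF e] and p = ses_hom2[OF e] and j = ses_hom1[OF *(3)] and q = ses_hom2[OF *(3)]
  interpret N: left_module R N by (fact mods)
  interpret F: left_module R F by (fact mods)
  interpret W: left_module R W by (fact mods)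
  obtain \<phi> where \<phi>: "\<phi> \<in> rmod_hom R F N" "\<And>w. w \<in> carrier F \<Longrightarrow> q (\<phi> w) = i w"
    using left_perp_lift[OF F *(1,3) i mods(3,5)] by blast
  obtain Q :: "('r, 'm set) module" and \<pi> where Q: "left_module R Q" and \<pi>: "\<pi> \<in> rmod_hom R N Q"
    "\<pi> ` carrier N = carrier Q" "\<And>x. x \<in> carrier N \<Longrightarrow> \<pi> x = \<zero>\<^bsub>Q\<^esub> \<longleftrightarrow> x \<in> \<phi> ` carrier F"
  proof (rule quotient_module[OF mods(5), of "\<phi> ` carrier F"])
    show "\<phi> ` carrier F \<subseteq> carrier N" using hom_closed[OF \<phi>(1)] by blast
    show "\<zero>\<^bsub>N\<^esub> \<in> \<phi> ` carrier F" using hom_zero[OF \<phi>(1) mods(1,5)] by (metis F.zero_closed imageI)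
  qed (auto simp: hom_add[OF \<phi>(1), symmetric] hom_smult[OF \<phi>(1), symmetric] F.smult_closed)
  interpret Q: left_module R Q by fact
  have ker: "p (q n) = \<zero>\<^bsub>L\<^esub>" if "n \<in> carrier N" "\<pi> n = \<zero>\<^bsub>Q\<^esub>" for n
    using that \<pi>(3) \<phi>(2) ses_zero[OF e] by auto
  obtain p' where p': "p' \<in> rmod_hom R Q L" "\<And>n. n \<in> carrier N \<Longrightarrow> p' (\<pi> n) = p (q n)"
    using factor_hom[OF \<pi>(1,2) hom_comp[OF q p] ker mods(5) Q mods(2)] by metis
  have "ses R B (\<lambda>b. \<pi> (j b)) Q p' L"
  proof (rule sesI)
    show "(\<lambda>b. \<pi> (j b)) \<in> rmod_hom R B Q" using hom_comp[OF j \<pi>(1)] .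
    show "a = \<zero>\<^bsub>B\<^esub>" if a: "a \<in> carrier B" "\<pi> (j a) = \<zero>\<^bsub>Q\<^esub>" for a
    proof -
      obtain f where f: "f \<in> carrier F" "j a = \<phi> f" using \<pi>(3) a hom_closed[OF j] by auto
      then have "i f = \<zero>\<^bsub>W\<^esub>" using \<phi>(2) ses_zero[OF *(3) a(1)] by metis
      then have "f = \<zero>\<^bsub>F\<^esub>" using f(1) ses_inj[OF e] hom_inj_iff[OF i mods(1,3)] by blast
      then have "j a = \<zero>\<^bsub>N\<^esub>" using f hom_zero[OF \<phi>(1) mods(1,5)] by simp
      then show ?thesis using a(1) ses_inj[OF *(3)] hom_inj_iff[OF j mods(4,5)] by blast
    qed
    show "\<exists>b\<in>carrier Q. p' b = c" if c: "c \<in> carrier L" for c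
    proof -
      obtain w where w: "w \<in> carrier W" "p w = c" using ses_ex[OF e c] by blast
      obtain n where n: "n \<in> carrier N" "q n = w" using ses_ex[OF *(3) w(1)] by blast
      then show ?thesis using p'(2) w hom_closed[OF \<pi>(1)] by blast
    qed
    show "p' (\<pi> (j a)) = \<zero>\<^bsub>L\<^esub>" if "a \<in> carrier B" for a
      using that p'(2) hom_closed[OF j] by (simp add: ses_zero[OF *(3)] hom_zero[OF p mods(3,2)])
    show "\<exists>a\<in>carrier B. b = \<pi> (j a)" if b: "b \<in> carrier Q" "p' b = \<zero>\<^bsub>L\<^esub>" for b
    proof -
      obtain n where n: "n \<in> carrier N" "b = \<pi> n" using b(1) \<pi>(2) by blast
      then have "p (q n) = \<zero>\<^bsub>L\<^esub>" using b p'(2) by simp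
      then obtain f where f: "f \<in> carrier F" "q n = i f" using ses_ker[OF e] hom_closed[OF q n(1)] by blast
      note \<phi>f = hom_closed[OF \<phi>(1) f(1)]
      have "q (n \<ominus>\<^bsub>N\<^esub> \<phi> f) = \<zero>\<^bsub>W\<^esub>"
        using n f \<phi>f hom_closed[OF i] by (simp add: hom_minus[OF q mods(5,3)] \<phi>(2))
      then obtain a where a: "a \<in> carrier B" "n \<ominus>\<^bsub>N\<^esub> \<phi> f = j a"
        using ses_ker[OF *(3), of "n \<ominus>\<^bsub>N\<^esub> \<phi> f"] n \<phi>f by auto
      \<comment> \<open>Subtracting \<open>\<phi> f\<close> moves \<open>n\<close> into the image of
        \<open>B\<close> and does not change its class in \<open>Q\<close>.\<close>
      have "\<pi> (n \<ominus>\<^bsub>N\<^esub> \<phi> f) = \<pi> n" using n \<phi>f \<pi>(3)[of "\<phi> f"] f(1) hom_closed[OF \<pi>(1)]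
        by (simp add: hom_minus[OF \<pi>(1) mods(5) Q])
      then show ?thesis using a n by metis
    qed
  qed (fact mods p'(1) Q)+
  then obtain r s where "splits R B (\<lambda>b. \<pi> (j b)) Q p' L r s"
    using left_perp_splits[OF L *(1) Q] by metis
  then have "(\<lambda>n. r (\<pi> n)) \<in> rmod_hom R N B" "\<forall>b\<in>carrier B. r (\<pi> (j b)) = b"
    using hom_comp[OF \<pi>(1)] by (auto simp: splits_def)
  then show "(\<exists>r\<in>rmod_hom R N B. \<forall>a\<in>carrier B. r (j a) = a) \<or> (\<exists>s\<in>rmod_hom R W N. \<forall>c\<in>carrier W. q (s c) = c)"
    by (intro disjI1 bexI[of _ "\<lambda>n. r (\<pi> n)"])
qed

lemma perp_biproduct:
  assumes T: "T \<in> Mods R U" and e: "e \<in> rmod_hom R (dprod A B) T" "e' \<in> rmod_hom R T (dprod A B)"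
    "\<And>x. x \<in> carrier (dprod A B) \<Longrightarrow> e' (e x) = x" "\<And>y. y \<in> carrier T \<Longrightarrow> e (e' y) = y"
  shows "\<lbrakk>A \<in> right_perp R U X; B \<in> right_perp R U X\<rbrakk> \<Longrightarrow> T \<in> right_perp R U X"
    and "\<lbrakk>A \<in> left_perp R U X; B \<in> left_perp R U X\<rbrakk> \<Longrightarrow> T \<in> left_perp R U X"
proof -
  have *: "ses R A (\<lambda>a. e (a, \<zero>\<^bsub>B\<^esub>)) T (\<lambda>y. snd (e' y)) B" if "left_module R A" "left_module R B"
    by (rule ses_transport[OF ses_dprod[OF that] that(1) Mods_left_module[OF T] dprod_left_module[OF that] e])
  show "T \<in> right_perp R U X" if "A \<in> right_perp R U X" "B \<in> right_perp R U X"
    using right_perp_extension[OF that T] * that right_perp_left_module by blast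
  show "T \<in> left_perp R U X" if "A \<in> left_perp R U X" "B \<in> left_perp R U X"
    using left_perp_extension[OF that T] * that left_perp_left_module by blast
qed

end

section \<open>Extensions of complexes\<close>

lemma cplx_obj: "is_cplx R C \<Longrightarrow> left_module R (obj C n)"
  and cplx_dif: "is_cplx R C \<Longrightarrow> dif C n \<in> rmod_hom R (obj C n) (obj C (n - 1))"
  and cplx_dif_dif: "\<lbrakk>is_cplx R C; x \<in> carrier (obj C n)\<rbrakk>
      \<Longrightarrow> dif C (n - 1) (dif C n x) = \<zero>\<^bsub>obj C (n - 1 - 1)\<^esub>"
  by (auto simp: is_cplx_def)

lemma chain_hom: "f \<in> chain_maps R C D \<Longrightarrow> f n \<in> rmod_hom R (obj C n) (obj D n)"
  and chain_comm: "\<lbrakk>f \<in> chain_maps R C D; x \<in> carrier (obj C n)\<rbrakk>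
      \<Longrightarrow> dif D n (f n x) = f (n - 1) (dif C n x)"
  by (auto simp: chain_maps_def)

lemma chain_comp:
  "\<lbrakk>f \<in> chain_maps R C D; g \<in> chain_maps R D E\<rbrakk> \<Longrightarrow> (\<lambda>n x. g n (f n x)) \<in> chain_maps R C E"
  unfolding chain_maps_def by (auto intro: hom_comp simp: hom_closed) (metis hom_closed)

lemma chain_id: "(\<lambda>n x. x) \<in> chain_maps R C C"
  by (simp add: chain_maps_def hom_id)

lemma chain_plus:
  assumes f: "f \<in> chain_maps R C D" and g: "g \<in> chain_maps R C D" and D: "is_cplx R D"
  shows "(\<lambda>n x. f n x \<oplus>\<^bsub>obj D n\<^esub> g n x) \<in> chain_maps R C D"
  using hom_plus[OF chain_hom[OF f] chain_hom[OF g] cplx_obj[OF D]]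
    hom_add[OF cplx_dif[OF D]] hom_closed[OF chain_hom[OF f]] hom_closed[OF chain_hom[OF g]]
    chain_comm[OF f] chain_comm[OF g]
  by (simp add: chain_maps_def)

section \<open>Short exact sequences of complexes\<close>

definition cplx_ses ::
    "('r, 'k) ring_scheme \<Rightarrow> ('r, 'a) cplx \<Rightarrow> (int \<Rightarrow> 'a \<Rightarrow> 'b) \<Rightarrow> ('r, 'b) cplx
      \<Rightarrow> (int \<Rightarrow> 'b \<Rightarrow> 'c) \<Rightarrow> ('r, 'c) cplx \<Rightarrow> bool" where
  "cplx_ses R A i B p C \<longleftrightarrow>
     i \<in> chain_maps R A B \<and> p \<in> chain_maps R B C \<and>
     (\<forall>n. ses R (obj A n) (i n) (obj B n) (p n) (obj C n))"

lemma cplx_short_exact_eq_ses: "cplx_short_exact R A i B p C = cplx_ses R A i B p C"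
  by (simp add: cplx_short_exact_def cplx_ses_def short_exact_eq_ses)

lemma
  assumes "cplx_ses R A i B p C"
  shows cplx_ses_chain1: "i \<in> chain_maps R A B" and cplx_ses_chain2: "p \<in> chain_maps R B C"
    and cplx_ses_ses: "ses R (obj A n) (i n) (obj B n) (p n) (obj C n)"
  using assms by (auto simp: cplx_ses_def)

definition cplx_splits ::
    "('r, 'k) ring_scheme \<Rightarrow> ('r, 'a) cplx \<Rightarrow> (int \<Rightarrow> 'a \<Rightarrow> 'b) \<Rightarrow> ('r, 'b) cplx
      \<Rightarrow> (int \<Rightarrow> 'b \<Rightarrow> 'c) \<Rightarrow> ('r, 'c) cplx \<Rightarrow> (int \<Rightarrow> 'b \<Rightarrow> 'a) \<Rightarrow> (int \<Rightarrow> 'c \<Rightarrow> 'b) \<Rightarrow> bool" where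
  "cplx_splits R A i B p C r s \<longleftrightarrow> r \<in> chain_maps R B A \<and> s \<in> chain_maps R C B \<and>
     (\<forall>n. splits R (obj A n) (i n) (obj B n) (p n) (obj C n) (r n) (s n))"

text \<open>In each degree the complementary section is determined by \<open>p s = 1\<close> and
  \<open>r s = 0\<close>. Both equations are respected by the differentials when \<open>p\<close>
  and \<open>r\<close> are chain maps, so the degreewise sections form a chain map.\<close>

lemma cplx_retraction_splits:
  assumes e: "cplx_ses R A i B p C" and A: "is_cplx R A" and B: "is_cplx R B" and C: "is_cplx R C"
    and r: "r \<in> chain_maps R B A" "\<And>n a. a \<in> carrier (obj A n) \<Longrightarrow> r n (i n a) = a"
  obtains s where "cplx_splits R A i B p C r s"
proof -
  have "\<exists>s. splits R (obj A n) (i n) (obj B n) (p n) (obj C n) (r n) s" for n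
    using ses_retraction_splits[OF cplx_ses_ses[OF e] cplx_obj[OF A] cplx_obj[OF B] cplx_obj[OF C]
        chain_hom[OF r(1)] r(2)] by metis
  then obtain s where s: "\<And>n. splits R (obj A n) (i n) (obj B n) (p n) (obj C n) (r n) (s n)"
    by metis
  note i = cplx_ses_chain1[OF e] and p = cplx_ses_chain2[OF e]
  have sh: "s n \<in> rmod_hom R (obj C n) (obj B n)" for n using s by (auto simp: splits_def)
  have "dif B n (s n x) = s (n - 1) (dif C n x)" if x: "x \<in> carrier (obj C n)" for n x
  proof -
    interpret B1: left_module R "obj B (n - 1)" by (rule cplx_obj[OF B])
    let ?u = "dif B n (s n x)"
    have sx: "s n x \<in> carrier (obj B n)" and u: "?u \<in> carrier (obj B (n - 1))"
      using x by (auto intro: hom_closed[OF sh] hom_closed[OF cplx_dif[OF B]])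
    have "p (n - 1) ?u = dif C n x"
      using chain_comm[OF p sx] s[of n] x by (simp add: splits_def)
    moreover have "r (n - 1) ?u = \<zero>\<^bsub>obj A (n - 1)\<^esub>"
      using chain_comm[OF r(1) sx] s[of n] x hom_zero[OF cplx_dif[OF A] cplx_obj[OF A] cplx_obj[OF A]]
      by (simp add: splits_def)
    moreover have "i (n - 1) (r (n - 1) ?u) \<oplus>\<^bsub>obj B (n - 1)\<^esub> s (n - 1) (p (n - 1) ?u) = ?u"
      using s[of "n - 1"] u by (simp add: splits_def)
    ultimately show ?thesis
      using hom_zero[OF chain_hom[OF i] cplx_obj[OF A] cplx_obj[OF B]]
        hom_closed[OF sh hom_closed[OF cplx_dif[OF C] x]] by simp
  qed
  then have "s \<in> chain_maps R C B" using sh by (simp add: chain_maps_def)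
  then show thesis using r(1) s by (intro that[of s]) (simp add: cplx_splits_def)
qed

text \<open>Decompose \<open>x\<close> as \<open>i (r x) + s (p x)\<close> and apply the
  differential, which commutes with \<open>i\<close> and \<open>s\<close>; then \<open>r\<close>
  extracts the first component.\<close>

lemma cplx_section_splits:
  assumes e: "cplx_ses R A i B p C" and A: "is_cplx R A" and B: "is_cplx R B" and C: "is_cplx R C"
    and s: "s \<in> chain_maps R C B" "\<And>n c. c \<in> carrier (obj C n) \<Longrightarrow> p n (s n c) = c"
  obtains r where "cplx_splits R A i B p C r s"
proof -
  have "\<exists>r. splits R (obj A n) (i n) (obj B n) (p n) (obj C n) r (s n)" for n
    using ses_section_splits[OF cplx_ses_ses[OF e] cplx_obj[OF A] cplx_obj[OF B] cplx_obj[OF C]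
        chain_hom[OF s(1)] s(2)] by metis
  then obtain r where r: "\<And>n. splits R (obj A n) (i n) (obj B n) (p n) (obj C n) (r n) (s n)"
    by metis
  note i = cplx_ses_chain1[OF e] and p = cplx_ses_chain2[OF e]
  have rh: "r n \<in> rmod_hom R (obj B n) (obj A n)" for n using r by (auto simp: splits_def)
  have "dif A n (r n x) = r (n - 1) (dif B n x)" if x: "x \<in> carrier (obj B n)" for n x
  proof -
    interpret A1: left_module R "obj A (n - 1)" by (rule cplx_obj[OF A])
    have rx: "r n x \<in> carrier (obj A n)" and px: "p n x \<in> carrier (obj C n)"
      using x by (auto intro: hom_closed[OF rh] hom_closed[OF chain_hom[OF p]])
    note drx = hom_closed[OF cplx_dif[OF A] rx] and dpx = hom_closed[OF cplx_dif[OF C] px]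
    have "x = i n (r n x) \<oplus>\<^bsub>obj B n\<^esub> s n (p n x)" using r[of n] x by (simp add: splits_def)
    then have "dif B n x = dif B n (i n (r n x)) \<oplus>\<^bsub>obj B (n - 1)\<^esub> dif B n (s n (p n x))"
      using hom_add[OF cplx_dif[OF B]] hom_closed[OF chain_hom[OF i] rx] hom_closed[OF chain_hom[OF s(1)] px]
      by metis
    also have "\<dots> = i (n - 1) (dif A n (r n x)) \<oplus>\<^bsub>obj B (n - 1)\<^esub> s (n - 1) (dif C n (p n x))"
      by (simp add: chain_comm[OF i rx] chain_comm[OF s(1) px])
    finally have "r (n - 1) (dif B n x) = dif A n (r n x) \<oplus>\<^bsub>obj A (n - 1)\<^esub> \<zero>\<^bsub>obj A (n - 1)\<^esub>"
      using hom_add[OF rh] hom_closed[OF chain_hom[OF i] drx] hom_closed[OF chain_hom[OF s(1)] dpx]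
        r[of "n - 1"] drx dpx by (simp add: splits_def)
    then show ?thesis using drx by simp
  qed
  then have "r \<in> chain_maps R B A" using rh by (simp add: chain_maps_def)
  then show thesis using s(1) r by (intro that[of r]) (simp add: cplx_splits_def)
qed

definition dprod_cplx :: "('r, 'a) cplx \<Rightarrow> ('r, 'b) cplx \<Rightarrow> ('r, 'a \<times> 'b) cplx" where
  "dprod_cplx A B = \<lparr>obj = (\<lambda>n. dprod (obj A n) (obj B n)),
     dif = (\<lambda>n z. (dif A n (fst z), dif B n (snd z)))\<rparr>"

lemma dprod_cplx:
  assumes A: "is_cplx R A" and B: "is_cplx R B"
  shows "is_cplx R (dprod_cplx A B)"
    and "cplx_ses R A (\<lambda>n a. (a, \<zero>\<^bsub>obj B n\<^esub>)) (dprod_cplx A B) (\<lambda>n. snd) B"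
    and "(\<lambda>n. fst) \<in> chain_maps R (dprod_cplx A B) A"
proof -
  note hA = cplx_dif[OF A] and hB = cplx_dif[OF B]
  have d: "dif (dprod_cplx A B) n \<in> rmod_hom R (obj (dprod_cplx A B) n) (obj (dprod_cplx A B) (n - 1))" for n
    unfolding dprod_cplx_def by simp (intro hom_Pair hom_comp[OF hom_fst hA] hom_comp[OF hom_snd hB])
  show "is_cplx R (dprod_cplx A B)"
    unfolding is_cplx_def using d
    by (auto simp: dprod_cplx_def cplx_dif_dif[OF A] cplx_dif_dif[OF B] intro: dprod_left_module cplx_obj A B)
  show "cplx_ses R A (\<lambda>n a. (a, \<zero>\<^bsub>obj B n\<^esub>)) (dprod_cplx A B) (\<lambda>n. snd) B"
    unfolding cplx_ses_def chain_maps_def dprod_cplx_def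
    by (auto intro!: ses_dprod hom_snd hom_Pair hom_id hom_const_zero cplx_obj A B
        simp: hom_zero[OF hB cplx_obj[OF B] cplx_obj[OF B]])
  show "(\<lambda>n. fst) \<in> chain_maps R (dprod_cplx A B) A"
    by (auto simp: chain_maps_def dprod_cplx_def intro: hom_fst)
qed

lemma cplx_ses_transport:
  assumes e: "cplx_ses R A i N p C" and A: "is_cplx R A" and M: "is_cplx R M" and N: "is_cplx R N"
    and h: "h \<in> chain_maps R N M" "h' \<in> chain_maps R M N"
    and inv: "\<And>n x. x \<in> carrier (obj N n) \<Longrightarrow> h' n (h n x) = x"
      "\<And>n y. y \<in> carrier (obj M n) \<Longrightarrow> h n (h' n y) = y"
  shows "cplx_ses R A (\<lambda>n a. h n (i n a)) M (\<lambda>n y. p n (h' n y)) C"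
  unfolding cplx_ses_def
  using chain_comp[OF cplx_ses_chain1[OF e] h(1)] chain_comp[OF h(2) cplx_ses_chain2[OF e]]
    ses_transport[OF cplx_ses_ses[OF e] cplx_obj[OF A] cplx_obj[OF M] cplx_obj[OF N]
      chain_hom[OF h(1)] chain_hom[OF h(2)] inv] by blast

context module_universe
begin

lemma Cplxs_cplx: "C \<in> Cplxs R U \<Longrightarrow> is_cplx R C"
  and Cplxs_Mods: "C \<in> Cplxs R U \<Longrightarrow> obj C n \<in> Mods R U"
  by (auto simp: Cplxs_def)

text \<open>The terms are moved into the universe one by one and the differentials are conjugated by
  the isomorphisms.\<close>

lemma obtain_Cplxs_iso:
  fixes N :: "('r, 'n) cplx"
  assumes N: "is_cplx R N" and sm: "\<And>n. small U (carrier (obj N n))"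
  obtains M e e' where "M \<in> Cplxs R U" "e \<in> chain_maps R N M" "e' \<in> chain_maps R M N"
    "\<And>n x. x \<in> carrier (obj N n) \<Longrightarrow> e' n (e n x) = x" "\<And>n y. y \<in> carrier (obj M n) \<Longrightarrow> e n (e' n y) = y"
proof -
  have "\<exists>M e e'. M \<in> Mods R U \<and> e \<in> rmod_hom R (obj N n) M \<and> e' \<in> rmod_hom R M (obj N n) \<and>
    (\<forall>x\<in>carrier (obj N n). e' (e x) = x) \<and> (\<forall>y\<in>carrier M. e (e' y) = y)" for n
    using obtain_Mods_iso[OF cplx_obj[OF N] sm, of n] by metis
  then obtain M e e' where M: "\<And>n. M n \<in> Mods R U" and e: "\<And>n. e n \<in> rmod_hom R (obj N n) (M n)"
    "\<And>n. e' n \<in> rmod_hom R (M n) (obj N n)"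
    "\<And>n x. x \<in> carrier (obj N n) \<Longrightarrow> e' n (e n x) = x" "\<And>n y. y \<in> carrier (M n) \<Longrightarrow> e n (e' n y) = y"
    by metis
  define C where "C = \<lparr>obj = M, dif = (\<lambda>n y. e (n - 1) (dif N n (e' n y)))\<rparr>"
  note dN = cplx_dif[OF N]
  have d: "dif C n \<in> rmod_hom R (M n) (M (n - 1))" for n
    unfolding C_def using hom_comp[OF hom_comp[OF e(2) dN] e(1)] by simp
  have "is_cplx R C"
    unfolding is_cplx_def
    using d by (auto simp: C_def M Mods_left_module e(3) hom_closed[OF dN] hom_closed[OF e(2)]
        cplx_dif_dif[OF N] hom_zero[OF e(1) cplx_obj[OF N] Mods_left_module[OF M]])
  then have "C \<in> Cplxs R U" using M by (simp add: Cplxs_def C_def)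
  moreover have "e \<in> chain_maps R N C" "e' \<in> chain_maps R C N"
    using e by (auto simp: chain_maps_def C_def hom_closed[OF dN] hom_closed[OF e(2)])
  ultimately show thesis using e by (intro that) (auto simp: C_def)
qed

lemma obtain_cplx_biproduct:
  assumes "A \<in> Cplxs R U" "B \<in> Cplxs R U"
  obtains T e e' where "T \<in> Cplxs R U" "e \<in> chain_maps R (dprod_cplx A B) T" "e' \<in> chain_maps R T (dprod_cplx A B)"
    "\<And>n x. x \<in> carrier (obj (dprod_cplx A B) n) \<Longrightarrow> e' n (e n x) = x"
    "\<And>n y. y \<in> carrier (obj T n) \<Longrightarrow> e n (e' n y) = y"
proof -
  have "small U (carrier (obj (dprod_cplx A B) n))" for n
    using small_times[OF Mods_small[OF Cplxs_Mods[OF assms(1)]] Mods_small[OF Cplxs_Mods[OF assms(2)]]]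
    by (simp add: dprod_cplx_def)
  from obtain_Cplxs_iso[OF dprod_cplx(1)[OF Cplxs_cplx[OF assms(1)] Cplxs_cplx[OF assms(2)]] this]
  show thesis using that by metis
qed

section \<open>Vanishing of Ext^1 of complexes as splitting of extensions\<close>

lemma cplx_extensions_iff:
  "(E, i, p) \<in> cplx_extensions R U A B \<longleftrightarrow> E \<in> Cplxs R U \<and> cplx_ses R B i E p A"
  by (simp add: cplx_extensions_def cplx_short_exact_eq_ses)

lemma cplx_Ext1_singleton_iff:
  assumes A: "A \<in> Cplxs R U" and B: "B \<in> Cplxs R U"
  shows "is_singleton (cplx_Ext1 R U A B) \<longleftrightarrow>
    (\<forall>x\<in>cplx_extensions R U A B. \<forall>y\<in>cplx_extensions R U A B. (x, y) \<in> cplx_ext_equiv R U A B)"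
  unfolding cplx_Ext1_def
proof (rule singleton_quotient_iff)
  obtain T e e' where T: "T \<in> Cplxs R U" "e \<in> chain_maps R (dprod_cplx B A) T"
    "e' \<in> chain_maps R T (dprod_cplx B A)"
    "\<And>n x. x \<in> carrier (obj (dprod_cplx B A) n) \<Longrightarrow> e' n (e n x) = x"
    "\<And>n y. y \<in> carrier (obj T n) \<Longrightarrow> e n (e' n y) = y"
    using obtain_cplx_biproduct[OF B A] by metis
  note D = dprod_cplx[OF Cplxs_cplx[OF B] Cplxs_cplx[OF A]]
  show "cplx_extensions R U A B \<noteq> {}"
    using cplx_ses_transport[OF D(2) Cplxs_cplx[OF B] Cplxs_cplx[OF T(1)] D(1) T(2-5)] T(1)
      cplx_extensions_iff by blast
  show "(x, x) \<in> cplx_ext_equiv R U A B" if "x \<in> cplx_extensions R U A B" for x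
    using that chain_id by (cases x) (force simp: cplx_ext_equiv_def)
  show "cplx_ext_equiv R U A B \<subseteq> cplx_extensions R U A B \<times> cplx_extensions R U A B"
    by (auto simp: cplx_ext_equiv_def)
qed

lemma cplx_Ext1_splits:
  fixes N :: "('r, 'n) cplx"
  assumes A: "A \<in> Cplxs R U" and B: "B \<in> Cplxs R U" and sing: "is_singleton (cplx_Ext1 R U A B)"
    and N: "is_cplx R N" and e: "cplx_ses R B i N p A"
  obtains r s where "cplx_splits R B i N p A r s"
proof -
  note cA = Cplxs_cplx[OF A] and cB = Cplxs_cplx[OF B]
  have "small U (carrier (obj N n))" for n
    by (rule ses_small[OF cplx_ses_ses[OF e] cplx_obj[OF N] cplx_obj[OF cA]
          Mods_small[OF Cplxs_Mods[OF B]] Mods_small[OF Cplxs_Mods[OF A]]])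
  then obtain W f f' where W: "W \<in> Cplxs R U" and f: "f \<in> chain_maps R N W" "f' \<in> chain_maps R W N"
    "\<And>n x. x \<in> carrier (obj N n) \<Longrightarrow> f' n (f n x) = x" "\<And>n y. y \<in> carrier (obj W n) \<Longrightarrow> f n (f' n y) = y"
    using obtain_Cplxs_iso[OF N] by metis
  obtain T t t' where T: "T \<in> Cplxs R U" and t: "t \<in> chain_maps R (dprod_cplx B A) T"
    "t' \<in> chain_maps R T (dprod_cplx B A)"
    "\<And>n x. x \<in> carrier (obj (dprod_cplx B A) n) \<Longrightarrow> t' n (t n x) = x"
    "\<And>n y. y \<in> carrier (obj T n) \<Longrightarrow> t n (t' n y) = y"
    by (rule obtain_cplx_biproduct[OF B A]) (rule that)
  note D = dprod_cplx[OF cB cA]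
  let ?x = "(W, \<lambda>n b. f n (i n b), \<lambda>n y. p n (f' n y))"
  let ?y = "(T, \<lambda>n a. t n (a, \<zero>\<^bsub>obj A n\<^esub>), \<lambda>n y. snd (t' n y))"
  have "?x \<in> cplx_extensions R U A B" "?y \<in> cplx_extensions R U A B"
    unfolding cplx_extensions_iff
    using cplx_ses_transport[OF D(2) cB Cplxs_cplx[OF T] D(1) t]
      cplx_ses_transport[OF e cB Cplxs_cplx[OF W] N f] T W by auto
  then have "(?x, ?y) \<in> cplx_ext_equiv R U A B"
    using sing unfolding cplx_Ext1_singleton_iff[OF A B] by blast
  then obtain h where h: "h \<in> chain_maps R W T"
    "\<And>n b. b \<in> carrier (obj B n) \<Longrightarrow> h n (f n (i n b)) = t n (b, \<zero>\<^bsub>obj A n\<^esub>)"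
    by (auto simp: cplx_ext_equiv_def)
  have r: "(\<lambda>n x. fst (t' n (h n (f n x)))) \<in> chain_maps R N B"
    using chain_comp[OF f(1) chain_comp[OF h(1) chain_comp[OF t(2) D(3)]]] .
  have r_i: "fst (t' n (h n (f n (i n b)))) = b" if "b \<in> carrier (obj B n)" for n b
    using that t(3)[of "(b, \<zero>\<^bsub>obj A n\<^esub>)" n] left_module_group[OF cplx_obj[OF cA]]
    by (simp add: h(2) dprod_cplx_def abelian_groupE(2))
  show thesis
    by (rule cplx_retraction_splits[OF e cB N cA r r_i]) (assumption, rule that)
qed

lemma cplx_Ext1_singletonI:
  assumes A: "A \<in> Cplxs R U" and B: "B \<in> Cplxs R U"
    and sp: "\<And>W i p. \<lbrakk>W \<in> Cplxs R U; cplx_ses R B i W p A\<rbrakk> \<Longrightarrow> \<exists>r s. cplx_splits R B i W p A r s"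
  shows "is_singleton (cplx_Ext1 R U A B)"
  unfolding cplx_Ext1_singleton_iff[OF A B]
proof (clarify)
  fix W i p V j q
  assume WV: "(W, i, p) \<in> cplx_extensions R U A B" "(V, j, q) \<in> cplx_extensions R U A B"
  then have W: "W \<in> Cplxs R U" "cplx_ses R B i W p A" and V: "V \<in> Cplxs R U" "cplx_ses R B j V q A"
    by (auto simp: cplx_extensions_iff)
  obtain r s where r: "cplx_splits R B i W p A r s" using sp[OF W] by blast
  obtain r' s' where s: "cplx_splits R B j V q A r' s'" using sp[OF V] by blast
  note ch = cplx_ses_chain1[OF W(2)] cplx_ses_chain2[OF W(2)] cplx_ses_chain1[OF V(2)] cplx_ses_chain2[OF V(2)]
  note cx = Cplxs_cplx[OF A] Cplxs_cplx[OF B] Cplxs_cplx[OF W(1)] Cplxs_cplx[OF V(1)]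
  have rh: "r \<in> chain_maps R W B" and sh: "s' \<in> chain_maps R A V" using r s by (auto simp: cplx_splits_def)
  define h where "h = (\<lambda>n e. j n (r n e) \<oplus>\<^bsub>obj V n\<^esub> s' n (p n e))"
  have "h \<in> chain_maps R W V"
    unfolding h_def by (rule chain_plus[OF chain_comp[OF rh ch(3)] chain_comp[OF ch(2) sh] cx(4)])
  moreover have "h n (i n b) = j n b" if "b \<in> carrier (obj B n)" for n b
  proof -
    interpret V: left_module R "obj V n" by (rule cplx_obj[OF cx(4)])
    show ?thesis
      using r that hom_closed[OF chain_hom[OF ch(3)]]
      by (simp add: h_def cplx_splits_def splits_def ses_zero[OF cplx_ses_ses[OF W(2)]]
          hom_zero[OF chain_hom[OF sh] cplx_obj[OF cx(1)] cplx_obj[OF cx(4)]])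
  qed
  moreover have "q n (h n x) = p n x" if "x \<in> carrier (obj W n)" for n x
  proof -
    interpret A: left_module R "obj A n" by (rule cplx_obj[OF cx(1)])
    show ?thesis
      using s that hom_closed[OF chain_hom[OF ch(2)]] hom_closed[OF chain_hom[OF ch(3)]]
        hom_closed[OF chain_hom[OF rh]] hom_closed[OF chain_hom[OF sh]]
      by (simp add: h_def cplx_splits_def splits_def hom_add[OF chain_hom[OF ch(4)]]
          ses_zero[OF cplx_ses_ses[OF V(2)]])
  qed
  ultimately show "((W, i, p), (V, j, q)) \<in> cplx_ext_equiv R U A B"
    using WV by (auto simp: cplx_ext_equiv_def intro!: bexI[of _ h])
qed

end

section \<open>Contractible complexes\<close>

lemma cplxI:
  assumes "\<And>n. left_module R (obj C n)" "\<And>n. dif C n \<in> rmod_hom R (obj C n) (obj C (n - 1))"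
    "\<And>n x. x \<in> carrier (obj C n) \<Longrightarrow> dif C (n - 1) (dif C n x) = \<zero>\<^bsub>obj C (n - 1 - 1)\<^esub>"
  shows "is_cplx R C"
  using assms by (simp add: is_cplx_def)

text \<open>The differential indexed by its target degree, so that the target reads \<open>n\<close>
  and not \<open>n + 1 - 1\<close>.\<close>

lemma cplx_dif_Suc: "is_cplx R C \<Longrightarrow> dif C (n + 1) \<in> rmod_hom R (obj C (n + 1)) (obj C n)"
  using cplx_dif[of R C "n + 1"] by simp

lemma cplx_dif_dif_Suc:
  "\<lbrakk>is_cplx R C; x \<in> carrier (obj C (n + 1))\<rbrakk> \<Longrightarrow> dif C n (dif C (n + 1) x) = \<zero>\<^bsub>obj C (n - 1)\<^esub>"
  using cplx_dif_dif[of R C x "n + 1"] by simp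

definition contraction :: "('r, 'k) ring_scheme \<Rightarrow> ('r, 'm) cplx \<Rightarrow> (int \<Rightarrow> 'm \<Rightarrow> 'm) \<Rightarrow> bool" where
  "contraction R C s \<longleftrightarrow> (\<forall>n. s n \<in> rmod_hom R (obj C n) (obj C (n + 1)) \<and>
     (\<forall>x\<in>carrier (obj C n). dif C (n + 1) (s n x) \<oplus>\<^bsub>obj C n\<^esub> s (n - 1) (dif C n x) = x))"

lemma contraction_hom: "contraction R C s \<Longrightarrow> s n \<in> rmod_hom R (obj C n) (obj C (n + 1))"
  and contraction_eq: "\<lbrakk>contraction R C s; x \<in> carrier (obj C n)\<rbrakk>
     \<Longrightarrow> dif C (n + 1) (s n x) \<oplus>\<^bsub>obj C n\<^esub> s (n - 1) (dif C n x) = x"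
  by (auto simp: contraction_def)

lemma contraction_hom_pred: "contraction R C s \<Longrightarrow> s (n - 1) \<in> rmod_hom R (obj C (n - 1)) (obj C n)"
  using contraction_hom[of R C s "n - 1"] by simp

lemma contraction_cycle:
  assumes s: "contraction R C s" and C: "is_cplx R C" and x: "x \<in> carrier (obj C n)"
    and dx: "dif C n x = \<zero>\<^bsub>obj C (n - 1)\<^esub>"
  shows "dif C (n + 1) (s n x) = x"
proof -
  interpret left_module R "obj C n" by (rule cplx_obj[OF C])
  have "dif C (n + 1) (s n x) \<in> carrier (obj C n)"
    by (rule hom_closed[OF cplx_dif_Suc[OF C] hom_closed[OF contraction_hom[OF s] x]])
  then show ?thesis
    using contraction_eq[OF s x] dx hom_zero[OF contraction_hom_pred[OF s] cplx_obj[OF C] cplx_obj[OF C]]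
    by simp
qed

lemma contraction_exact:
  assumes s: "contraction R C s" and C: "is_cplx R C"
  shows "exact_cplx C"
  unfolding exact_cplx_def
proof (intro allI equalityI subsetI)
  fix n x assume "x \<in> dif C (n + 1) ` carrier (obj C (n + 1))"
  then show "x \<in> carrier (cycles C n)"
    using hom_closed[OF cplx_dif_Suc[OF C]] cplx_dif_dif_Suc[OF C] by (auto simp: cycles_def)
next
  fix n x assume "x \<in> carrier (cycles C n)"
  then have "x \<in> carrier (obj C n)" "dif C n x = \<zero>\<^bsub>obj C (n - 1)\<^esub>" by (auto simp: cycles_def)
  then show "x \<in> dif C (n + 1) ` carrier (obj C (n + 1))"
    using contraction_cycle[OF s C] hom_closed[OF contraction_hom[OF s]] by (metis imageI)
qed

lemma cycles_left_module:
  assumes C: "is_cplx R C" shows "left_module R (cycles C n)"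
proof -
  interpret M: left_module R "obj C n" by (rule cplx_obj[OF C])
  interpret N: left_module R "obj C (n - 1)" by (rule cplx_obj[OF C])
  note d = cplx_dif[OF C]
  show ?thesis
    unfolding cycles_def
    by (rule submodule_left_module[OF cplx_obj[OF C]])
      (auto simp: hom_zero[OF d cplx_obj[OF C] cplx_obj[OF C]] hom_add[OF d] hom_smult[OF d]
        M.smult_closed N.smult_zero_right)
qed

text \<open>The map \<open>d s\<close> is a projection of the term onto its cycles: it has values in
  cycles because \<open>d d = 0\<close>, and it fixes them by
  \<open>contraction_cycle\<close>.\<close>

lemma cycles_retract:
  assumes s: "contraction R C s" and C: "is_cplx R C"
  shows "(\<lambda>x. x) \<in> rmod_hom R (cycles C n) (obj C n)"
    and "(\<lambda>x. dif C (n + 1) (s n x)) \<in> rmod_hom R (obj C n) (cycles C n)"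
    and "x \<in> carrier (cycles C n) \<Longrightarrow> dif C (n + 1) (s n x) = x"
proof -
  show "(\<lambda>x. x) \<in> rmod_hom R (cycles C n) (obj C n)" by (rule homI) (auto simp: cycles_def)
  show "(\<lambda>x. dif C (n + 1) (s n x)) \<in> rmod_hom R (obj C n) (cycles C n)"
    using hom_comp[OF contraction_hom[OF s] cplx_dif_Suc[OF C], of n]
      cplx_dif_dif_Suc[OF C hom_closed[OF contraction_hom[OF s]]]
    by (auto simp: rmod_hom_def cycles_def)
  show "x \<in> carrier (cycles C n) \<Longrightarrow> dif C (n + 1) (s n x) = x"
    using contraction_cycle[OF s C] by (auto simp: cycles_def)
qed

context module_class
begin

lemma C_star_cplx: "S \<in> C_star R U X \<Longrightarrow> S \<in> Cplxs R U"
  and C_star_obj: "S \<in> C_star R U X \<Longrightarrow> obj S n \<in> X"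
  by (auto simp: C_star_def)

lemma C_injective_cplx: "C \<in> C_injective R U X \<Longrightarrow> C \<in> Cplxs R U"
  and C_projective_cplx: "C \<in> C_projective R U X \<Longrightarrow> C \<in> Cplxs R U"
  by (auto simp: C_injective_def C_projective_def)

text \<open>A degreewise retraction \<open>\<rho>\<close> onto a contractible complex gives the chain retraction
  \<open>d s \<rho> + s \<rho> d\<close>.\<close>

lemma contractible_C_injective:
  assumes C: "C \<in> Cplxs R U" and s: "contraction R C s" and perp: "\<And>n. obj C n \<in> right_perp R U X"
  shows "C \<in> C_injective R U X"
  unfolding C_injective_def mem_Collect_eq
proof (intro conjI ballI C)
  fix S assume S: "S \<in> C_star R U X"
  show "is_singleton (cplx_Ext1 R U S C)"
  proof (rule cplx_Ext1_singletonI[OF C_star_cplx[OF S] C])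
    fix W i p assume W: "W \<in> Cplxs R U" and e: "cplx_ses R C i W p S"
    note cC = Cplxs_cplx[OF C] and cW = Cplxs_cplx[OF W] and cS = Cplxs_cplx[OF C_star_cplx[OF S]]
    note i = cplx_ses_chain1[OF e]
    have "\<exists>r t. splits R (obj C n) (i n) (obj W n) (p n) (obj S n) r t" for n
      using right_perp_splits[OF perp C_star_obj[OF S] cplx_obj[OF cW] cplx_ses_ses[OF e]] by metis
    then obtain \<rho> t where "\<And>n. splits R (obj C n) (i n) (obj W n) (p n) (obj S n) (\<rho> n) (t n)" by metis
    then have \<rho>: "\<rho> n \<in> rmod_hom R (obj W n) (obj C n)" and
      \<rho>i: "c \<in> carrier (obj C n) \<Longrightarrow> \<rho> n (i n c) = c" for n c by (auto simp: splits_def)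
    note sh = contraction_hom[OF s] and sh' = contraction_hom_pred[OF s]
    note dC = cplx_dif[OF cC] and dC' = cplx_dif_Suc[OF cC] and dW = cplx_dif[OF cW]
    define r where "r = (\<lambda>n w. dif C (n + 1) (s n (\<rho> n w)) \<oplus>\<^bsub>obj C n\<^esub> s (n - 1) (\<rho> (n - 1) (dif W n w)))"
    have rh: "r n \<in> rmod_hom R (obj W n) (obj C n)" for n
      unfolding r_def
      by (intro hom_plus cplx_obj cC hom_comp[OF hom_comp[OF \<rho> sh] dC'] hom_comp[OF hom_comp[OF dW \<rho>] sh'])
    have "dif C n (r n w) = r (n - 1) (dif W n w)" if w: "w \<in> carrier (obj W n)" for n w
    proof -
      interpret L: left_module R "obj C (n - 1)" by (rule cplx_obj[OF cC])
      let ?u = "\<rho> (n - 1) (dif W n w)"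
      have u: "?u \<in> carrier (obj C (n - 1))" by (rule hom_closed[OF \<rho> hom_closed[OF dW w]])
      \<comment> \<open>On the left \<open>d d = 0\<close> removes the first summand of
        \<open>r\<close>, on the right the second one; both sides become
        \<open>d s \<rho> d\<close>.\<close>
      have 1: "dif C n (r n w) = dif C n (s (n - 1) ?u)"
        unfolding r_def
        using hom_closed[OF sh hom_closed[OF \<rho> w]] hom_closed[OF sh' u] u
        by (simp add: hom_add[OF dC] hom_closed[OF dC'] hom_closed[OF dC] cplx_dif_dif_Suc[OF cC])
      have 2: "r (n - 1) (dif W n w) = dif C n (s (n - 1) ?u)"
        unfolding r_def
        using hom_closed[OF sh' u] w hom_zero[OF sh'[of "n - 1"] cplx_obj[OF cC] cplx_obj[OF cC]]
        by (simp add: cplx_dif_dif[OF cW] hom_zero[OF \<rho> cplx_obj[OF cW] cplx_obj[OF cC]]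
            hom_closed[OF dC])
      show ?thesis using 1 2 by simp
    qed
    then have chain: "r \<in> chain_maps R W C" using rh by (simp add: chain_maps_def)
    have ri: "r n (i n c) = c" if c: "c \<in> carrier (obj C n)" for n c
      using contraction_eq[OF s c] hom_closed[OF dC c]
      by (simp add: r_def \<rho>i c chain_comm[OF i c])
    show "\<exists>r t. cplx_splits R C i W p S r t"
      by (rule cplx_retraction_splits[OF e cC cW cS chain ri]) blast+
  qed
qed

text \<open>Dually, a degreewise section \<open>\<sigma>\<close> of \<open>p\<close> is turned into
  the chain section \<open>d \<sigma> s + \<sigma> s d\<close>. It is a section because
  \<open>p \<sigma> = 1\<close> and \<open>p\<close> commutes with \<open>d\<close>, which leaves
  \<open>d s + s d = 1\<close>.\<close>

lemma contractible_C_projective: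
  assumes C: "C \<in> Cplxs R U" and s: "contraction R C s" and perp: "\<And>n. obj C n \<in> left_perp R U X"
  shows "C \<in> C_projective R U X"
  unfolding C_projective_def mem_Collect_eq
proof (intro conjI ballI C)
  fix S assume S: "S \<in> C_star R U X"
  show "is_singleton (cplx_Ext1 R U C S)"
  proof (rule cplx_Ext1_singletonI[OF C C_star_cplx[OF S]])
    fix W i p assume W: "W \<in> Cplxs R U" and e: "cplx_ses R S i W p C"
    note cC = Cplxs_cplx[OF C] and cW = Cplxs_cplx[OF W] and cS = Cplxs_cplx[OF C_star_cplx[OF S]]
    note p = cplx_ses_chain2[OF e]
    have "\<exists>r t. splits R (obj S n) (i n) (obj W n) (p n) (obj C n) r t" for n
      using left_perp_splits[OF perp C_star_obj[OF S] cplx_obj[OF cW] cplx_ses_ses[OF e]] by metis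
    then obtain t \<sigma> where "\<And>n. splits R (obj S n) (i n) (obj W n) (p n) (obj C n) (t n) (\<sigma> n)" by metis
    then have \<sigma>: "\<sigma> n \<in> rmod_hom R (obj C n) (obj W n)" and
      p\<sigma>: "c \<in> carrier (obj C n) \<Longrightarrow> p n (\<sigma> n c) = c" for n c by (auto simp: splits_def)
    note sh = contraction_hom[OF s] and sh' = contraction_hom_pred[OF s]
    note dC = cplx_dif[OF cC] and dW' = cplx_dif_Suc[OF cW] and dW = cplx_dif[OF cW]
    define r where "r = (\<lambda>n c. dif W (n + 1) (\<sigma> (n + 1) (s n c)) \<oplus>\<^bsub>obj W n\<^esub> \<sigma> n (s (n - 1) (dif C n c)))"
    have rh: "r n \<in> rmod_hom R (obj C n) (obj W n)" for n
      unfolding r_def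
      by (intro hom_plus cplx_obj cW hom_comp[OF hom_comp[OF sh \<sigma>] dW'] hom_comp[OF hom_comp[OF dC sh'] \<sigma>])
    have "dif W n (r n c) = r (n - 1) (dif C n c)" if c: "c \<in> carrier (obj C n)" for n c
    proof -
      interpret L: left_module R "obj W (n - 1)" by (rule cplx_obj[OF cW])
      let ?u = "s (n - 1) (dif C n c)"
      have u: "?u \<in> carrier (obj C n)" by (rule hom_closed[OF sh' hom_closed[OF dC c]])
      have 1: "dif W n (r n c) = dif W n (\<sigma> n ?u)"
        unfolding r_def
        using hom_closed[OF \<sigma> hom_closed[OF sh c]] hom_closed[OF \<sigma> u]
        by (simp add: hom_add[OF dW] hom_closed[OF dW'] hom_closed[OF dW] cplx_dif_dif_Suc[OF cW])
      have 2: "r (n - 1) (dif C n c) = dif W n (\<sigma> n ?u)"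
        unfolding r_def
        using hom_closed[OF \<sigma> u] c hom_zero[OF sh'[of "n - 1"] cplx_obj[OF cC] cplx_obj[OF cC]]
        by (simp add: cplx_dif_dif[OF cC] hom_zero[OF \<sigma> cplx_obj[OF cC] cplx_obj[OF cW]]
            hom_closed[OF dW])
      show ?thesis using 1 2 by simp
    qed
    then have chain: "r \<in> chain_maps R C W" using rh by (simp add: chain_maps_def)
    have pr: "p n (r n c) = c" if c: "c \<in> carrier (obj C n)" for n c
    proof -
      have cl: "\<sigma> (n + 1) (s n c) \<in> carrier (obj W (n + 1))" "\<sigma> n (s (n - 1) (dif C n c)) \<in> carrier (obj W n)"
        using c by (auto intro!: hom_closed[OF \<sigma>] hom_closed[OF sh] hom_closed[OF sh'] hom_closed[OF dC])
      have "p n (r n c) = p n (dif W (n + 1) (\<sigma> (n + 1) (s n c))) \<oplus>\<^bsub>obj C n\<^esub> p n (\<sigma> n (s (n - 1) (dif C n c)))"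
        unfolding r_def by (rule hom_add[OF chain_hom[OF p] hom_closed[OF dW' cl(1)] cl(2)])
      also have "\<dots> = c"
        using contraction_eq[OF s c] chain_comm[OF p cl(1)] c
        by (simp add: p\<sigma> hom_closed[OF sh] hom_closed[OF sh'] hom_closed[OF dC])
      finally show ?thesis .
    qed
    show "\<exists>r t. cplx_splits R S i W p C r t"
      by (rule cplx_section_splits[OF e cS cW cC chain pr]) blast+
  qed
qed

text \<open>Every \<open>C\<close> embeds in the contractible complex \<open>C\<^sub>n \<oplus> C\<^bsub>n-1\<^esub>\<close> with differential
  \<open>(x, y) \<mapsto> (y, 0)\<close> and with a shift of \<open>C\<close> as cokernel; a retraction yields a contraction.\<close>

lemma C_injective_contraction:
  assumes C: "C \<in> C_injective R U X" and CX: "\<And>n. obj C n \<in> X"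
  obtains s where "contraction R C s"
proof -
  note cC' = C_injective_cplx[OF C]
  note cC = Cplxs_cplx[OF cC']
  note d = cplx_dif[OF cC] and M = cplx_obj[OF cC]
  \<comment> \<open>The sign is forced by the projection \<open>(x, y) \<mapsto> y - d x\<close>: it
    sends the differential \<open>(y, 0)\<close> to \<open>- d y\<close>.\<close>
  define S where "S = \<lparr>obj = (\<lambda>n. obj C (n - 1)), dif = (\<lambda>n x. \<ominus>\<^bsub>obj C (n - 1 - 1)\<^esub> dif C (n - 1) x)\<rparr>"
  define E where "E = \<lparr>obj = (\<lambda>n. dprod (obj C n) (obj C (n - 1))), dif = (\<lambda>n z. (snd z, \<zero>\<^bsub>obj C (n - 1 - 1)\<^esub>))\<rparr>"
  have z: "\<zero>\<^bsub>obj C n\<^esub> \<in> carrier (obj C n)" for n using M by (meson abelian_groupE(2) left_module_group)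
  have cS: "is_cplx R S"
  proof (rule cplxI)
    fix n x assume "x \<in> carrier (obj S n)"
    then have "x \<in> carrier (obj C (n - 1))" by (simp add: S_def)
    note x = this hom_closed[OF d this]
    \<comment> \<open>The target degree \<open>n - 1 - 1 - 1\<close> in simplified form.\<close>
    interpret A: left_module R "obj C (n - 3)" by (rule M)
    show "dif S (n - 1) (dif S n x) = \<zero>\<^bsub>obj S (n - 1 - 1)\<^esub>"
      using x cplx_dif_dif[OF cC x(1)] by (simp add: S_def hom_neg[OF d M M])
  next
    show "dif S n \<in> rmod_hom R (obj S n) (obj S (n - 1))" for n
      using hom_uminus[OF d[of "n - 1"] M] by (simp add: S_def)
  qed (auto simp: S_def intro: M)
  have "S \<in> C_star R U X" using cS CX X_Mods by (auto simp: C_star_def Cplxs_def S_def)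
  have cE: "is_cplx R E"
    by (rule cplxI) (auto simp: E_def intro!: dprod_left_module M hom_Pair hom_snd hom_const_zero)
  have e: "cplx_ses R C (\<lambda>n c. (c, dif C n c)) E (\<lambda>n z. snd z \<ominus>\<^bsub>obj C (n - 1)\<^esub> dif C n (fst z)) S"
    unfolding cplx_ses_def
  proof (intro conjI allI)
    have i: "(\<lambda>c. (c, dif C n c)) \<in> rmod_hom R (obj C n) (obj E n)" for n
      by (auto simp: E_def intro!: hom_Pair hom_id d)
    then show "(\<lambda>n c. (c, dif C n c)) \<in> chain_maps R C E"
      by (auto simp: chain_maps_def E_def cplx_dif_dif[OF cC])
    have p: "(\<lambda>z. snd z \<ominus>\<^bsub>obj C (n - 1)\<^esub> dif C n (fst z)) \<in> rmod_hom R (obj E n) (obj S n)" for n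
      by (auto simp: E_def S_def intro!: hom_diff[OF hom_snd hom_comp[OF hom_fst d]] M)
    show "(\<lambda>n z. snd z \<ominus>\<^bsub>obj C (n - 1)\<^esub> dif C n (fst z)) \<in> chain_maps R E S"
      unfolding chain_maps_def mem_Collect_eq
    proof (intro allI conjI ballI p)
      fix n z assume "z \<in> carrier (obj E n)"
      then have z: "fst z \<in> carrier (obj C n)" "snd z \<in> carrier (obj C (n - 1))" by (auto simp: E_def)
      interpret A: left_module R "obj C (n - 2)" by (rule M)
      note dz = hom_closed[OF d z(1)] hom_closed[OF d z(2)]
      have "dif C (n - 1) (snd z \<ominus>\<^bsub>obj C (n - 1)\<^esub> dif C n (fst z)) = dif C (n - 1) (snd z)"
        using z dz by (simp add: hom_minus[OF d M M] cplx_dif_dif[OF cC])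
      then show "dif S n (snd z \<ominus>\<^bsub>obj C (n - 1)\<^esub> dif C n (fst z)) =
         snd (dif E n z) \<ominus>\<^bsub>obj C (n - 1 - 1)\<^esub> dif C (n - 1) (fst (dif E n z))"
        using dz by (simp add: S_def E_def a_minus_def)
    qed
    fix n
    interpret A: left_module R "obj C (n - 1)" by (rule M)
    show "ses R (obj C n) (\<lambda>c. (c, dif C n c)) (obj E n) (\<lambda>z. snd z \<ominus>\<^bsub>obj C (n - 1)\<^esub> dif C n (fst z)) (obj S n)"
    proof (rule sesI[OF i p M cplx_obj[OF cE]])
      fix c assume c: "c \<in> carrier (obj S n)"
      then show "\<exists>b\<in>carrier (obj E n). snd b \<ominus>\<^bsub>obj C (n - 1)\<^esub> dif C n (fst b) = c"
        using z by (intro bexI[of _ "(\<zero>\<^bsub>obj C n\<^esub>, c)"]) (auto simp: S_def E_def hom_zero[OF d M M])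
    next
      fix b assume "b \<in> carrier (obj E n)" "snd b \<ominus>\<^bsub>obj C (n - 1)\<^esub> dif C n (fst b) = \<zero>\<^bsub>obj S n\<^esub>"
      then show "\<exists>a\<in>carrier (obj C n). b = (a, dif C n a)"
        by (intro bexI[of _ "fst b"]) (auto simp: S_def E_def hom_closed[OF d] prod_eq_iff)
    qed (auto simp: E_def S_def hom_closed[OF d])
  qed
  have "is_singleton (cplx_Ext1 R U S C)" using C \<open>S \<in> _\<close> by (auto simp: C_injective_def)
  then obtain r t where "cplx_splits R C (\<lambda>n c. (c, dif C n c)) E (\<lambda>n z. snd z \<ominus>\<^bsub>obj C (n - 1)\<^esub> dif C n (fst z)) S r t"
    using cplx_Ext1_splits[OF C_star_cplx[OF \<open>S \<in> _\<close>] cC' _ cE e] by blast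
  then have r: "r \<in> chain_maps R E C" and ri: "c \<in> carrier (obj C n) \<Longrightarrow> r n (c, dif C n c) = c" for n c
    by (auto simp: cplx_splits_def splits_def)
  have in2: "(\<lambda>x. (\<zero>\<^bsub>obj C (n + 1)\<^esub>, x)) \<in> rmod_hom R (obj C n) (obj E (n + 1))" for n
    by (auto simp: E_def intro!: hom_Pair hom_const_zero hom_id M)
  \<comment> \<open>As \<open>(0, x)\<close> has differential \<open>(x, 0)\<close>, the two terms
    of the contraction equation are \<open>r (x, 0)\<close> and \<open>r (0, d x)\<close>. They add
    up to \<open>r (x, d x)\<close>, the value of \<open>r\<close> on the embedded
    \<open>x\<close>.\<close>
  have "contraction R C (\<lambda>n x. r (n + 1) (\<zero>\<^bsub>obj C (n + 1)\<^esub>, x))"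
    unfolding contraction_def
  proof (intro allI conjI ballI)
    fix n
    show "(\<lambda>x. r (n + 1) (\<zero>\<^bsub>obj C (n + 1)\<^esub>, x)) \<in> rmod_hom R (obj C n) (obj C (n + 1))"
      by (rule hom_comp[OF in2 chain_hom[OF r]])
    fix x assume x: "x \<in> carrier (obj C n)"
    interpret A: left_module R "obj C n" by (rule M)
    interpret B: left_module R "obj C (n - 1)" by (rule M)
    have "dif C (n + 1) (r (n + 1) (\<zero>\<^bsub>obj C (n + 1)\<^esub>, x)) = r n (x, \<zero>\<^bsub>obj C (n - 1)\<^esub>)"
      using chain_comm[OF r hom_closed[OF in2 x]] by (simp add: E_def)
    moreover have "r n (x, \<zero>\<^bsub>obj C (n - 1)\<^esub>) \<oplus>\<^bsub>obj C n\<^esub> r n (\<zero>\<^bsub>obj C n\<^esub>, dif C n x) = r n (x, dif C n x)"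
      using hom_add[OF chain_hom[OF r, of n], of "(x, \<zero>\<^bsub>obj C (n - 1)\<^esub>)" "(\<zero>\<^bsub>obj C n\<^esub>, dif C n x)"]
        x hom_closed[OF d x] by (simp add: E_def)
    ultimately show "dif C (n + 1) (r (n + 1) (\<zero>\<^bsub>obj C (n + 1)\<^esub>, x)) \<oplus>\<^bsub>obj C n\<^esub>
        r (n - 1 + 1) (\<zero>\<^bsub>obj C (n - 1 + 1)\<^esub>, dif C n x) = x"
      using ri[OF x] by simp
  qed
  then show thesis by (rule that)
qed

text \<open>Here \<open>C\<close> is a quotient of the contractible complex with terms
  \<open>C n\<close> plus \<open>C (n + 1)\<close> and differential
  \<open>(x, y) \<mapsto> (0, x)\<close>, via \<open>(x, y) \<mapsto> x + d y\<close>. The kernel is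
  a shift of \<open>C\<close>, so there is a chain section, whose second component is a
  contraction.\<close>

lemma C_projective_contraction:
  assumes C: "C \<in> C_projective R U X" and CX: "\<And>n. obj C n \<in> X"
  obtains s where "contraction R C s"
proof -
  note cC' = C_projective_cplx[OF C]
  note cC = Cplxs_cplx[OF cC']
  note d = cplx_dif[OF cC] and d' = cplx_dif_Suc[OF cC] and M = cplx_obj[OF cC]
  define S where "S = \<lparr>obj = (\<lambda>n. obj C (n + 1)), dif = (\<lambda>n x. \<ominus>\<^bsub>obj C n\<^esub> dif C (n + 1) x)\<rparr>"
  define E where "E = \<lparr>obj = (\<lambda>n. dprod (obj C n) (obj C (n + 1))), dif = (\<lambda>n z. (\<zero>\<^bsub>obj C (n - 1)\<^esub>, fst z))\<rparr>"
  have cS: "is_cplx R S"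
  proof (rule cplxI)
    fix n x assume "x \<in> carrier (obj S n)"
    then have "x \<in> carrier (obj C (n + 1))" by (simp add: S_def)
    note x = this hom_closed[OF d' this]
    interpret A: left_module R "obj C (n - 1)" by (rule M)
    show "dif S (n - 1) (dif S n x) = \<zero>\<^bsub>obj S (n - 1 - 1)\<^esub>"
      using x cplx_dif_dif_Suc[OF cC x(1)] by (simp add: S_def hom_neg[OF d M M])
  qed (auto simp: S_def intro: M hom_uminus[OF d' M])
  have "S \<in> C_star R U X" using cS CX X_Mods by (auto simp: C_star_def Cplxs_def S_def)
  have cE: "is_cplx R E"
    by (rule cplxI) (auto simp: E_def intro!: dprod_left_module M hom_Pair hom_fst hom_const_zero)
  have e: "cplx_ses R S (\<lambda>n y. (\<ominus>\<^bsub>obj C n\<^esub> dif C (n + 1) y, y)) E (\<lambda>n z. fst z \<oplus>\<^bsub>obj C n\<^esub> dif C (n + 1) (snd z)) C"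
    unfolding cplx_ses_def
  proof (intro conjI allI)
    have i: "(\<lambda>y. (\<ominus>\<^bsub>obj C n\<^esub> dif C (n + 1) y, y)) \<in> rmod_hom R (obj S n) (obj E n)" for n
      by (auto simp: E_def S_def intro!: hom_Pair hom_id hom_uminus d' M)
    show "(\<lambda>n y. (\<ominus>\<^bsub>obj C n\<^esub> dif C (n + 1) y, y)) \<in> chain_maps R S E"
      unfolding chain_maps_def mem_Collect_eq
    proof (intro allI conjI ballI i)
      fix n x assume "x \<in> carrier (obj S n)"
      then have "x \<in> carrier (obj C (n + 1))" by (simp add: S_def)
      note x = this hom_closed[OF d' this]
      interpret A: left_module R "obj C (n - 1)" by (rule M)
      show "dif E n (\<ominus>\<^bsub>obj C n\<^esub> dif C (n + 1) x, x) =
        (\<ominus>\<^bsub>obj C (n - 1)\<^esub> dif C (n - 1 + 1) (dif S n x), dif S n x)"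
        using x cplx_dif_dif_Suc[OF cC x(1)] by (simp add: S_def E_def hom_neg[OF d M M])
    qed
    have p: "(\<lambda>z. fst z \<oplus>\<^bsub>obj C n\<^esub> dif C (n + 1) (snd z)) \<in> rmod_hom R (obj E n) (obj C n)" for n
      by (auto simp: E_def intro!: hom_plus[OF hom_fst hom_comp[OF hom_snd d']] M)
    show "(\<lambda>n z. fst z \<oplus>\<^bsub>obj C n\<^esub> dif C (n + 1) (snd z)) \<in> chain_maps R E C"
      unfolding chain_maps_def mem_Collect_eq
    proof (intro allI conjI ballI p)
      fix n z assume "z \<in> carrier (obj E n)"
      then have z: "fst z \<in> carrier (obj C n)" "snd z \<in> carrier (obj C (n + 1))" by (auto simp: E_def)
      interpret A: left_module R "obj C (n - 1)" by (rule M)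
      show "dif C n (fst z \<oplus>\<^bsub>obj C n\<^esub> dif C (n + 1) (snd z)) =
        fst (dif E n z) \<oplus>\<^bsub>obj C (n - 1)\<^esub> dif C (n - 1 + 1) (snd (dif E n z))"
        using z hom_closed[OF d' z(2)] hom_closed[OF d z(1)]
        by (simp add: E_def hom_add[OF d] cplx_dif_dif_Suc[OF cC])
    qed
    fix n
    interpret A: left_module R "obj C n" by (rule M)
    interpret B: left_module R "obj C (n + 1)" by (rule M)
    show "ses R (obj S n) (\<lambda>y. (\<ominus>\<^bsub>obj C n\<^esub> dif C (n + 1) y, y)) (obj E n) (\<lambda>z. fst z \<oplus>\<^bsub>obj C n\<^esub> dif C (n + 1) (snd z)) (obj C n)"
    proof (rule sesI[OF i p cplx_obj[OF cS] cplx_obj[OF cE]])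
      fix c assume c: "c \<in> carrier (obj C n)"
      then show "\<exists>b\<in>carrier (obj E n). fst b \<oplus>\<^bsub>obj C n\<^esub> dif C (n + 1) (snd b) = c"
        by (intro bexI[of _ "(c, \<zero>\<^bsub>obj C (n + 1)\<^esub>)"]) (auto simp: E_def hom_zero[OF d' M M])
    next
      fix b assume b: "b \<in> carrier (obj E n)" "fst b \<oplus>\<^bsub>obj C n\<^esub> dif C (n + 1) (snd b) = \<zero>\<^bsub>obj C n\<^esub>"
      then have "fst b \<in> carrier (obj C n)" "dif C (n + 1) (snd b) \<in> carrier (obj C n)"
        by (auto simp: E_def hom_closed[OF d'])
      then have "fst b = \<ominus>\<^bsub>obj C n\<^esub> dif C (n + 1) (snd b)" using b(2) A.minus_equality by metis
      then show "\<exists>a\<in>carrier (obj S n). b = (\<ominus>\<^bsub>obj C n\<^esub> dif C (n + 1) a, a)"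
        using b(1) by (intro bexI[of _ "snd b"]) (auto simp: S_def E_def prod_eq_iff)
    qed (auto simp: E_def S_def hom_closed[OF d'] A.l_neg)
  qed
  have "is_singleton (cplx_Ext1 R U C S)" using C \<open>S \<in> _\<close> by (auto simp: C_projective_def)
  then obtain r t where rt: "cplx_splits R S (\<lambda>n y. (\<ominus>\<^bsub>obj C n\<^esub> dif C (n + 1) y, y)) E (\<lambda>n z. fst z \<oplus>\<^bsub>obj C n\<^esub> dif C (n + 1) (snd z)) C r t"
    using cplx_Ext1_splits[OF cC' C_star_cplx[OF \<open>S \<in> _\<close>] _ cE e] by blast
  then have t: "t \<in> chain_maps R C E"
    and pt: "c \<in> carrier (obj C n) \<Longrightarrow> fst (t n c) \<oplus>\<^bsub>obj C n\<^esub> dif C (n + 1) (snd (t n c)) = c" for n c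
    unfolding cplx_splits_def splits_def by blast+
  have th: "t n \<in> rmod_hom R (obj C n) (dprod (obj C n) (obj C (n + 1)))" for n
    using chain_hom[OF t, of n] by (simp add: E_def)
  have "contraction R C (\<lambda>n x. snd (t n x))"
    unfolding contraction_def
  proof (intro allI conjI ballI)
    fix n
    show "(\<lambda>x. snd (t n x)) \<in> rmod_hom R (obj C n) (obj C (n + 1))"
      by (rule hom_comp[OF th hom_snd])
    fix x assume x: "x \<in> carrier (obj C n)"
    interpret A: left_module R "obj C n" by (rule M)
    \<comment> \<open>Compatibility of \<open>t\<close> with the differentials, read in the second
      component. It turns the section equation \<open>fst (t x) + d (snd (t x)) = x\<close> into the
      contraction equation.\<close>
    have "snd (t (n - 1) (dif C n x)) = fst (t n x)"
      using chain_comm[OF t x] by (simp add: E_def prod_eq_iff)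
    moreover have "fst (t n x) \<in> carrier (obj C n)" "snd (t n x) \<in> carrier (obj C (n + 1))"
      using hom_closed[OF th x] by auto
    ultimately show "dif C (n + 1) (snd (t n x)) \<oplus>\<^bsub>obj C n\<^esub> snd (t (n - 1) (dif C n x)) = x"
      using pt[OF x] hom_closed[OF d'] by (simp add: A.a_comm)
  qed
  then show thesis by (rule that)
qed

end

section \<open>The terms of \<open>X\<close>-injective and \<open>X\<close>-projective
  complexes\<close>

context module_class
begin

text \<open>The test complex assembled from discs on \<open>A\<close> in all degrees has the sum of
  two copies of \<open>A\<close> as terms; closure under extensions keeps it in
  \<open>X\<close>.\<close>

lemma obtain_X_biproduct:
  assumes ext: "closed_under_extensions R U X" and A: "A \<in> X" and B: "B \<in> X"
  obtains T e e' where "T \<in> X" "e \<in> rmod_hom R (dprod A B) T" "e' \<in> rmod_hom R T (dprod A B)"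
    "\<And>x. x \<in> carrier (dprod A B) \<Longrightarrow> e' (e x) = x" "\<And>y. y \<in> carrier T \<Longrightarrow> e (e' y) = y"
proof -
  obtain T e e' where T: "T \<in> Mods R U" and e: "e \<in> rmod_hom R (dprod A B) T" "e' \<in> rmod_hom R T (dprod A B)"
    "\<And>x. x \<in> carrier (dprod A B) \<Longrightarrow> e' (e x) = x" "\<And>y. y \<in> carrier T \<Longrightarrow> e (e' y) = y"
    using obtain_biproduct[OF X_in_Mods[OF A] X_in_Mods[OF B]] by metis
  note m = X_left_module[OF A] X_left_module[OF B]
  have "ses R A (\<lambda>a. e (a, \<zero>\<^bsub>B\<^esub>)) T (\<lambda>y. snd (e' y)) B"
    by (rule ses_transport[OF ses_dprod[OF m] m(1) Mods_left_module[OF T] dprod_left_module[OF m] e])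
  then have "T \<in> X" using ext A B T unfolding closed_under_extensions_def short_exact_eq_ses by blast
  then show thesis using e by (rule that)
qed

text \<open>
  \<open>Ext\<^sup>1(D, C) = Ext\<^sup>1(A, C\<^sub>n)\<close> for the disc complex \<open>D\<close> on \<open>A\<close> in degrees \<open>n\<close> and \<open>n - 1\<close>.
  To avoid distinguishing degrees, the discs in all degrees are used at once: extensions
  \<open>0 \<rightarrow> C\<^sub>k \<rightarrow> W\<^sub>k \<rightarrow> A \<rightarrow> 0\<close> are assembled to the extension of complexes whose \<open>k\<close>-th term is the
  pushout of \<open>W\<^sub>k\<close> and \<open>W\<^bsub>k+1\<^esub>\<close> over \<open>C\<^bsub>k+1\<^esub>\<close>.
\<close>

lemma C_injective_right_perp:
  assumes ext: "closed_under_extensions R U X" and C: "C \<in> C_injective R U X"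
  shows "obj C n \<in> right_perp R U X"
proof (rule right_perpI)
  note cC' = C_injective_cplx[OF C]
  note cC = Cplxs_cplx[OF cC']
  note d = cplx_dif[OF cC] and d' = cplx_dif_Suc[OF cC] and M = cplx_obj[OF cC]
  show "obj C n \<in> Mods R U" by (rule Cplxs_Mods[OF cC'])
  fix A N i p assume A: "A \<in> X" and N: "N \<in> Mods R U" and e0: "ses R (obj C n) i N p A"
  note mA = X_left_module[OF A]
  \<comment> \<open>The extension to be split is put in degree \<open>n\<close>, the trivial one in
    all other degrees.\<close>
  have "\<exists>W j q. W \<in> Mods R U \<and> ses R (obj C k) j W q A \<and> (k = n \<longrightarrow> W = N \<and> j = i \<and> q = p)" for k
  proof (cases "k = n")
    case True then show ?thesis using N e0 by blast
  next
    case False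
    obtain T e e' where T: "T \<in> Mods R U" and e: "e \<in> rmod_hom R (dprod (obj C k) A) T"
      "e' \<in> rmod_hom R T (dprod (obj C k) A)"
      "\<And>x. x \<in> carrier (dprod (obj C k) A) \<Longrightarrow> e' (e x) = x" "\<And>y. y \<in> carrier T \<Longrightarrow> e (e' y) = y"
      using obtain_biproduct[OF Cplxs_Mods[OF cC', of k] X_in_Mods[OF A]] by metis
    from ses_transport[OF ses_dprod[OF M mA] M Mods_left_module[OF T] dprod_left_module[OF M mA] e] T False
    show ?thesis by blast
  qed
  then obtain W j q where W': "\<And>k. W k \<in> Mods R U" and e: "\<And>k. ses R (obj C k) (j k) (W k) (q k) A"
    and Wn: "W n = N" "j n = i" "q n = p" by metis
  note W = Mods_left_module[OF W']
  note j = ses_hom1[OF e] and q = ses_hom2[OF e]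
  note jd = hom_comp[OF d' j]
  have "\<exists>Q \<phi>. pushout R (obj C (k + 1)) (\<lambda>c. j k (dif C (k + 1) c)) (W k) (j (k + 1)) (W (k + 1)) \<phi>
      (Q :: ('r, ('m \<times> 'm) set) module)" for k
    by (rule obtain_pushout[OF M W W jd[of k] j[of "k + 1"]]) blast
  then obtain Q \<phi> where po: "\<And>k. pushout R (obj C (k + 1)) (\<lambda>c. j k (dif C (k + 1) c)) (W k) (j (k + 1)) (W (k + 1)) (\<phi> k)
      (Q k :: ('r, ('m \<times> 'm) set) module)" by metis
  have Q: "left_module R (Q k)" and \<phi>: "\<phi> k \<in> rmod_hom R (dprod (W k) (W (k + 1))) (Q k)"
    and \<phi>_surj: "\<phi> k ` carrier (dprod (W k) (W (k + 1))) = carrier (Q k)" for k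
    using po[of k] by (auto simp: pushout_def)
  have \<phi>0: "\<exists>c\<in>carrier (obj C (k + 1)). fst z = j k (dif C (k + 1) c) \<and> snd z = \<ominus>\<^bsub>W (k + 1)\<^esub> j (k + 1) c"
    if "z \<in> carrier (dprod (W k) (W (k + 1)))" "\<phi> k z = \<zero>\<^bsub>Q k\<^esub>" for k z
    using that po[of k] unfolding pushout_def by (cases z) auto
  have \<phi>_comm: "\<phi> k (j k (dif C (k + 1) c), \<zero>\<^bsub>W (k + 1)\<^esub>) = \<phi> k (\<zero>\<^bsub>W k\<^esub>, j (k + 1) c)"
    if "c \<in> carrier (obj C (k + 1))" for k c
    using pushout_comm[OF M W W jd j po that] .
  have zW: "\<zero>\<^bsub>W k\<^esub> \<in> carrier (W k)" for k
    using W by (meson abelian_groupE(2) left_module_group)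
  have z0: "\<phi> k (\<zero>\<^bsub>W k\<^esub>, \<zero>\<^bsub>W (k + 1)\<^esub>) = \<zero>\<^bsub>Q k\<^esub>" for k
    using hom_zero[OF \<phi> dprod_left_module[OF W W] Q, of k] by simp

  have in2: "(\<lambda>z. \<phi> (k - 1) (\<zero>\<^bsub>W (k - 1)\<^esub>, fst z)) \<in> rmod_hom R (dprod (W k) (W (k + 1))) (Q (k - 1))" for k
  proof -
    have "fst \<in> rmod_hom R (dprod (W k) (W (k + 1))) (W (k - 1 + 1))" using hom_fst[of R "W k"] by simp
    from hom_comp[OF hom_Pair[OF hom_const_zero[OF W] this] \<phi>] show ?thesis .
  qed
  \<comment> \<open>The differential sends the class of \<open>(x, y)\<close> to that of
    \<open>(0, x)\<close>. It is well defined because \<open>(0, j (d c))\<close> is identified with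
    \<open>(j (d (d c)), 0)\<close>, which is zero.\<close>
  have "\<exists>D\<in>rmod_hom R (Q k) (Q (k - 1)). \<forall>z\<in>carrier (dprod (W k) (W (k + 1))).
      D (\<phi> k z) = \<phi> (k - 1) (\<zero>\<^bsub>W (k - 1)\<^esub>, fst z)" for k
  proof -
    have ker: "\<phi> (k - 1) (\<zero>\<^bsub>W (k - 1)\<^esub>, fst z) = \<zero>\<^bsub>Q (k - 1)\<^esub>"
      if z: "z \<in> carrier (dprod (W k) (W (k + 1)))" "\<phi> k z = \<zero>\<^bsub>Q k\<^esub>" for z
    proof -
      obtain c where c: "c \<in> carrier (obj C (k + 1))" "fst z = j k (dif C (k + 1) c)" using \<phi>0[OF z] by blast
      show ?thesis
        using \<phi>_comm[of "dif C (k + 1) c" "k - 1"] c hom_closed[OF d' c(1)] cplx_dif_dif_Suc[OF cC c(1)]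
          hom_zero[OF j M W] z0[of "k - 1"] by simp
    qed
    show ?thesis
      by (rule factor_hom[OF \<phi> \<phi>_surj in2 ker dprod_left_module[OF W W] Q Q]) blast+
  qed
  then obtain D where D: "\<And>k. D k \<in> rmod_hom R (Q k) (Q (k - 1))"
    and D\<phi>: "\<And>k x y. \<lbrakk>x \<in> carrier (W k); y \<in> carrier (W (k + 1))\<rbrakk> \<Longrightarrow> D k (\<phi> k (x, y)) = \<phi> (k - 1) (\<zero>\<^bsub>W (k - 1)\<^esub>, x)"
    by (metis dprod_simps(1) fst_conv mem_Sigma_iff)
  have Qcases: "\<exists>x\<in>carrier (W k). \<exists>y\<in>carrier (W (k + 1)). u = \<phi> k (x, y)" if "u \<in> carrier (Q k)" for k u
    using that unfolding \<phi>_surj[symmetric] by auto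

  obtain T b b' where T: "T \<in> X" and b: "b \<in> rmod_hom R (dprod A A) T" "b' \<in> rmod_hom R T (dprod A A)"
    "\<And>x. x \<in> carrier (dprod A A) \<Longrightarrow> b' (b x) = x" "\<And>y. y \<in> carrier T \<Longrightarrow> b (b' y) = y"
    using obtain_X_biproduct[OF ext A A] by metis
  note mT = X_left_module[OF T]
  have zA: "\<zero>\<^bsub>A\<^esub> \<in> carrier A" using mA by (meson abelian_groupE(2) left_module_group)
  have b0: "b (\<zero>\<^bsub>A\<^esub>, \<zero>\<^bsub>A\<^esub>) = \<zero>\<^bsub>T\<^esub>" using hom_zero[OF b(1) dprod_left_module[OF mA mA] mT] by simp
  \<comment> \<open>The sum of the discs on \<open>A\<close> in all degrees: every term is a copy
    \<open>T\<close> of two summands \<open>A\<close>, with differential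
    \<open>(a, a') \<mapsto> (0, a)\<close>.\<close>
  define S where "S = \<lparr>obj = (\<lambda>k::int. T), dif = (\<lambda>k::int. \<lambda>t. b (\<zero>\<^bsub>A\<^esub>, fst (b' t)))\<rparr>"
  define E where "E = \<lparr>obj = Q, dif = D\<rparr>"
  have fb: "(\<lambda>t. fst (b' t)) \<in> rmod_hom R T A" by (rule hom_comp[OF b(2) hom_fst])
  have dS: "(\<lambda>t. b (\<zero>\<^bsub>A\<^esub>, fst (b' t))) \<in> rmod_hom R T T"
    by (intro hom_comp[OF hom_Pair[OF hom_const_zero[OF mA] fb] b(1)])
  have cS: "is_cplx R S"
    by (rule cplxI) (use mT dS hom_closed[OF fb] in \<open>auto simp: S_def b(3) b0 zA\<close>)
  have SX: "S \<in> C_star R U X" using cS T X_in_Mods by (auto simp: C_star_def Cplxs_def S_def)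
  have cE: "is_cplx R E"
  proof (rule cplxI)
    fix k u assume "u \<in> carrier (obj E k)"
    then obtain x y where xy: "x \<in> carrier (W k)" "y \<in> carrier (W (k + 1))" "u = \<phi> k (x, y)"
      using Qcases[of u k] by (auto simp: E_def)
    show "dif E (k - 1) (dif E k u) = \<zero>\<^bsub>obj E (k - 1 - 1)\<^esub>"
      using D\<phi>[OF xy(1,2)] D\<phi>[of "\<zero>\<^bsub>W (k - 1)\<^esub>" "k - 1" x] xy zW z0[of "k - 1 - 1"] by (simp add: E_def)
  qed (auto simp: E_def intro: Q D)
  have \<iota>: "(\<lambda>c. \<phi> k (j k c, \<zero>\<^bsub>W (k + 1)\<^esub>)) \<in> rmod_hom R (obj C k) (Q k)" for k
    by (intro hom_comp[OF hom_Pair[OF j hom_const_zero[OF W]] \<phi>])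
  have \<pi>_hom: "(\<lambda>z. b (q k (fst z), q (k + 1) (snd z))) \<in> rmod_hom R (dprod (W k) (W (k + 1))) T" for k
    by (intro hom_comp[OF hom_Pair[OF hom_comp[OF hom_fst q] hom_comp[OF hom_snd q]] b(1)])
  have "\<exists>\<pi>\<in>rmod_hom R (Q k) T. \<forall>z\<in>carrier (dprod (W k) (W (k + 1))).
      \<pi> (\<phi> k z) = b (q k (fst z), q (k + 1) (snd z))" for k
  proof -
    have ker: "b (q k (fst z), q (k + 1) (snd z)) = \<zero>\<^bsub>T\<^esub>"
      if z: "z \<in> carrier (dprod (W k) (W (k + 1)))" "\<phi> k z = \<zero>\<^bsub>Q k\<^esub>" for z
    proof -
      obtain c where c: "c \<in> carrier (obj C (k + 1))" "fst z = j k (dif C (k + 1) c)"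
        "snd z = \<ominus>\<^bsub>W (k + 1)\<^esub> j (k + 1) c" using \<phi>0[OF z] by blast
      interpret A: left_module R A by fact
      show ?thesis
        using c b0 hom_closed[OF d' c(1)] hom_closed[OF j c(1)]
        by (simp add: ses_zero[OF e] hom_neg[OF q W mA])
    qed
    show ?thesis
      by (rule factor_hom[OF \<phi> \<phi>_surj \<pi>_hom ker dprod_left_module[OF W W] Q mT]) blast+
  qed
  then obtain \<pi> where \<pi>: "\<And>k. \<pi> k \<in> rmod_hom R (Q k) T"
    and \<pi>\<phi>: "\<And>k x y. \<lbrakk>x \<in> carrier (W k); y \<in> carrier (W (k + 1))\<rbrakk> \<Longrightarrow> \<pi> k (\<phi> k (x, y)) = b (q k x, q (k + 1) y)"
    by (metis dprod_simps(1) fst_conv snd_conv mem_Sigma_iff)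
  have eE: "cplx_ses R C (\<lambda>k c. \<phi> k (j k c, \<zero>\<^bsub>W (k + 1)\<^esub>)) E \<pi> S"
    unfolding cplx_ses_def
  proof (intro conjI allI)
    show "(\<lambda>k c. \<phi> k (j k c, \<zero>\<^bsub>W (k + 1)\<^esub>)) \<in> chain_maps R C E"
      unfolding chain_maps_def mem_Collect_eq
    proof (intro allI conjI ballI)
      fix k c assume c: "c \<in> carrier (obj C k)"
      show "dif E k (\<phi> k (j k c, \<zero>\<^bsub>W (k + 1)\<^esub>)) = \<phi> (k - 1) (j (k - 1) (dif C k c), \<zero>\<^bsub>W (k - 1 + 1)\<^esub>)"
        using D\<phi>[OF hom_closed[OF j c] zW] \<phi>_comm[of c "k - 1"] c by (simp add: E_def)
    qed (use \<iota> in \<open>simp add: E_def\<close>)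
    show "\<pi> \<in> chain_maps R E S"
      unfolding chain_maps_def mem_Collect_eq
    proof (intro allI conjI ballI)
      fix k u assume "u \<in> carrier (obj E k)"
      then obtain x y where xy: "x \<in> carrier (W k)" "y \<in> carrier (W (k + 1))" "u = \<phi> k (x, y)"
        using Qcases[of u k] by (auto simp: E_def)
      show "dif S k (\<pi> k u) = \<pi> (k - 1) (dif E k u)"
        using D\<phi>[OF xy(1,2)] \<pi>\<phi>[of "\<zero>\<^bsub>W (k - 1)\<^esub>" "k - 1" x] \<pi>\<phi>[OF xy(1,2)] xy zW
          hom_closed[OF q xy(1)] hom_closed[OF q xy(2)]
        by (simp add: E_def S_def b(3) hom_zero[OF q W mA])
    qed (use \<pi> in \<open>simp add: E_def S_def\<close>)
    fix k
    interpret Wk: left_module R "W k" by (rule W)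
    interpret Wk1: left_module R "W (k + 1)" by (rule W)
    show "ses R (obj C k) (\<lambda>c. \<phi> k (j k c, \<zero>\<^bsub>W (k + 1)\<^esub>)) (obj E k) (\<pi> k) (obj S k)"
      unfolding E_def S_def cplx.simps
    proof (rule sesI[OF \<iota> \<pi> M Q])
      fix c assume c: "c \<in> carrier (obj C k)" "\<phi> k (j k c, \<zero>\<^bsub>W (k + 1)\<^esub>) = \<zero>\<^bsub>Q k\<^esub>"
      then obtain c' where c': "c' \<in> carrier (obj C (k + 1))" "j k c = j k (dif C (k + 1) c')"
        "\<zero>\<^bsub>W (k + 1)\<^esub> = \<ominus>\<^bsub>W (k + 1)\<^esub> j (k + 1) c'"
        using \<phi>0[of "(j k c, \<zero>\<^bsub>W (k + 1)\<^esub>)" k] hom_closed[OF j c(1)] by auto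
      then have "j (k + 1) c' = \<zero>\<^bsub>W (k + 1)\<^esub>"
        using hom_closed[OF j c'(1)] by (metis Wk1.M.minus_minus Wk1.neg_zero)
      then have "c' = \<zero>\<^bsub>obj C (k + 1)\<^esub>" using c'(1) ses_inj[OF e] hom_inj_iff[OF j M W] by blast
      then have "j k c = \<zero>\<^bsub>W k\<^esub>" using c'(2) by (simp add: hom_zero[OF d' M M] hom_zero[OF j M W])
      then show "c = \<zero>\<^bsub>obj C k\<^esub>" using c(1) ses_inj[OF e] hom_inj_iff[OF j M W] by blast
    next
      fix t assume t: "t \<in> carrier T"
      have "fst (b' t) \<in> carrier A" "snd (b' t) \<in> carrier A" using hom_closed[OF b(2) t] by auto
      then obtain x y where "x \<in> carrier (W k)" "q k x = fst (b' t)" "y \<in> carrier (W (k + 1))" "q (k + 1) y = snd (b' t)"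
        using ses_ex[OF e] by metis
      then show "\<exists>u\<in>carrier (Q k). \<pi> k u = t"
        using \<pi>\<phi>[of x k y] b(4)[OF t] hom_closed[OF \<phi>, of "(x, y)" k] by (intro bexI[of _ "\<phi> k (x, y)"]) auto
    next
      fix c assume c: "c \<in> carrier (obj C k)"
      show "\<pi> k (\<phi> k (j k c, \<zero>\<^bsub>W (k + 1)\<^esub>)) = \<zero>\<^bsub>T\<^esub>"
        using c by (simp add: \<pi>\<phi> hom_closed[OF j] ses_zero[OF e] hom_zero[OF q W mA] b0)
    next
      fix u assume u: "u \<in> carrier (Q k)" "\<pi> k u = \<zero>\<^bsub>T\<^esub>"
      then obtain x y where xy: "x \<in> carrier (W k)" "y \<in> carrier (W (k + 1))" "u = \<phi> k (x, y)"
        using Qcases by blast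
      have "b' (\<pi> k u) = (\<zero>\<^bsub>A\<^esub>, \<zero>\<^bsub>A\<^esub>)"
        using u(2) hom_zero[OF b(2) mT dprod_left_module[OF mA mA]] by simp
      then have "q k x = \<zero>\<^bsub>A\<^esub>" "q (k + 1) y = \<zero>\<^bsub>A\<^esub>"
        using xy hom_closed[OF q xy(1)] hom_closed[OF q xy(2)] by (simp_all add: \<pi>\<phi> b(3))
      then obtain c c' where c: "c \<in> carrier (obj C k)" "x = j k c" and c': "c' \<in> carrier (obj C (k + 1))" "y = j (k + 1) c'"
        using ses_ker[OF e] xy(1,2) by metis
      note dc' = hom_closed[OF d' c'(1)]
      have "u = \<phi> k (x, \<zero>\<^bsub>W (k + 1)\<^esub>) \<oplus>\<^bsub>Q k\<^esub> \<phi> k (\<zero>\<^bsub>W k\<^esub>, y)"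
        using hom_add[OF \<phi>, of "(x, \<zero>\<^bsub>W (k + 1)\<^esub>)" k "(\<zero>\<^bsub>W k\<^esub>, y)"] xy by simp
      also have "\<dots> = \<phi> k (j k (c \<oplus>\<^bsub>obj C k\<^esub> dif C (k + 1) c'), \<zero>\<^bsub>W (k + 1)\<^esub>)"
        using \<phi>_comm[OF c'(1)] hom_add[OF \<iota> c(1) dc'] c c' by simp
      finally show "\<exists>a\<in>carrier (obj C k). u = \<phi> k (j k a, \<zero>\<^bsub>W (k + 1)\<^esub>)"
        using c(1) dc' abelian_groupE(1)[OF left_module_group[OF M]] by blast
    qed
  qed
  have "is_singleton (cplx_Ext1 R U S C)" using C SX by (auto simp: C_injective_def)
  then obtain r t where "cplx_splits R C (\<lambda>k c. \<phi> k (j k c, \<zero>\<^bsub>W (k + 1)\<^esub>)) E \<pi> S r t"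
    using cplx_Ext1_splits[OF C_star_cplx[OF SX] cC' _ cE eE] by blast
  then have r: "r n \<in> rmod_hom R (Q n) (obj C n)"
    and r\<iota>: "c \<in> carrier (obj C n) \<Longrightarrow> r n (\<phi> n (j n c, \<zero>\<^bsub>W (n + 1)\<^esub>)) = c" for c
    by (auto simp: cplx_splits_def splits_def E_def)
  \<comment> \<open>The embedding of \<open>C\<close> in degree \<open>n\<close> passes through
    \<open>W n = N\<close>, so a chain retraction restricted to \<open>N\<close> retracts the given
    extension.\<close>
  have "(\<lambda>w. r n (\<phi> n (w, \<zero>\<^bsub>W (n + 1)\<^esub>))) \<in> rmod_hom R N (obj C n)"
    unfolding Wn(1)[symmetric]
    by (intro hom_comp[OF hom_comp[OF hom_Pair[OF hom_id hom_const_zero[OF W]] \<phi>] r])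
  moreover have "\<forall>a\<in>carrier (obj C n). r n (\<phi> n (i a, \<zero>\<^bsub>W (n + 1)\<^esub>)) = a"
    using r\<iota> unfolding Wn(2) by blast
  ultimately show "(\<exists>r\<in>rmod_hom R N (obj C n). \<forall>a\<in>carrier (obj C n). r (i a) = a) \<or>
      (\<exists>s\<in>rmod_hom R A N. \<forall>c\<in>carrier A. p (s c) = c)"
    by (intro disjI1 bexI[of _ "\<lambda>w. r n (\<phi> n (w, \<zero>\<^bsub>W (n + 1)\<^esub>))"])
qed

text \<open>The dual assembly: extensions \<open>0 -> A -> W k -> C k -> 0\<close> are combined into
  a complex whose \<open>k\<close>-th term is the fibre product of \<open>W k\<close> and
  \<open>W (k - 1)\<close> over \<open>C (k - 1)\<close>, with differential
  \<open>(w, w') \<mapsto> (w', 0)\<close>. It maps onto \<open>C\<close>, and the kernel is a sum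
  of discs on \<open>A\<close>. The first component of a chain section splits the extension in
  degree \<open>n\<close>.\<close>

lemma C_projective_left_perp:
  assumes ext: "closed_under_extensions R U X" and C: "C \<in> C_projective R U X"
  shows "obj C n \<in> left_perp R U X"
proof (rule left_perpI)
  note cC' = C_projective_cplx[OF C]
  note cC = Cplxs_cplx[OF cC']
  note d = cplx_dif[OF cC] and M = cplx_obj[OF cC]
  show "obj C n \<in> Mods R U" by (rule Cplxs_Mods[OF cC'])
  fix A N i p assume A: "A \<in> X" and N: "N \<in> Mods R U" and e0: "ses R A i N p (obj C n)"
  note mA = X_left_module[OF A]
  have "\<exists>W j q. W \<in> Mods R U \<and> ses R A j W q (obj C k) \<and> (k = n \<longrightarrow> W = N \<and> j = i \<and> q = p)" for k
  proof (cases "k = n")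
    case True then show ?thesis using N e0 by blast
  next
    case False
    obtain T e e' where T: "T \<in> Mods R U" and e: "e \<in> rmod_hom R (dprod A (obj C k)) T"
      "e' \<in> rmod_hom R T (dprod A (obj C k))"
      "\<And>x. x \<in> carrier (dprod A (obj C k)) \<Longrightarrow> e' (e x) = x" "\<And>y. y \<in> carrier T \<Longrightarrow> e (e' y) = y"
      using obtain_biproduct[OF X_in_Mods[OF A] Cplxs_Mods[OF cC', of k]] by metis
    from ses_transport[OF ses_dprod[OF mA M] mA Mods_left_module[OF T] dprod_left_module[OF mA M] e] T False
    show ?thesis by blast
  qed
  then obtain W j q where W': "\<And>k. W k \<in> Mods R U" and e: "\<And>k. ses R A (j k) (W k) (q k) (obj C k)"
    and Wn: "W n = N" "j n = i" "q n = p" by metis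
  note W = Mods_left_module[OF W']
  note j = ses_hom1[OF e] and q = ses_hom2[OF e]
  note dq = hom_comp[OF q d]
  have zW: "\<zero>\<^bsub>W k\<^esub> \<in> carrier (W k)" for k
    using W by (meson abelian_groupE(2) left_module_group)
  obtain T b b' where T: "T \<in> X" and b: "b \<in> rmod_hom R (dprod A A) T" "b' \<in> rmod_hom R T (dprod A A)"
    "\<And>x. x \<in> carrier (dprod A A) \<Longrightarrow> b' (b x) = x" "\<And>y. y \<in> carrier T \<Longrightarrow> b (b' y) = y"
    using obtain_X_biproduct[OF ext A A] by metis
  note mT = X_left_module[OF T]
  have zA: "\<zero>\<^bsub>A\<^esub> \<in> carrier A" using mA by (meson abelian_groupE(2) left_module_group)
  have b0: "b (\<zero>\<^bsub>A\<^esub>, \<zero>\<^bsub>A\<^esub>) = \<zero>\<^bsub>T\<^esub>" using hom_zero[OF b(1) dprod_left_module[OF mA mA] mT] by simp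
  have fb: "(\<lambda>t. fst (b' t)) \<in> rmod_hom R T A" "(\<lambda>t. snd (b' t)) \<in> rmod_hom R T A"
    by (rule hom_comp[OF b(2) hom_fst] hom_comp[OF b(2) hom_snd])+
  define S where "S = \<lparr>obj = (\<lambda>k::int. T), dif = (\<lambda>k::int. \<lambda>t. b (snd (b' t), \<zero>\<^bsub>A\<^esub>))\<rparr>"
  define Q where "Q k = fibre_product (W k) (\<lambda>w. dif C k (q k w)) (W (k - 1)) (q (k - 1))" for k
  define E where "E = \<lparr>obj = Q, dif = (\<lambda>k z. (snd z, \<zero>\<^bsub>W (k - 1 - 1)\<^esub>))\<rparr>"
  have Q: "left_module R (Q k)" for k
    unfolding Q_def by (rule fibre_product_left_module[OF W W M dq q])
  have dS: "(\<lambda>t. b (snd (b' t), \<zero>\<^bsub>A\<^esub>)) \<in> rmod_hom R T T"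
    by (intro hom_comp[OF hom_Pair[OF fb(2) hom_const_zero[OF mA]] b(1)])
  have cS: "is_cplx R S"
    by (rule cplxI) (use mT dS hom_closed[OF fb(1)] hom_closed[OF fb(2)] in \<open>auto simp: S_def b(3) b0 zA\<close>)
  have SX: "S \<in> C_star R U X" using cS T X_in_Mods by (auto simp: C_star_def Cplxs_def S_def)
  have cE: "is_cplx R E"
  proof (rule cplxI)
    fix k
    have "(\<lambda>z. (snd z, \<zero>\<^bsub>W (k - 1 - 1)\<^esub>)) \<in> rmod_hom R (Q k) (Q (k - 1))"
      unfolding Q_def
    proof (rule fibre_product_hom_Pair[OF fibre_product_snd hom_const_zero[OF W]])
      fix z assume "z \<in> carrier (fibre_product (W k) (\<lambda>w. dif C k (q k w)) (W (k - 1)) (q (k - 1)))"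
      then have z: "fst z \<in> carrier (W k)" "dif C k (q k (fst z)) = q (k - 1) (snd z)" by auto
      show "dif C (k - 1) (q (k - 1) (snd z)) = q (k - 1 - 1) \<zero>\<^bsub>W (k - 1 - 1)\<^esub>"
        unfolding z(2)[symmetric] hom_zero[OF q W M] by (rule cplx_dif_dif[OF cC hom_closed[OF q z(1)]])
    qed
    then show "dif E k \<in> rmod_hom R (obj E k) (obj E (k - 1))" by (simp add: E_def)
  qed (auto simp: E_def Q_def intro: Q[unfolded Q_def])
  have "(\<lambda>t. (j k (fst (b' t)), j (k - 1) (snd (b' t)))) \<in> rmod_hom R T (Q k)" for k
    unfolding Q_def
  proof (rule fibre_product_hom_Pair[OF hom_comp[OF fb(1) j] hom_comp[OF fb(2) j]])
    fix t assume "t \<in> carrier T"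
    then show "dif C k (q k (j k (fst (b' t)))) = q (k - 1) (j (k - 1) (snd (b' t)))"
      using hom_closed[OF fb(1)] hom_closed[OF fb(2)] by (simp add: ses_zero[OF e] hom_zero[OF d M M])
  qed
  note \<iota> = this
  have \<pi>: "(\<lambda>z. q k (fst z)) \<in> rmod_hom R (Q k) (obj C k)" for k
    unfolding Q_def by (rule hom_comp[OF fibre_product_fst q])
  have eE: "cplx_ses R S (\<lambda>k t. (j k (fst (b' t)), j (k - 1) (snd (b' t)))) E (\<lambda>k z. q k (fst z)) C"
    unfolding cplx_ses_def
  proof (intro conjI allI)
    show "(\<lambda>k t. (j k (fst (b' t)), j (k - 1) (snd (b' t)))) \<in> chain_maps R S E"
      using \<iota> hom_closed[OF fb(2)] zA b(3)
      by (auto simp: chain_maps_def S_def E_def hom_zero[OF j mA W])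
    show "(\<lambda>k z. q k (fst z)) \<in> chain_maps R E C"
      using \<pi> by (auto simp: chain_maps_def E_def Q_def)
    fix k
    show "ses R (obj S k) (\<lambda>t. (j k (fst (b' t)), j (k - 1) (snd (b' t)))) (obj E k) (\<lambda>z. q k (fst z)) (obj C k)"
      unfolding E_def S_def cplx.simps
    proof (rule sesI[OF \<iota> \<pi> mT Q])
      fix t assume t: "t \<in> carrier T" "(j k (fst (b' t)), j (k - 1) (snd (b' t))) = \<zero>\<^bsub>Q k\<^esub>"
      then have "fst (b' t) = \<zero>\<^bsub>A\<^esub>" "snd (b' t) = \<zero>\<^bsub>A\<^esub>"
        using ses_inj[OF e] hom_inj_iff[OF j mA W] hom_closed[OF fb(1)] hom_closed[OF fb(2)]
        by (auto simp: Q_def)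
      then show "t = \<zero>\<^bsub>T\<^esub>" using b(4)[OF t(1)] b0 by (metis prod.collapse)
    next
      fix c assume c: "c \<in> carrier (obj C k)"
      obtain x y where "x \<in> carrier (W k)" "q k x = c" "y \<in> carrier (W (k - 1))" "q (k - 1) y = dif C k c"
        using ses_ex[OF e c] ses_ex[OF e hom_closed[OF d c]] by metis
      then show "\<exists>z\<in>carrier (Q k). q k (fst z) = c"
        by (intro bexI[of _ "(x, y)"]) (auto simp: Q_def)
    next
      fix t assume "t \<in> carrier T"
      then show "q k (fst (j k (fst (b' t)), j (k - 1) (snd (b' t)))) = \<zero>\<^bsub>obj C k\<^esub>"
        using hom_closed[OF fb(1)] by (simp add: ses_zero[OF e])
    next
      fix z assume z: "z \<in> carrier (Q k)" "q k (fst z) = \<zero>\<^bsub>obj C k\<^esub>"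
      then have "fst z \<in> carrier (W k)" "snd z \<in> carrier (W (k - 1))" "q (k - 1) (snd z) = \<zero>\<^bsub>obj C (k - 1)\<^esub>"
        using hom_zero[OF d M M, of k] by (auto simp: Q_def)
      then obtain a a' where "a \<in> carrier A" "fst z = j k a" "a' \<in> carrier A" "snd z = j (k - 1) a'"
        using z(2) ses_ker[OF e] by metis
      then show "\<exists>t\<in>carrier T. z = (j k (fst (b' t)), j (k - 1) (snd (b' t)))"
        using b(3) hom_closed[OF b(1)] by (intro bexI[of _ "b (a, a')"]) (auto simp: prod_eq_iff)
    qed
  qed
  have "is_singleton (cplx_Ext1 R U C S)" using C SX by (auto simp: C_projective_def)
  then obtain r t where "cplx_splits R S (\<lambda>k t. (j k (fst (b' t)), j (k - 1) (snd (b' t)))) E (\<lambda>k z. q k (fst z)) C r t"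
    using cplx_Ext1_splits[OF cC' C_star_cplx[OF SX] _ cE eE] by blast
  then have t: "t n \<in> rmod_hom R (obj C n) (Q n)"
    and qt: "\<forall>c\<in>carrier (obj C n). q n (fst (t n c)) = c"
    by (auto simp: cplx_splits_def splits_def E_def)
  have "(\<lambda>c. fst (t n c)) \<in> rmod_hom R (obj C n) N"
    unfolding Wn(1)[symmetric] by (rule hom_comp[OF t[unfolded Q_def] fibre_product_fst])
  then show "(\<exists>r\<in>rmod_hom R N A. \<forall>a\<in>carrier A. r (i a) = a) \<or>
      (\<exists>s\<in>rmod_hom R (obj C n) N. \<forall>c\<in>carrier (obj C n). p (s c) = c)"
    using qt unfolding Wn(3) by (intro disjI2 bexI[of _ "\<lambda>c. fst (t n c)"])
qed

end

section \<open>Preenvelopes and precovers\<close>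

lemma (in module_universe) obtain_kernel:
  assumes F: "F \<in> Mods R U" and mM: "left_module R M"
    and \<phi>: "\<phi> \<in> rmod_hom R F M" "\<phi> ` carrier F = carrier M"
  obtains K where "K \<in> Mods R U" "ses R K (\<lambda>x. x) F \<phi> M"
proof -
  note mF = Mods_left_module[OF F]
  interpret M: left_module R M by fact
  interpret F: left_module R F by fact
  define K where "K = F\<lparr>carrier := {x \<in> carrier F. \<phi> x = \<zero>\<^bsub>M\<^esub>}\<rparr>"
  have mK: "left_module R K" unfolding K_def
    by (rule submodule_left_module[OF mF])
      (auto simp: hom_zero[OF \<phi>(1) mF mM] hom_add[OF \<phi>(1)] hom_smult[OF \<phi>(1)] F.smult_closed M.smult_zero_right)
  have "carrier K \<subseteq> carrier F" by (auto simp: K_def)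
  then have K: "K \<in> Mods R U"
    using F U_lepoll[OF _ subset_imp_lepoll] mK by (auto simp: Mods_def)
  have KF: "ses R K (\<lambda>x. x) F \<phi> M"
  proof (rule sesI[OF _ \<phi>(1) mK mF])
    show "(\<lambda>x. x) \<in> rmod_hom R K F" by (rule homI) (auto simp: K_def)
    show "\<exists>b\<in>carrier F. \<phi> b = c" if "c \<in> carrier M" for c using that \<phi>(2) by (metis imageE)
  qed (auto simp: K_def)
  show thesis by (rule that[OF K KF])
qed

context module_class
begin

text \<open>By \<open>cycles_retract\<close> the cycle modules are retracts of the terms, and
  orthogonal classes are closed under retracts.\<close>

lemma contractible_eps_injective:
  assumes C: "C \<in> Cplxs R U" and s: "contraction R C s" and perp: "\<And>n. obj C n \<in> right_perp R U X"
  shows "C \<in> eps_injective R U X"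
proof -
  note cC = Cplxs_cplx[OF C]
  have "cycles C n \<in> right_perp R U X" for n
  proof (rule right_perp_retract[OF perp _ cycles_retract[OF s cC]])
    have "carrier (cycles C n) \<subseteq> carrier (obj C n)" by (auto simp: cycles_def)
    then show "cycles C n \<in> Mods R U"
      using Cplxs_Mods[OF C, of n] U_lepoll[OF _ subset_imp_lepoll] cycles_left_module[OF cC]
      by (auto simp: Mods_def)
  qed
  then show ?thesis using C contraction_exact[OF s cC] by (simp add: eps_injective_def)
qed

lemma contractible_eps_projective:
  assumes C: "C \<in> Cplxs R U" and s: "contraction R C s" and perp: "\<And>n. obj C n \<in> left_perp R U X"
  shows "C \<in> eps_projective R U X"
proof -
  note cC = Cplxs_cplx[OF C]
  have "cycles C n \<in> left_perp R U X" for n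
  proof (rule left_perp_retract[OF perp _ cycles_retract[OF s cC]])
    have "carrier (cycles C n) \<subseteq> carrier (obj C n)" by (auto simp: cycles_def)
    then show "cycles C n \<in> Mods R U"
      using Cplxs_Mods[OF C, of n] U_lepoll[OF _ subset_imp_lepoll] cycles_left_module[OF cC]
      by (auto simp: Mods_def)
  qed
  then show ?thesis using C contraction_exact[OF s cC] by (simp add: eps_projective_def)
qed

text \<open>A chain map \<open>g\<close> from \<open>Y\<close> into an \<open>X\<close>-injective
  complex \<open>J\<close> extends over each \<open>E n\<close> separately, because the cokernel
  \<open>L n\<close> is in \<open>X\<close> and the terms of \<open>J\<close> are
  \<open>X\<close>-injective. These extensions need not commute with differentials; a contraction of
  \<open>J\<close> converts them into a chain map on the contractible complex.\<close>

lemma C_injective_preenvelope: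
  assumes ext: "closed_under_extensions R U X" and sub: "right_perp R U X \<subseteq> X"
    and env: "\<And>M. M \<in> Mods R U \<Longrightarrow> \<exists>E\<in>right_perp R U X. \<exists>L\<in>X. \<exists>f p. ses R M f E p L"
    and Y: "Y \<in> Cplxs R U"
  shows "\<exists>I f. is_preenvelope R (C_injective R U X) Y f I \<and> monic_map Y f \<and> exact_cplx I \<and>
    I \<in> eps_injective R U X"
proof -
  note cY = Cplxs_cplx[OF Y]
  note dY = cplx_dif[OF cY] and MY = cplx_obj[OF cY]
  have "\<exists>E L f p. E \<in> right_perp R U X \<and> L \<in> X \<and> ses R (obj Y n) f E p L" for n
    using env[OF Cplxs_Mods[OF Y, of n]] by blast
  then obtain E L f p where E: "\<And>n. E n \<in> right_perp R U X" and L: "\<And>n. L n \<in> X"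
    and ses: "\<And>n. ses R (obj Y n) (f n) (E n) (p n) (L n)" by metis
  note f = ses_hom1[OF ses] and ME = right_perp_left_module[OF E]
  have zE: "\<zero>\<^bsub>E n\<^esub> \<in> carrier (E n)" for n using ME by (meson abelian_groupE(2) left_module_group)
  define D where "D = \<lparr>obj = (\<lambda>n. dprod (E n) (E (n - 1))), dif = (\<lambda>n z. (snd z, \<zero>\<^bsub>E (n - 1 - 1)\<^esub>))\<rparr>"
  have cD: "is_cplx R D"
    by (rule cplxI) (auto simp: D_def intro!: dprod_left_module ME hom_Pair hom_snd hom_const_zero)
  have "small U (carrier (obj D n))" for n
    using small_times[OF Mods_small[OF right_perp_Mods[OF E]] Mods_small[OF right_perp_Mods[OF E]]]
    by (simp add: D_def)
  then obtain I e e' where I: "I \<in> Cplxs R U" and e: "e \<in> chain_maps R D I" "e' \<in> chain_maps R I D"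
    "\<And>n x. x \<in> carrier (obj D n) \<Longrightarrow> e' n (e n x) = x" "\<And>n y. y \<in> carrier (obj I n) \<Longrightarrow> e n (e' n y) = y"
    using obtain_Cplxs_iso[OF cD] by metis
  note cI = Cplxs_cplx[OF I]
  have eh: "e n \<in> rmod_hom R (dprod (E n) (E (n - 1))) (obj I n)"
    and e'h: "e' n \<in> rmod_hom R (obj I n) (dprod (E n) (E (n - 1)))" for n
    using chain_hom[OF e(1), of n] chain_hom[OF e(2), of n] by (auto simp: D_def)
  have perp: "obj I n \<in> right_perp R U X" for n
    by (rule perp_biproduct(1)[OF Cplxs_Mods[OF I] eh e'h])
      (use e(3,4) E in \<open>auto simp: D_def\<close>)
  \<comment> \<open>Up to the isomorphism \<open>e\<close> this is
    \<open>(a, b) \<mapsto> (0, a)\<close>, which undoes the differential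
    \<open>(a, b) \<mapsto> (b, 0)\<close>.\<close>
  have "contraction R I (\<lambda>n x. e (n + 1) (\<zero>\<^bsub>E (n + 1)\<^esub>, fst (e' n x)))"
    unfolding contraction_def
  proof (intro allI conjI ballI)
    fix n
    have in2: "(\<lambda>a. e (n + 1) (\<zero>\<^bsub>E (n + 1)\<^esub>, a)) \<in> rmod_hom R (E n) (obj I (n + 1))"
      using hom_comp[OF hom_Pair[OF hom_const_zero[OF ME] hom_id] eh, of "n + 1"] by simp
    show "(\<lambda>x. e (n + 1) (\<zero>\<^bsub>E (n + 1)\<^esub>, fst (e' n x))) \<in> rmod_hom R (obj I n) (obj I (n + 1))"
      by (rule hom_comp[OF hom_comp[OF e'h hom_fst] in2])
    fix x assume x: "x \<in> carrier (obj I n)"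
    interpret A: left_module R "E n" by (rule ME)
    interpret B: left_module R "E (n - 1)" by (rule ME)
    have ab: "fst (e' n x) \<in> carrier (E n)" "snd (e' n x) \<in> carrier (E (n - 1))"
      using hom_closed[OF e'h x] by auto
    have 1: "dif I (n + 1) (e (n + 1) (\<zero>\<^bsub>E (n + 1)\<^esub>, fst (e' n x))) = e n (fst (e' n x), \<zero>\<^bsub>E (n - 1)\<^esub>)"
      using chain_comm[OF e(1), of "(\<zero>\<^bsub>E (n + 1)\<^esub>, fst (e' n x))" "n + 1"] ab zE by (simp add: D_def)
    have 2: "fst (e' (n - 1) (dif I n x)) = snd (e' n x)"
      using chain_comm[OF e(2) x] by (simp add: D_def prod_eq_iff)
    have "e n (fst (e' n x), \<zero>\<^bsub>E (n - 1)\<^esub>) \<oplus>\<^bsub>obj I n\<^esub> e n (\<zero>\<^bsub>E n\<^esub>, snd (e' n x)) = e n (e' n x)"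
      using hom_add[OF eh, of "(fst (e' n x), \<zero>\<^bsub>E (n - 1)\<^esub>)" n "(\<zero>\<^bsub>E n\<^esub>, snd (e' n x))"] ab by simp
    then show "dif I (n + 1) (e (n + 1) (\<zero>\<^bsub>E (n + 1)\<^esub>, fst (e' n x))) \<oplus>\<^bsub>obj I n\<^esub>
        e (n - 1 + 1) (\<zero>\<^bsub>E (n - 1 + 1)\<^esub>, fst (e' (n - 1) (dif I n x))) = x"
      using 1 2 e(4)[OF x] by simp
  qed
  note s = this
  \<comment> \<open>The second component \<open>f (d y)\<close> makes this a chain map; the first
    one makes it monic.\<close>
  define F where "F = (\<lambda>n y. e n (f n y, f (n - 1) (dif Y n y)))"
  have fy: "(f n y, f (n - 1) (dif Y n y)) \<in> carrier (obj D n)" if "y \<in> carrier (obj Y n)" for n y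
    using that by (auto simp: D_def hom_closed[OF f] hom_closed[OF dY])
  have F: "F \<in> chain_maps R Y I"
    unfolding chain_maps_def mem_Collect_eq
  proof (intro allI conjI ballI)
    fix n
    show "F n \<in> rmod_hom R (obj Y n) (obj I n)"
      unfolding F_def by (intro hom_comp[OF hom_Pair[OF f hom_comp[OF dY f]] eh])
    fix y assume y: "y \<in> carrier (obj Y n)"
    show "dif I n (F n y) = F (n - 1) (dif Y n y)"
      using chain_comm[OF e(1) fy[OF y]] cplx_dif_dif[OF cY y] hom_zero[OF f[of "n - 1 - 1"] MY ME]
      by (simp add: F_def D_def)
  qed
  have "monic_map Y F"
    unfolding monic_map_def
  proof (intro allI inj_onI)
    fix n x y assume xy: "x \<in> carrier (obj Y n)" "y \<in> carrier (obj Y n)" "F n x = F n y"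
    then have "(f n x, f (n - 1) (dif Y n x)) = (f n y, f (n - 1) (dif Y n y))"
      unfolding F_def using e(3)[OF fy] by metis
    then show "x = y" using xy ses_inj[OF ses] by (auto dest: inj_onD)
  qed
  moreover have "is_preenvelope R (C_injective R U X) Y F I"
    unfolding is_preenvelope_def
  proof (intro conjI ballI F)
    show "I \<in> C_injective R U X" by (rule contractible_C_injective[OF I s perp])
    fix J g assume J: "J \<in> C_injective R U X" and g: "g \<in> chain_maps R Y J"
    note cJ = Cplxs_cplx[OF C_injective_cplx[OF J]]
    note J_perp = C_injective_right_perp[OF ext J]
    obtain t where t: "contraction R J t" using C_injective_contraction[OF J] J_perp sub by blast
    note th = contraction_hom[OF t] and th' = contraction_hom_pred[OF t]
    note dJ = cplx_dif[OF cJ] and dJ' = cplx_dif_Suc[OF cJ] and MJ = cplx_obj[OF cJ]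
    have "\<exists>q\<in>rmod_hom R (E n) (obj J n). \<forall>y\<in>carrier (obj Y n). q (f n y) = g n y" for n
      using right_perp_extend[OF J_perp L ses chain_hom[OF g] MY ME, of n] by metis
    then obtain q where q: "\<And>n. q n \<in> rmod_hom R (E n) (obj J n)"
      and qf: "\<And>n y. y \<in> carrier (obj Y n) \<Longrightarrow> q n (f n y) = g n y" by metis
    \<comment> \<open>On \<open>(f y, f (d y))\<close> this is
      \<open>d t (g y) + t (g (d y))\<close>. As \<open>g\<close> commutes with \<open>d\<close>,
      that is the contraction equation of \<open>J\<close> at \<open>g y\<close>.\<close>
    define k where "k = (\<lambda>n z. dif J (n + 1) (t n (q n (fst z))) \<oplus>\<^bsub>obj J n\<^esub> t (n - 1) (q (n - 1) (snd z)))"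
    have kh: "k n \<in> rmod_hom R (dprod (E n) (E (n - 1))) (obj J n)" for n
      unfolding k_def
      by (intro hom_plus MJ hom_comp[OF hom_comp[OF hom_comp[OF hom_fst q] th] dJ']
          hom_comp[OF hom_comp[OF hom_snd q] th'])
    have k: "k \<in> chain_maps R D J"
      unfolding chain_maps_def mem_Collect_eq
    proof (intro allI conjI ballI)
      fix n
      show "k n \<in> rmod_hom R (obj D n) (obj J n)" using kh by (simp add: D_def)
      fix z assume "z \<in> carrier (obj D n)"
      then have z: "fst z \<in> carrier (E n)" "snd z \<in> carrier (E (n - 1))" by (auto simp: D_def)
      interpret A: left_module R "obj J (n - 1)" by (rule MJ)
      note c1 = hom_closed[OF th hom_closed[OF q z(1)]] and c2 = hom_closed[OF th' hom_closed[OF q z(2)]]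
      show "dif J n (k n z) = k (n - 1) (dif D n z)"
        using z c1 c2 hom_zero[OF q[of "n - 1 - 1"] ME MJ] hom_zero[OF th'[of "n - 1"] MJ MJ]
        by (simp add: k_def D_def hom_add[OF dJ] hom_closed[OF dJ'] hom_closed[OF dJ] cplx_dif_dif_Suc[OF cJ])
    qed
    show "\<exists>h\<in>chain_maps R I J. \<forall>n. \<forall>x\<in>carrier (obj Y n). h n (F n x) = g n x"
    proof (intro bexI[OF _ chain_comp[OF e(2) k]] allI ballI)
      fix n y assume y: "y \<in> carrier (obj Y n)"
      show "k n (e' n (F n y)) = g n y"
        using y contraction_eq[OF t hom_closed[OF chain_hom[OF g] y]]
        by (simp add: F_def e(3)[OF fy] k_def qf hom_closed[OF dY] chain_comm[OF g])
    qed
  qed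
  ultimately show ?thesis
    using contractible_eps_injective[OF I s perp] contraction_exact[OF s cI] by blast
qed

text \<open>Dually, a chain map \<open>g : J -> Y\<close> lifts in each degree to
  \<open>q n : J n -> E n\<close>, because the kernel of \<open>f n\<close> is in \<open>X\<close>,
  and a contraction of the source \<open>J\<close> turns these lifts into a chain map.\<close>

lemma C_projective_precover:
  assumes ext: "closed_under_extensions R U X" and sub: "left_perp R U X \<subseteq> X"
    and cov: "\<And>M. M \<in> Mods R U \<Longrightarrow> \<exists>P\<in>left_perp R U X. \<exists>K\<in>X. \<exists>i p. ses R K i P p M"
    and Y: "Y \<in> Cplxs R U"
  shows "\<exists>P f. is_precover R (C_projective R U X) P f Y \<and> epic_map P f Y \<and> exact_cplx P \<and>
    P \<in> eps_projective R U X"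
proof -
  note cY = Cplxs_cplx[OF Y]
  note dY = cplx_dif[OF cY] and dY' = cplx_dif_Suc[OF cY] and MY = cplx_obj[OF cY]
  have "\<exists>E K f p. E \<in> left_perp R U X \<and> K \<in> X \<and> ses R K p E f (obj Y n)" for n
    using cov[OF Cplxs_Mods[OF Y, of n]] by blast
  then obtain E K f p where E: "\<And>n. E n \<in> left_perp R U X" and K: "\<And>n. K n \<in> X"
    and ses: "\<And>n. ses R (K n) (p n) (E n) (f n) (obj Y n)" by metis
  note f = ses_hom2[OF ses] and ME = left_perp_left_module[OF E]
  have zE: "\<zero>\<^bsub>E n\<^esub> \<in> carrier (E n)" for n using ME by (meson abelian_groupE(2) left_module_group)
  define D where "D = \<lparr>obj = (\<lambda>n. dprod (E n) (E (n + 1))), dif = (\<lambda>n z. (\<zero>\<^bsub>E (n - 1)\<^esub>, fst z))\<rparr>"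
  have cD: "is_cplx R D"
    by (rule cplxI) (auto simp: D_def intro!: dprod_left_module ME hom_Pair hom_fst hom_const_zero)
  have "small U (carrier (obj D n))" for n
    using small_times[OF Mods_small[OF left_perp_Mods[OF E]] Mods_small[OF left_perp_Mods[OF E]]]
    by (simp add: D_def)
  then obtain I e e' where I: "I \<in> Cplxs R U" and e: "e \<in> chain_maps R D I" "e' \<in> chain_maps R I D"
    "\<And>n x. x \<in> carrier (obj D n) \<Longrightarrow> e' n (e n x) = x" "\<And>n y. y \<in> carrier (obj I n) \<Longrightarrow> e n (e' n y) = y"
    using obtain_Cplxs_iso[OF cD] by metis
  note cI = Cplxs_cplx[OF I]
  have eh: "e n \<in> rmod_hom R (dprod (E n) (E (n + 1))) (obj I n)"
    and e'h: "e' n \<in> rmod_hom R (obj I n) (dprod (E n) (E (n + 1)))" for n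
    using chain_hom[OF e(1), of n] chain_hom[OF e(2), of n] by (auto simp: D_def)
  have perp: "obj I n \<in> left_perp R U X" for n
    by (rule perp_biproduct(2)[OF Cplxs_Mods[OF I] eh e'h])
      (use e(3,4) E in \<open>auto simp: D_def\<close>)
  have "contraction R I (\<lambda>n x. e (n + 1) (snd (e' n x), \<zero>\<^bsub>E (n + 1 + 1)\<^esub>))"
    unfolding contraction_def
  proof (intro allI conjI ballI)
    fix n
    have in1: "(\<lambda>a. e (n + 1) (a, \<zero>\<^bsub>E (n + 1 + 1)\<^esub>)) \<in> rmod_hom R (E (n + 1)) (obj I (n + 1))"
      by (rule hom_comp[OF hom_Pair[OF hom_id hom_const_zero[OF ME]] eh])
    show "(\<lambda>x. e (n + 1) (snd (e' n x), \<zero>\<^bsub>E (n + 1 + 1)\<^esub>)) \<in> rmod_hom R (obj I n) (obj I (n + 1))"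
      by (rule hom_comp[OF hom_comp[OF e'h hom_snd] in1])
    fix x assume x: "x \<in> carrier (obj I n)"
    interpret A: left_module R "E n" by (rule ME)
    interpret B: left_module R "E (n + 1)" by (rule ME)
    have ab: "fst (e' n x) \<in> carrier (E n)" "snd (e' n x) \<in> carrier (E (n + 1))"
      using hom_closed[OF e'h x] by auto
    have 1: "dif I (n + 1) (e (n + 1) (snd (e' n x), \<zero>\<^bsub>E (n + 1 + 1)\<^esub>)) = e n (\<zero>\<^bsub>E n\<^esub>, snd (e' n x))"
      using chain_comm[OF e(1), of "(snd (e' n x), \<zero>\<^bsub>E (n + 1 + 1)\<^esub>)" "n + 1"] ab zE by (simp add: D_def)
    have 2: "snd (e' (n - 1) (dif I n x)) = fst (e' n x)"
      using chain_comm[OF e(2) x] by (simp add: D_def prod_eq_iff)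
    have "e n (\<zero>\<^bsub>E n\<^esub>, snd (e' n x)) \<oplus>\<^bsub>obj I n\<^esub> e n (fst (e' n x), \<zero>\<^bsub>E (n + 1)\<^esub>) = e n (e' n x)"
      using hom_add[OF eh, of "(\<zero>\<^bsub>E n\<^esub>, snd (e' n x))" n "(fst (e' n x), \<zero>\<^bsub>E (n + 1)\<^esub>)"] ab by simp
    then show "dif I (n + 1) (e (n + 1) (snd (e' n x), \<zero>\<^bsub>E (n + 1 + 1)\<^esub>)) \<oplus>\<^bsub>obj I n\<^esub>
        e (n - 1 + 1) (snd (e' (n - 1) (dif I n x)), \<zero>\<^bsub>E (n - 1 + 1 + 1)\<^esub>) = x"
      using 1 2 e(4)[OF x] by simp
  qed
  note s = this
  \<comment> \<open>The second summand makes \<open>G\<close> compatible with the differential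
    \<open>(a, b) \<mapsto> (0, a)\<close>; the first one makes it epic.\<close>
  define G where "G = (\<lambda>n z. f n (fst z) \<oplus>\<^bsub>obj Y n\<^esub> dif Y (n + 1) (f (n + 1) (snd z)))"
  have G: "G \<in> chain_maps R D Y"
    unfolding chain_maps_def mem_Collect_eq
  proof (intro allI conjI ballI)
    fix n
    have "G n \<in> rmod_hom R (dprod (E n) (E (n + 1))) (obj Y n)"
      unfolding G_def by (intro hom_plus MY hom_comp[OF hom_fst f] hom_comp[OF hom_comp[OF hom_snd f] dY'])
    then show "G n \<in> rmod_hom R (obj D n) (obj Y n)" by (simp add: D_def)
    fix z assume "z \<in> carrier (obj D n)"
    then have z: "fst z \<in> carrier (E n)" "snd z \<in> carrier (E (n + 1))" by (auto simp: D_def)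
    interpret A: left_module R "obj Y (n - 1)" by (rule MY)
    show "dif Y n (G n z) = G (n - 1) (dif D n z)"
      using z by (simp add: G_def D_def hom_add[OF dY] hom_closed[OF f] hom_closed[OF dY'] hom_closed[OF dY]
          cplx_dif_dif_Suc[OF cY] hom_zero[OF f ME MY])
  qed
  define F where "F = (\<lambda>n x. G n (e' n x))"
  have F: "F \<in> chain_maps R I Y" unfolding F_def by (rule chain_comp[OF e(2) G])
  have "epic_map I F Y"
    unfolding epic_map_def
  proof (intro allI equalityI subsetI)
    fix n y assume y: "y \<in> carrier (obj Y n)"
    interpret A: left_module R "obj Y n" by (rule MY)
    obtain x where x: "x \<in> carrier (E n)" "f n x = y" using ses_ex[OF ses y] by blast
    have D: "(x, \<zero>\<^bsub>E (n + 1)\<^esub>) \<in> carrier (obj D n)" using x zE by (simp add: D_def)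
    have "F n (e n (x, \<zero>\<^bsub>E (n + 1)\<^esub>)) = y"
      using x y by (simp add: F_def e(3)[OF D] G_def hom_zero[OF f ME MY] hom_zero[OF dY' MY MY])
    then show "y \<in> F n ` carrier (obj I n)" using hom_closed[OF chain_hom[OF e(1)] D] by blast
  qed (use hom_closed[OF chain_hom[OF F]] in blast)
  moreover have "is_precover R (C_projective R U X) I F Y"
    unfolding is_precover_def
  proof (intro conjI ballI F)
    show "I \<in> C_projective R U X" by (rule contractible_C_projective[OF I s perp])
    fix J g assume J: "J \<in> C_projective R U X" and g: "g \<in> chain_maps R J Y"
    note cJ = Cplxs_cplx[OF C_projective_cplx[OF J]]
    note J_perp = C_projective_left_perp[OF ext J]
    obtain t where t: "contraction R J t" using C_projective_contraction[OF J] J_perp sub by blast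
    note th = contraction_hom[OF t] and th' = contraction_hom_pred[OF t]
    note dJ = cplx_dif[OF cJ] and dJ' = cplx_dif_Suc[OF cJ] and MJ = cplx_obj[OF cJ]
    have "\<exists>q\<in>rmod_hom R (obj J n) (E n). \<forall>y\<in>carrier (obj J n). f n (q y) = g n y" for n
      using left_perp_lift[OF J_perp K ses chain_hom[OF g] MY ME, of n] by metis
    then obtain q where q: "\<And>n. q n \<in> rmod_hom R (obj J n) (E n)"
      and fq: "\<And>n y. y \<in> carrier (obj J n) \<Longrightarrow> f n (q n y) = g n y" by metis
    \<comment> \<open>Composed with \<open>G\<close> this gives
      \<open>g (t (d c)) + d (g (t c))\<close>, which is \<open>g\<close> applied to the two terms
      of the contraction equation for \<open>c\<close>.\<close>
    define k where "k = (\<lambda>n c. (q n (t (n - 1) (dif J n c)), q (n + 1) (t n c)))"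
    have k: "k \<in> chain_maps R J D"
      unfolding chain_maps_def mem_Collect_eq
    proof (intro allI conjI ballI)
      fix n
      have "k n \<in> rmod_hom R (obj J n) (dprod (E n) (E (n + 1)))"
        unfolding k_def by (intro hom_Pair hom_comp[OF hom_comp[OF dJ th'] q] hom_comp[OF th q])
      then show "k n \<in> rmod_hom R (obj J n) (obj D n)" by (simp add: D_def)
      fix c assume c: "c \<in> carrier (obj J n)"
      show "dif D n (k n c) = k (n - 1) (dif J n c)"
        using cplx_dif_dif[OF cJ c] hom_zero[OF q[of "n - 1"] MJ ME] hom_zero[OF th'[of "n - 1"] MJ MJ]
        by (simp add: k_def D_def)
    qed
    show "\<exists>h\<in>chain_maps R J I. \<forall>n. \<forall>x\<in>carrier (obj J n). F n (h n x) = g n x"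
    proof (intro bexI[OF _ chain_comp[OF k e(1)]] allI ballI)
      fix n c assume c: "c \<in> carrier (obj J n)"
      interpret A: left_module R "obj Y n" by (rule MY)
      let ?u = "t (n - 1) (dif J n c)" and ?v = "dif J (n + 1) (t n c)"
      have cl: "?u \<in> carrier (obj J n)" "t n c \<in> carrier (obj J (n + 1))" "?v \<in> carrier (obj J n)"
        using hom_closed[OF th' hom_closed[OF dJ c]] hom_closed[OF th c] hom_closed[OF dJ' hom_closed[OF th c]]
        by simp_all
      have "F n (e n (k n c)) = g n ?u \<oplus>\<^bsub>obj Y n\<^esub> dif Y (n + 1) (g (n + 1) (t n c))"
        using cl by (simp add: F_def e(3)[OF hom_closed[OF chain_hom[OF k] c]] G_def)
          (simp add: k_def fq cl)
      also have "dif Y (n + 1) (g (n + 1) (t n c)) = g n ?v"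
        using chain_comm[OF g cl(2)] by simp
      also have "g n ?u \<oplus>\<^bsub>obj Y n\<^esub> g n ?v = g n (?v \<oplus>\<^bsub>obj J n\<^esub> ?u)"
        using cl hom_closed[OF chain_hom[OF g]] by (simp add: hom_add[OF chain_hom[OF g]] A.a_comm)
      also have "\<dots> = g n c" using contraction_eq[OF t c] by simp
      finally show "F n (e n (k n c)) = g n c" .
    qed
  qed
  ultimately show ?thesis
    using contractible_eps_projective[OF I s perp] contraction_exact[OF s cI] by blast
qed

text \<open>Salce's argument. Let \<open>Q\<close> be the quotient of \<open>J\<close> by
  \<open>M\<close>, take a special precover \<open>A -> Q\<close> with kernel \<open>K\<close>, and
  let \<open>B\<close> be the fibre product of \<open>A\<close> and \<open>J\<close> over
  \<open>Q\<close>. Then \<open>B\<close> is an extension of \<open>J\<close> by \<open>K\<close>,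
  hence \<open>X\<close>-injective, and also an extension of \<open>A\<close> by \<open>M\<close>,
  which is the sequence sought.\<close>

lemma special_right_perp_preenvelope:
  assumes pre: "special_precovering R U X" and M: "M \<in> Mods R U"
    and J: "J \<in> right_perp R U X" and i: "i \<in> rmod_hom R M J" "inj_on i (carrier M)"
  shows "\<exists>E\<in>right_perp R U X. \<exists>L\<in>X. \<exists>f p. ses R M f E p L"
proof -
  note mM = Mods_left_module[OF M] and mJ = right_perp_left_module[OF J]
  interpret M: left_module R M by fact
  interpret J: left_module R J by fact
  obtain Q0 :: "('r, 'm set) module" and \<pi>0 where Q0: "left_module R Q0" and \<pi>0: "\<pi>0 \<in> rmod_hom R J Q0"
    "\<pi>0 ` carrier J = carrier Q0" "\<And>x. x \<in> carrier J \<Longrightarrow> \<pi>0 x = \<zero>\<^bsub>Q0\<^esub> \<longleftrightarrow> x \<in> i ` carrier M"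
  proof (rule quotient_module[OF mJ, of "i ` carrier M"])
    show "i ` carrier M \<subseteq> carrier J" using hom_closed[OF i(1)] by blast
    show "\<zero>\<^bsub>J\<^esub> \<in> i ` carrier M" using hom_zero[OF i(1) mM mJ] by (metis M.zero_closed imageI)
  qed (auto simp: hom_add[OF i(1), symmetric] hom_smult[OF i(1), symmetric] M.smult_closed)
  \<comment> \<open>As an image of \<open>carrier J\<close> the quotient is small, so it has a copy
    in the universe to which special precovering applies.\<close>
  have "carrier Q0 \<lesssim> carrier J" unfolding \<pi>0(2)[symmetric] by (rule image_lepoll)
  then have "small U (carrier Q0)" using small_lepoll Mods_small[OF right_perp_Mods[OF J]] by blast
  then obtain Q e e' where Q: "Q \<in> Mods R U" and e: "e \<in> rmod_hom R Q0 Q" "e' \<in> rmod_hom R Q Q0"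
    "\<And>x. x \<in> carrier Q0 \<Longrightarrow> e' (e x) = x" "\<And>y. y \<in> carrier Q \<Longrightarrow> e (e' y) = y"
    using obtain_Mods_iso[OF Q0] by metis
  note mQ = Mods_left_module[OF Q]
  define \<pi> where "\<pi> x = e (\<pi>0 x)" for x
  have \<pi>: "\<pi> \<in> rmod_hom R J Q" unfolding \<pi>_def by (rule hom_comp[OF \<pi>0(1) e(1)])
  have \<pi>_surj: "\<exists>x\<in>carrier J. \<pi> x = c" if c: "c \<in> carrier Q" for c
    using e(4)[OF c] hom_closed[OF e(2) c] unfolding \<pi>_def \<pi>0(2)[symmetric] by (metis imageE)
  have \<pi>_ker: "\<exists>m\<in>carrier M. x = i m" if x: "x \<in> carrier J" "\<pi> x = \<zero>\<^bsub>Q\<^esub>" for x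
  proof -
    have "\<pi>0 x = \<zero>\<^bsub>Q0\<^esub>"
      using e(3)[OF hom_closed[OF \<pi>0(1) x(1)]] x(2) hom_zero[OF e(2) mQ Q0] unfolding \<pi>_def by simp
    then show ?thesis using \<pi>0(3)[OF x(1)] by blast
  qed
  have \<pi>_i: "\<pi> (i m) = \<zero>\<^bsub>Q\<^esub>" if "m \<in> carrier M" for m
    using \<pi>0(3)[of "i m"] hom_closed[OF i(1) that] that by (simp add: \<pi>_def hom_zero[OF e(1) Q0 mQ])
  obtain K A k \<alpha> where K: "K \<in> right_perp R U X" and A: "A \<in> X" and kA: "ses R K k A \<alpha> Q"
    using pre Q unfolding special_precovering_def short_exact_eq_ses by blast
  note mA = X_left_module[OF A] and mK = right_perp_left_module[OF K] and \<alpha> = ses_hom2[OF kA]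
  interpret A: left_module R A by fact
  let ?B = "fibre_product A \<alpha> J \<pi>"
  note mB = fibre_product_left_module[OF mA mJ mQ \<alpha> \<pi>]
  note KB = fibre_product_ses[OF kA mK mA mJ mQ \<pi>]
  have MB: "ses R M (\<lambda>m. (\<zero>\<^bsub>A\<^esub>, i m)) ?B fst A"
  proof (rule sesI[OF _ fibre_product_fst mM mB])
    show "(\<lambda>m. (\<zero>\<^bsub>A\<^esub>, i m)) \<in> rmod_hom R M ?B"
      by (rule fibre_product_hom_Pair[OF hom_const_zero[OF mA] i(1)])
        (simp add: hom_zero[OF \<alpha> mA mQ] \<pi>_i)
    show "a = \<zero>\<^bsub>M\<^esub>" if "a \<in> carrier M" "(\<zero>\<^bsub>A\<^esub>, i a) = \<zero>\<^bsub>?B\<^esub>" for a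
      using that i(2) hom_inj_iff[OF i(1) mM mJ] by simp
    show "\<exists>b\<in>carrier ?B. fst b = c" if c: "c \<in> carrier A" for c
    proof -
      obtain x where "x \<in> carrier J" "\<pi> x = \<alpha> c" using \<pi>_surj[OF hom_closed[OF \<alpha> c]] by blast
      then show ?thesis using c by (intro bexI[of _ "(c, x)"]) auto
    qed
    show "\<exists>a\<in>carrier M. b = (\<zero>\<^bsub>A\<^esub>, i a)" if b: "b \<in> carrier ?B" "fst b = \<zero>\<^bsub>A\<^esub>" for b
      using b \<pi>_ker[of "snd b"] by (auto simp: hom_zero[OF \<alpha> mA mQ] prod_eq_iff)
  qed simp
  obtain W h h' where W: "W \<in> Mods R U" and h: "h \<in> rmod_hom R ?B W" "h' \<in> rmod_hom R W ?B"
    "\<And>x. x \<in> carrier ?B \<Longrightarrow> h' (h x) = x" "\<And>y. y \<in> carrier W \<Longrightarrow> h (h' y) = y"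
    using obtain_Mods_iso[OF mB ses_small[OF MB mB mA Mods_small[OF M] Mods_small[OF X_in_Mods[OF A]]]]
    by metis
  note mW = Mods_left_module[OF W]
  have "W \<in> right_perp R U X"
    by (rule right_perp_extension[OF K J W ses_transport[OF KB mK mW mB h]])
  then show ?thesis using ses_transport[OF MB mM mW mB h] A by blast
qed

text \<open>The dual of Salce's argument: embed the kernel \<open>K\<close> of \<open>\<phi>\<close>
  in \<open>A\<close> from \<open>X\<close> with \<open>X\<close>-projective cokernel
  \<open>L\<close>, and push out along \<open>K -> F\<close>. The pushout is an extension of
  \<open>L\<close> by \<open>F\<close>, hence \<open>X\<close>-projective, and an extension of
  \<open>M\<close> by \<open>A\<close>.\<close>

lemma special_left_perp_precover:
  assumes pre: "special_preenveloping R U X" and M: "M \<in> Mods R U"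
    and F: "F \<in> left_perp R U X" and \<phi>: "\<phi> \<in> rmod_hom R F M" "\<phi> ` carrier F = carrier M"
  shows "\<exists>P\<in>left_perp R U X. \<exists>K\<in>X. \<exists>i p. ses R K i P p M"
proof -
  note mM = Mods_left_module[OF M] and mF = left_perp_left_module[OF F]
  obtain K where K: "K \<in> Mods R U" and KF: "ses R K (\<lambda>x. x) F \<phi> M"
    by (rule obtain_kernel[OF left_perp_Mods[OF F] mM \<phi>])
  note mK = Mods_left_module[OF K]
  obtain A L g p where A: "A \<in> X" and L: "L \<in> left_perp R U X" and KA: "ses R K g A p L"
    using pre K unfolding special_preenveloping_def short_exact_eq_ses by blast
  note mA = X_left_module[OF A] and mL = left_perp_left_module[OF L]
  note f = ses_hom1[OF KF] and g = ses_hom1[OF KA]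
  obtain Q q where po: "pushout R K (\<lambda>x. x) F g A q (Q :: ('r, ('m \<times> 'm) set) module)"
    by (rule obtain_pushout[OF mK mF mA f g])
  have mQ: "left_module R Q" using po by (simp add: pushout_def)
  obtain a where AQ: "ses R A (\<lambda>y. q (\<zero>\<^bsub>F\<^esub>, y)) Q a M"
    using pushout_ses[OF KF mK mF mA mM g po] by blast
  obtain b where "ses R F (\<lambda>y. (\<lambda>(y, x). q (x, y)) (\<zero>\<^bsub>A\<^esub>, y)) Q b L"
    using pushout_ses[OF KA mK mA mF mL f pushout_swap[OF mK mF mA f g po]] by blast
  then have FQ: "ses R F (\<lambda>y. q (y, \<zero>\<^bsub>A\<^esub>)) Q b L" by simp
  obtain W h h' where W: "W \<in> Mods R U" and h: "h \<in> rmod_hom R Q W" "h' \<in> rmod_hom R W Q"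
    "\<And>x. x \<in> carrier Q \<Longrightarrow> h' (h x) = x" "\<And>y. y \<in> carrier W \<Longrightarrow> h (h' y) = y"
    using obtain_Mods_iso[OF mQ ses_small[OF AQ mQ mM Mods_small[OF X_in_Mods[OF A]] Mods_small[OF M]]]
    by metis
  note mW = Mods_left_module[OF W]
  have "W \<in> left_perp R U X"
    by (rule left_perp_extension[OF F L W ses_transport[OF FQ mF mW mQ h]])
  then show ?thesis using ses_transport[OF AQ mA mW mQ h] A by blast
qed

end

section \<open>Direct sums and projective modules\<close>

lemma direct_sum_simps [simp]:
  "carrier (direct_sum I F) = {x \<in> (\<Pi>\<^sub>E i\<in>I. carrier (F i)). finite {i\<in>I. x i \<noteq> \<zero>\<^bsub>F i\<^esub>}}"
  "\<zero>\<^bsub>direct_sum I F\<^esub> = (\<lambda>i\<in>I. \<zero>\<^bsub>F i\<^esub>)"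
  "x \<oplus>\<^bsub>direct_sum I F\<^esub> y = (\<lambda>i\<in>I. x i \<oplus>\<^bsub>F i\<^esub> y i)"
  "r \<odot>\<^bsub>direct_sum I F\<^esub> x = (\<lambda>i\<in>I. r \<odot>\<^bsub>F i\<^esub> x i)"
  by (simp_all add: direct_sum_def)

definition single :: "'i set \<Rightarrow> ('i \<Rightarrow> ('r, 'm) module) \<Rightarrow> 'i \<Rightarrow> 'm \<Rightarrow> 'i \<Rightarrow> 'm" where
  "single I F i x = (\<lambda>j\<in>I. if j = i then x else \<zero>\<^bsub>F j\<^esub>)"

definition supp :: "'i set \<Rightarrow> ('i \<Rightarrow> ('r, 'm) module) \<Rightarrow> ('i \<Rightarrow> 'm) \<Rightarrow> 'i set" where
  "supp I F x = {i\<in>I. x i \<noteq> \<zero>\<^bsub>F i\<^esub>}"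

locale module_family =
  fixes R :: "('r, 'k) ring_scheme" and I :: "'i set" and F :: "'i \<Rightarrow> ('r, 'm) module"
  assumes ring: "ring R" and F: "i \<in> I \<Longrightarrow> left_module R (F i)"
begin

lemma F_group: "i \<in> I \<Longrightarrow> abelian_group (F i)"
  using F left_module_group by blast

lemma F_simps [simp]:
  assumes i: "i \<in> I"
  shows "\<zero>\<^bsub>F i\<^esub> \<in> carrier (F i)"
    "\<lbrakk>x \<in> carrier (F i); y \<in> carrier (F i)\<rbrakk> \<Longrightarrow> x \<oplus>\<^bsub>F i\<^esub> y \<in> carrier (F i)"
    "x \<in> carrier (F i) \<Longrightarrow> x \<oplus>\<^bsub>F i\<^esub> \<zero>\<^bsub>F i\<^esub> = x"
    "x \<in> carrier (F i) \<Longrightarrow> \<zero>\<^bsub>F i\<^esub> \<oplus>\<^bsub>F i\<^esub> x = x"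
    "r \<in> carrier R \<Longrightarrow> r \<odot>\<^bsub>F i\<^esub> \<zero>\<^bsub>F i\<^esub> = \<zero>\<^bsub>F i\<^esub>"
    "\<lbrakk>r \<in> carrier R; x \<in> carrier (F i)\<rbrakk> \<Longrightarrow> r \<odot>\<^bsub>F i\<^esub> x \<in> carrier (F i)"
    "x \<in> carrier (F i) \<Longrightarrow> \<ominus>\<^bsub>F i\<^esub> x \<in> carrier (F i)"
    "x \<in> carrier (F i) \<Longrightarrow> \<ominus>\<^bsub>F i\<^esub> x \<oplus>\<^bsub>F i\<^esub> x = \<zero>\<^bsub>F i\<^esub>"
    "\<ominus>\<^bsub>F i\<^esub> \<zero>\<^bsub>F i\<^esub> = \<zero>\<^bsub>F i\<^esub>"
proof -
  interpret left_module R "F i" by (rule F[OF i])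
  show "\<zero>\<^bsub>F i\<^esub> \<in> carrier (F i)"
    "\<lbrakk>x \<in> carrier (F i); y \<in> carrier (F i)\<rbrakk> \<Longrightarrow> x \<oplus>\<^bsub>F i\<^esub> y \<in> carrier (F i)"
    "x \<in> carrier (F i) \<Longrightarrow> x \<oplus>\<^bsub>F i\<^esub> \<zero>\<^bsub>F i\<^esub> = x"
    "x \<in> carrier (F i) \<Longrightarrow> \<zero>\<^bsub>F i\<^esub> \<oplus>\<^bsub>F i\<^esub> x = x"
    "r \<in> carrier R \<Longrightarrow> r \<odot>\<^bsub>F i\<^esub> \<zero>\<^bsub>F i\<^esub> = \<zero>\<^bsub>F i\<^esub>"
    "\<lbrakk>r \<in> carrier R; x \<in> carrier (F i)\<rbrakk> \<Longrightarrow> r \<odot>\<^bsub>F i\<^esub> x \<in> carrier (F i)"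
    "x \<in> carrier (F i) \<Longrightarrow> \<ominus>\<^bsub>F i\<^esub> x \<in> carrier (F i)"
    "x \<in> carrier (F i) \<Longrightarrow> \<ominus>\<^bsub>F i\<^esub> x \<oplus>\<^bsub>F i\<^esub> x = \<zero>\<^bsub>F i\<^esub>"
    "\<ominus>\<^bsub>F i\<^esub> \<zero>\<^bsub>F i\<^esub> = \<zero>\<^bsub>F i\<^esub>"
    by (auto simp: M.l_neg smult_zero_right smult_closed)
qed

lemma dsumD: "x \<in> carrier (direct_sum I F) \<Longrightarrow> i \<in> I \<Longrightarrow> x i \<in> carrier (F i)"
  and dsum_finite: "x \<in> carrier (direct_sum I F) \<Longrightarrow> finite (supp I F x)"
  by (auto simp: supp_def)

lemma dsumI:
  assumes "\<And>i. i \<in> I \<Longrightarrow> x i \<in> carrier (F i)" "finite S" "\<And>i. \<lbrakk>i \<in> I; i \<notin> S\<rbrakk> \<Longrightarrow> x i = \<zero>\<^bsub>F i\<^esub>"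
  shows "(\<lambda>i\<in>I. x i) \<in> carrier (direct_sum I F)"
  using assms by (auto intro: finite_subset[of _ S])

lemma dsum_eqI:
  assumes "x \<in> carrier (direct_sum I F)" "y \<in> carrier (direct_sum I F)" "\<And>i. i \<in> I \<Longrightarrow> x i = y i"
  shows "x = y"
  using assms by (auto intro: PiE_ext)

lemma direct_sum_left_module: "left_module R (direct_sum I F)"
proof -
  let ?D = "direct_sum I F"
  have add: "x \<oplus>\<^bsub>?D\<^esub> y \<in> carrier ?D" if "x \<in> carrier ?D" "y \<in> carrier ?D" for x y
    unfolding direct_sum_simps(3)
    by (rule dsumI[of _ "supp I F x \<union> supp I F y"])
      (use dsumD[OF that(1)] dsumD[OF that(2)] dsum_finite[OF that(1)] dsum_finite[OF that(2)] in \<open>auto simp: supp_def\<close>)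
  have smult: "r \<odot>\<^bsub>?D\<^esub> x \<in> carrier ?D" if "r \<in> carrier R" "x \<in> carrier ?D" for r x
    unfolding direct_sum_simps(4)
    by (rule dsumI[of _ "supp I F x"])
      (use that(1) dsumD[OF that(2)] dsum_finite[OF that(2)] in \<open>auto simp: supp_def\<close>)
  have neg: "(\<lambda>i\<in>I. \<ominus>\<^bsub>F i\<^esub> x i) \<in> carrier ?D" if "x \<in> carrier ?D" for x
    by (rule dsumI[of _ "supp I F x"])
      (use dsumD[OF that] dsum_finite[OF that] in \<open>auto simp: supp_def\<close>)
  have zero: "\<zero>\<^bsub>?D\<^esub> \<in> carrier ?D"
    unfolding direct_sum_simps(2) by (rule dsumI[of _ "{}"]) auto
  show ?thesis
  proof (rule left_moduleI[OF ring])
    show "abelian_group ?D"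
    proof (rule abelian_groupI)
      fix x y z assume x: "x \<in> carrier ?D" and y: "y \<in> carrier ?D" and z: "z \<in> carrier ?D"
      show "x \<oplus>\<^bsub>?D\<^esub> y \<oplus>\<^bsub>?D\<^esub> z = x \<oplus>\<^bsub>?D\<^esub> (y \<oplus>\<^bsub>?D\<^esub> z)"
        using dsumD[OF x] dsumD[OF y] dsumD[OF z] F_group
        by (auto intro!: restrict_ext abelian_groupE(3))
      show "x \<oplus>\<^bsub>?D\<^esub> y = y \<oplus>\<^bsub>?D\<^esub> x"
        using dsumD[OF x] dsumD[OF y] F_group by (auto intro!: restrict_ext abelian_groupE(4))
      show "\<zero>\<^bsub>?D\<^esub> \<oplus>\<^bsub>?D\<^esub> x = x"
        by (rule dsum_eqI) (use add[OF zero x] x dsumD[OF x] in auto)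
      show "\<exists>y\<in>carrier ?D. y \<oplus>\<^bsub>?D\<^esub> x = \<zero>\<^bsub>?D\<^esub>"
        using neg[OF x] dsumD[OF x] by (intro bexI[of _ "\<lambda>i\<in>I. \<ominus>\<^bsub>F i\<^esub> x i"]) (auto intro!: restrict_ext)
    qed (use add zero in auto)
  next
    fix x assume x: "x \<in> carrier ?D"
    show "\<one>\<^bsub>R\<^esub> \<odot>\<^bsub>?D\<^esub> x = x"
      by (rule dsum_eqI) (use smult[OF ring.ring_simprules(6)[OF ring] x] x dsumD[OF x] left_module.smult_one[OF F] in auto)
  qed (use smult dsumD left_module.smult_l_distr[OF F] left_module.smult_r_distr[OF F]
      left_module.smult_assoc[OF F] in \<open>auto intro!: restrict_ext simp: PiE_mem\<close>)
qed

lemma single_apply: "j \<in> I \<Longrightarrow> single I F i x j = (if j = i then x else \<zero>\<^bsub>F j\<^esub>)"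
  by (simp add: single_def)

lemma single_hom: assumes i: "i \<in> I" shows "single I F i \<in> rmod_hom R (F i) (direct_sum I F)"
proof (rule homI)
  show cl: "single I F i x \<in> carrier (direct_sum I F)" if "x \<in> carrier (F i)" for x
    unfolding single_def by (rule dsumI[of _ "{i}"]) (use i that in auto)
qed (use i in \<open>auto simp: single_def fun_eq_iff restrict_def\<close>)

text \<open>Induction on a finite set containing the support; removing an index \<open>i\<close>
  splits off the summand \<open>single I F i (x i)\<close>.\<close>

lemma dsum_induct:
  assumes x: "x \<in> carrier (direct_sum I F)" and 0: "P \<zero>\<^bsub>direct_sum I F\<^esub>"
    and single: "\<And>i a. \<lbrakk>i \<in> I; a \<in> carrier (F i)\<rbrakk> \<Longrightarrow> P (single I F i a)"
    and add: "\<And>x y. \<lbrakk>x \<in> carrier (direct_sum I F); y \<in> carrier (direct_sum I F); P x; P y\<rbrakk>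
      \<Longrightarrow> P (x \<oplus>\<^bsub>direct_sum I F\<^esub> y)"
  shows "P x"
proof -
  let ?D = "direct_sum I F"
  have "P x" if "finite S" "S \<subseteq> I" "x \<in> carrier ?D" "\<And>i. \<lbrakk>i \<in> I; i \<notin> S\<rbrakk> \<Longrightarrow> x i = \<zero>\<^bsub>F i\<^esub>" for S x
    using that
  proof (induction S arbitrary: x rule: finite_induct)
    case empty
    have "x = \<zero>\<^bsub>?D\<^esub>"
      by (rule dsum_eqI[OF empty(2)]) (use empty(3) abelian_groupE(2)[OF left_module_group[OF direct_sum_left_module]] in auto)
    then show ?case using 0 by (simp only:)
  next
    case (insert i S)
    define y where "y = (\<lambda>j\<in>I. if j = i then \<zero>\<^bsub>F j\<^esub> else x j)"
    have i: "i \<in> I" and xi: "x i \<in> carrier (F i)" using insert.prems dsumD[OF insert.prems(2)] by auto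
    have y: "y \<in> carrier ?D"
      unfolding y_def by (rule dsumI[of _ S])
        (use insert.prems(3) insert.hyps(1) dsumD[OF insert.prems(2)] in auto)
    have s: "single I F i (x i) \<in> carrier ?D" by (rule hom_closed[OF single_hom[OF i] xi])
    have "x = y \<oplus>\<^bsub>?D\<^esub> single I F i (x i)"
      by (rule dsum_eqI[OF insert.prems(2) abelian_groupE(1)[OF left_module_group[OF direct_sum_left_module] y s]])
        (use dsumD[OF insert.prems(2)] i xi in \<open>auto simp: y_def single_apply\<close>)
    moreover have "P y" by (rule insert.IH) (use insert.prems y in \<open>auto simp: y_def\<close>)
    ultimately show ?case using add[OF y s] single[OF i xi] by simp
  qed
  from this[OF dsum_finite[OF x] _ x] show ?thesis by (auto simp: supp_def)
qed

lemma dsum_hom_ext: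
  assumes "h \<in> rmod_hom R (direct_sum I F) N" "h' \<in> rmod_hom R (direct_sum I F) N" "left_module R N"
    and eq: "\<And>i a. \<lbrakk>i \<in> I; a \<in> carrier (F i)\<rbrakk> \<Longrightarrow> h (single I F i a) = h' (single I F i a)"
    and x: "x \<in> carrier (direct_sum I F)"
  shows "h x = h' x"
proof (rule dsum_induct[OF x])
  show "h \<zero>\<^bsub>direct_sum I F\<^esub> = h' \<zero>\<^bsub>direct_sum I F\<^esub>"
    by (simp only: hom_zero[OF assms(1) direct_sum_left_module assms(3)]
        hom_zero[OF assms(2) direct_sum_left_module assms(3)])
next
  fix x y
  assume "x \<in> carrier (direct_sum I F)" "y \<in> carrier (direct_sum I F)" "h x = h' x" "h y = h' y"
  then show "h (x \<oplus>\<^bsub>direct_sum I F\<^esub> y) = h' (x \<oplus>\<^bsub>direct_sum I F\<^esub> y)"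
    by (simp only: hom_add[OF assms(1)] hom_add[OF assms(2)])
qed (rule eq)

lemma obtain_dsum_hom:
  assumes N: "left_module R N" and g: "\<And>i. i \<in> I \<Longrightarrow> g i \<in> rmod_hom R (F i) N"
  obtains h where "h \<in> rmod_hom R (direct_sum I F) N"
    "\<And>i a. \<lbrakk>i \<in> I; a \<in> carrier (F i)\<rbrakk> \<Longrightarrow> h (single I F i a) = g i a"
proof -
  interpret N: left_module R N by fact
  let ?D = "direct_sum I F"
  define h where "h x = finsum N (\<lambda>i. g i (x i)) (supp I F x)" for x
  have gc: "g i (x i) \<in> carrier N" if "x \<in> carrier ?D" "i \<in> I" for x i
    using hom_closed[OF g[OF that(2)]] dsumD[OF that] by blast
  have g0: "g i \<zero>\<^bsub>F i\<^esub> = \<zero>\<^bsub>N\<^esub>" if "i \<in> I" for i using hom_zero[OF g[OF that] F[OF that] N] .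
  \<comment> \<open>The sum may run over any finite set containing the support. Additivity relies on
    this, because the supports of \<open>x\<close>, \<open>y\<close> and their sum differ.\<close>
  have h_eq: "h x = finsum N (\<lambda>i. g i (x i)) S"
    if "x \<in> carrier ?D" "finite S" "supp I F x \<subseteq> S" "S \<subseteq> I" for x S
    unfolding h_def
    by (rule N.add.finprod_mono_neutral_cong_left) (use that gc g0 in \<open>auto simp: supp_def Pi_iff subset_iff\<close>)
  note D = direct_sum_left_module
  interpret D: left_module R ?D by (rule D)
  have "h \<in> rmod_hom R ?D N"
  proof (rule homI)
    fix x assume x: "x \<in> carrier ?D"
    show "h x \<in> carrier N" unfolding h_def using gc[OF x] by (intro N.finsum_closed) (auto simp: supp_def)
    fix y assume y: "y \<in> carrier ?D"
    let ?S = "supp I F x \<union> supp I F y"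
    have S: "finite ?S" "?S \<subseteq> I" using dsum_finite[OF x] dsum_finite[OF y] by (auto simp: supp_def)
    have "supp I F (x \<oplus>\<^bsub>?D\<^esub> y) \<subseteq> ?S" by (auto simp: supp_def)
    then have "h (x \<oplus>\<^bsub>?D\<^esub> y) = finsum N (\<lambda>i. g i ((x \<oplus>\<^bsub>?D\<^esub> y) i)) ?S"
      by (intro h_eq S D.M.a_closed x y)
    also have "\<dots> = finsum N (\<lambda>i. g i (x i) \<oplus>\<^bsub>N\<^esub> g i (y i)) ?S"
      by (rule N.finsum_cong')
        (use S(2) gc[OF x] gc[OF y] hom_add[OF g dsumD[OF x] dsumD[OF y]] in \<open>auto simp: subset_iff\<close>)
    also have "\<dots> = finsum N (\<lambda>i. g i (x i)) ?S \<oplus>\<^bsub>N\<^esub> finsum N (\<lambda>i. g i (y i)) ?S"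
      by (rule N.finsum_addf) (use S(2) gc[OF x] gc[OF y] in auto)
    also have "\<dots> = h x \<oplus>\<^bsub>N\<^esub> h y" using h_eq[OF x S(1)] h_eq[OF y S(1)] S(2) by simp
    finally show "h (x \<oplus>\<^bsub>?D\<^esub> y) = h x \<oplus>\<^bsub>N\<^esub> h y" .
  next
    fix r x assume r: "r \<in> carrier R" and x: "x \<in> carrier ?D"
    have S: "finite (supp I F x)" "supp I F x \<subseteq> I" using dsum_finite[OF x] by (auto simp: supp_def)
    have "supp I F (r \<odot>\<^bsub>?D\<^esub> x) \<subseteq> supp I F x" using r by (auto simp: supp_def)
    then have "h (r \<odot>\<^bsub>?D\<^esub> x) = finsum N (\<lambda>i. g i ((r \<odot>\<^bsub>?D\<^esub> x) i)) (supp I F x)"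
      by (intro h_eq S D.smult_closed r x)
    also have "\<dots> = finsum N (\<lambda>i. r \<odot>\<^bsub>N\<^esub> g i (x i)) (supp I F x)"
      by (rule N.finsum_cong')
        (use S(2) r gc[OF x] hom_smult[OF g r dsumD[OF x]] in \<open>auto simp: N.smult_closed subset_iff\<close>)
    \<comment> \<open>Scalars are pulled out of the sum by induction over its finite index set, for
      which the set gets its own name \<open>S'\<close>.\<close>
    also have "\<dots> = r \<odot>\<^bsub>N\<^esub> finsum N (\<lambda>i. g i (x i)) S'" if "finite S'" "S' \<subseteq> supp I F x" "S' = supp I F x" for S'
      unfolding that(3)[symmetric] using that(1,2)
    proof (induction S' rule: finite_induct)
      case empty then show ?case by (simp add: N.smult_zero_right r)
    next
      case (insert i T)
      then have c: "g i (x i) \<in> carrier N" "(\<lambda>i. g i (x i)) \<in> T \<rightarrow> carrier N" using S(2) gc[OF x] by auto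
      then have "(\<lambda>i. r \<odot>\<^bsub>N\<^esub> g i (x i)) \<in> T \<rightarrow> carrier N" using N.smult_closed r by auto
      then show ?case using insert c by (simp add: N.smult_r_distr r N.smult_closed)
    qed
    finally show "h (r \<odot>\<^bsub>?D\<^esub> x) = r \<odot>\<^bsub>N\<^esub> h x" unfolding h_def using S(1) by blast
  qed
  moreover have "h (single I F i a) = g i a" if i: "i \<in> I" and a: "a \<in> carrier (F i)" for i a
  proof -
    have "h (single I F i a) = finsum N (\<lambda>j. g j (single I F i a j)) {i}"
      by (rule h_eq[OF hom_closed[OF single_hom[OF i] a]]) (use i in \<open>auto simp: supp_def single_def split: if_splits\<close>)
    then show ?thesis using i hom_closed[OF g[OF i] a] by (simp add: single_apply)
  qed
  ultimately show thesis by (rule that)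
qed

end

section \<open>Free modules and enough projectives\<close>

definition regular_module :: "('r, 'k) ring_scheme \<Rightarrow> ('r, 'r) module" where
  "regular_module R = \<lparr>carrier = carrier R, monoid.mult = undefined, one = undefined,
     zero = \<zero>\<^bsub>R\<^esub>, add = (\<oplus>\<^bsub>R\<^esub>), smult = (\<otimes>\<^bsub>R\<^esub>)\<rparr>"

lemma regular_module_simps [simp]:
  "carrier (regular_module R) = carrier R" "\<zero>\<^bsub>regular_module R\<^esub> = \<zero>\<^bsub>R\<^esub>"
  "x \<oplus>\<^bsub>regular_module R\<^esub> y = x \<oplus>\<^bsub>R\<^esub> y" "r \<odot>\<^bsub>regular_module R\<^esub> x = r \<otimes>\<^bsub>R\<^esub> x"
  by (simp_all add: regular_module_def)

lemma regular_left_module: assumes "ring R" shows "left_module R (regular_module R)"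
proof -
  interpret ring R by fact
  show ?thesis
  proof (rule left_moduleI[OF assms])
    show "abelian_group (regular_module R)"
    proof (rule abelian_groupI)
      fix x assume "x \<in> carrier (regular_module R)"
      then show "\<exists>y\<in>carrier (regular_module R). y \<oplus>\<^bsub>regular_module R\<^esub> x = \<zero>\<^bsub>regular_module R\<^esub>"
        by (intro bexI[of _ "\<ominus>\<^bsub>R\<^esub> x"]) (auto simp: l_neg)
    qed (auto simp: a_ac)
  qed (auto simp: l_distr r_distr m_assoc)
qed

lemma regular_module_hom:
  assumes N: "left_module R N" and n: "n \<in> carrier N"
  shows "(\<lambda>r. r \<odot>\<^bsub>N\<^esub> n) \<in> rmod_hom R (regular_module R) N"
  using N n
  by (intro homI) (auto simp: left_module.smult_closed left_module.smult_l_distr left_module.smult_assoc)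

lemma obtain_free_hom:
  assumes N: "left_module R N" and g: "\<And>s. s \<in> S \<Longrightarrow> g s \<in> carrier N"
  obtains h where "h \<in> rmod_hom R (direct_sum S (\<lambda>_. regular_module R)) N"
    "\<And>s r. \<lbrakk>s \<in> S; r \<in> carrier R\<rbrakk> \<Longrightarrow> h (single S (\<lambda>_. regular_module R) s r) = r \<odot>\<^bsub>N\<^esub> g s"
proof -
  note ring = left_module_ring[OF N]
  interpret module_family R S "\<lambda>_. regular_module R"
    by (rule module_family.intro) (use ring regular_left_module in auto)
  show thesis
    using obtain_dsum_hom[OF N, of "\<lambda>s r. r \<odot>\<^bsub>N\<^esub> g s"] regular_module_hom[OF N g] that
    by (metis (no_types, lifting) regular_module_simps(1))
qed

context module_class
begin

text \<open>The free module on the carrier of \<open>M\<close> maps onto \<open>M\<close>, each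
  basis element going to the element that indexes it. Every extension of a free module splits by
  lifting the basis elements, so it is orthogonal to any class \<open>X\<close>.\<close>

lemma enough_projectives:
  assumes M: "M \<in> Mods R U"
  shows "\<exists>F\<in>left_perp R U X. \<exists>\<phi>\<in>rmod_hom R F M. \<phi> ` carrier F = carrier M"
proof -
  let ?S = "carrier M" and ?G = "\<lambda>_::'m. regular_module R"
  let ?D = "direct_sum ?S ?G"
  interpret module_family R ?S ?G
    by (rule module_family.intro) (use ring regular_left_module in auto)
  interpret R: ring R by (rule ring)
  note D = direct_sum_left_module and mM = Mods_left_module[OF M]
  have "small U (carrier ?D)"
    unfolding direct_sum_simps by (rule small_finsupp[OF Mods_small[OF M] small_R]) simp
  then obtain F e e' where F: "F \<in> Mods R U" and e: "e \<in> rmod_hom R ?D F" "e' \<in> rmod_hom R F ?D"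
    "\<And>x. x \<in> carrier ?D \<Longrightarrow> e' (e x) = x" "\<And>y. y \<in> carrier F \<Longrightarrow> e (e' y) = y"
    using obtain_Mods_iso[OF D] by metis
  note mF = Mods_left_module[OF F]
  have "F \<in> left_perp R U X"
  proof (rule left_perpI[OF F])
    fix B N i p assume N: "N \<in> Mods R U" and s: "ses R B i N p F"
    note mN = Mods_left_module[OF N] and p = ses_hom2[OF s]
    have sc: "single ?S ?G m r \<in> carrier ?D" if "m \<in> ?S" "r \<in> carrier R" for m r
      using hom_closed[OF single_hom[OF that(1)]] that(2) by simp
    have "\<exists>n. m \<in> ?S \<longrightarrow> n \<in> carrier N \<and> p n = e (single ?S ?G m \<one>\<^bsub>R\<^esub>)" for m
      using ses_ex[OF s hom_closed[OF e(1) sc]] by blast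
    then obtain g where g: "\<And>m. m \<in> ?S \<Longrightarrow> g m \<in> carrier N"
      and pg: "\<And>m. m \<in> ?S \<Longrightarrow> p (g m) = e (single ?S ?G m \<one>\<^bsub>R\<^esub>)" by metis
    obtain h where h: "h \<in> rmod_hom R ?D N"
      and h_single: "\<And>m r. \<lbrakk>m \<in> ?S; r \<in> carrier R\<rbrakk> \<Longrightarrow> h (single ?S ?G m r) = r \<odot>\<^bsub>N\<^esub> g m"
      by (rule obtain_free_hom[OF mN g]) (assumption, rule that)
    have "p (h x) = e x" if "x \<in> carrier ?D" for x
    proof (rule dsum_hom_ext[OF hom_comp[OF h p] e(1) mF _ that])
      fix m r assume m: "m \<in> ?S" and "r \<in> carrier (?G m)"
      then have r: "r \<in> carrier R" by simp
      have "p (h (single ?S ?G m r)) = r \<odot>\<^bsub>F\<^esub> e (single ?S ?G m \<one>\<^bsub>R\<^esub>)"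
        using m r by (simp add: h_single hom_smult[OF p] g pg)
      also have "\<dots> = e (r \<odot>\<^bsub>?D\<^esub> single ?S ?G m \<one>\<^bsub>R\<^esub>)"
        using sc[OF m] r by (intro hom_smult[OF e(1), symmetric]) auto
      also have "r \<odot>\<^bsub>?D\<^esub> single ?S ?G m \<one>\<^bsub>R\<^esub> = single ?S ?G m r"
        using hom_smult[OF single_hom[OF m] r, of "\<one>\<^bsub>R\<^esub>"] r by simp
      finally show "p (h (single ?S ?G m r)) = e (single ?S ?G m r)" .
    qed
    then have "\<forall>c\<in>carrier F. p (h (e' c)) = c" using e(4) hom_closed[OF e(2)] by simp
    then show "(\<exists>r\<in>rmod_hom R N B. \<forall>a\<in>carrier B. r (i a) = a) \<or> (\<exists>s\<in>rmod_hom R F N. \<forall>c\<in>carrier F. p (s c) = c)"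
      using hom_comp[OF e(2) h] by (intro disjI2 bexI[of _ "\<lambda>c. h (e' c)"])
  qed
  moreover obtain h where h: "h \<in> rmod_hom R ?D M"
      and h_single: "\<And>m r. \<lbrakk>m \<in> ?S; r \<in> carrier R\<rbrakk> \<Longrightarrow> h (single ?S ?G m r) = r \<odot>\<^bsub>M\<^esub> m"
    by (rule obtain_free_hom[OF mM, of ?S "\<lambda>m. m"]) (assumption, rule that)
  have "(\<lambda>x. h (e' x)) ` carrier F = carrier M"
  proof (intro equalityI subsetI)
    fix m assume m: "m \<in> carrier M"
    have x: "single ?S ?G m \<one>\<^bsub>R\<^esub> \<in> carrier ?D" using hom_closed[OF single_hom[OF m]] by simp
    have "h (e' (e (single ?S ?G m \<one>\<^bsub>R\<^esub>))) = m"
      using h_single[OF m R.one_closed] left_module.smult_one[OF mM m] by (simp only: e(3)[OF x])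
    then show "m \<in> (\<lambda>x. h (e' x)) ` carrier F"
      using hom_closed[OF e(1) x] by (metis imageI)
  qed (use hom_closed[OF e(2)] hom_closed[OF h] in blast)
  ultimately show ?thesis using hom_comp[OF e(2) h] by blast
qed

text \<open>The structure map of each summand into \<open>P\<close> is lifted along \<open>p\<close>
  separately, and the lifts are glued by the universal property of the direct sum.\<close>

lemma left_perp_direct_sum:
  assumes Fp: "\<And>i. i \<in> I \<Longrightarrow> F i \<in> left_perp R U X" and P: "P \<in> Mods R U"
    and e: "e \<in> rmod_hom R (direct_sum I F) P" "e' \<in> rmod_hom R P (direct_sum I F)"
    "\<And>y. y \<in> carrier P \<Longrightarrow> e (e' y) = y"
  shows "P \<in> left_perp R U X"
proof (rule left_perpI[OF P])
  interpret module_family R I F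
    by (rule module_family.intro) (use ring Fp left_perp_left_module in auto)
  fix B N j p assume B: "B \<in> X" and N: "N \<in> Mods R U" and s: "ses R B j N p P"
  note mN = Mods_left_module[OF N] and p = ses_hom2[OF s] and mP = Mods_left_module[OF P]
  have "\<exists>g. i \<in> I \<longrightarrow> g \<in> rmod_hom R (F i) N \<and> (\<forall>a\<in>carrier (F i). p (g a) = e (single I F i a))" for i
    using left_perp_lift[OF Fp B s hom_comp[OF single_hom e(1)] mP mN] by metis
  then obtain g where g: "\<And>i. i \<in> I \<Longrightarrow> g i \<in> rmod_hom R (F i) N"
    and pg: "\<And>i a. \<lbrakk>i \<in> I; a \<in> carrier (F i)\<rbrakk> \<Longrightarrow> p (g i a) = e (single I F i a)" by metis
  obtain h where h: "h \<in> rmod_hom R (direct_sum I F) N"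
    and h_single: "\<And>i a. \<lbrakk>i \<in> I; a \<in> carrier (F i)\<rbrakk> \<Longrightarrow> h (single I F i a) = g i a"
    by (rule obtain_dsum_hom[OF mN g]) (assumption, rule that)
  have "p (h x) = e x" if "x \<in> carrier (direct_sum I F)" for x
    by (rule dsum_hom_ext[OF hom_comp[OF h p] e(1) mP _ that]) (simp add: h_single pg)
  then have "\<forall>c\<in>carrier P. p (h (e' c)) = c" using e(3) hom_closed[OF e(2)] by simp
  then show "(\<exists>r\<in>rmod_hom R N B. \<forall>a\<in>carrier B. r (j a) = a) \<or> (\<exists>s\<in>rmod_hom R P N. \<forall>c\<in>carrier P. p (s c) = c)"
    using hom_comp[OF e(2) h] by (intro disjI2 bexI[of _ "\<lambda>c. h (e' c)"])
qed

end

section \<open>Classes closed under inverse limits\<close>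

text \<open>With zero differentials any linear map, repeated in all degrees, is a chain map; inverse
  limits of modules thus become inverse limits of complexes.\<close>

definition const_cplx :: "('r, 'm) module \<Rightarrow> ('r, 'm) cplx" where
  "const_cplx M = \<lparr>obj = (\<lambda>_. M), dif = (\<lambda>_ _. \<zero>\<^bsub>M\<^esub>)\<rparr>"

lemma const_cplx_simps [simp]: "obj (const_cplx M) n = M" "dif (const_cplx M) n x = \<zero>\<^bsub>M\<^esub>"
  by (simp_all add: const_cplx_def)

context module_universe
begin

lemma const_cplx: assumes "M \<in> Mods R U" shows "const_cplx M \<in> Cplxs R U"
proof -
  have "is_cplx R (const_cplx M)"
    by (rule cplxI) (use Mods_left_module[OF assms] in \<open>auto simp: const_cplx_def intro: hom_const_zero\<close>)
  then show ?thesis using assms by (simp add: Cplxs_def)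
qed

lemma small_Un:
  assumes S: "small U S" and T: "small U T" and ne: "a \<in> S" "b \<in> T"
  shows "small U (S \<union> T)"
proof (rule small_inj[OF small_times[OF small_countable small_times[OF S T]], of "UNIV :: bool set"])
  \<comment> \<open>A tag tells the two sets apart, and the fixed points \<open>a\<close>,
    \<open>b\<close> fill the component that is not in use.\<close>
  show "inj_on (\<lambda>x. if x \<in> S then (True, x, b) else (False, a, x)) (S \<union> T)"
    by (auto simp: inj_on_def split: if_splits)
qed (use ne in auto)

text \<open>Index sets of inverse systems have to be members of \<open>U\<close>, so a sequence is
  indexed by a copy of the naturals inside \<open>'m\<close>.\<close>

lemma obtain_nat_index:
  obtains I :: "'m set" and \<nu> where "I \<in> U" "bij_betw \<nu> I (UNIV :: nat set)"
proof -
  obtain C where C: "C \<in> U" "infinite C" by (rule obtain_infinite_U)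
  then obtain g :: "nat \<Rightarrow> 'm" where g: "inj g" "range g \<subseteq> C" using infinite_countable_subset by blast
  have "bij_betw (inv_into UNIV g) (range g) UNIV" using g(1) by (simp add: bij_betw_inv_into inj_imp_bij_betw_inv)
  moreover have "range g \<in> U" using U_lepoll[OF C(1) subset_imp_lepoll[OF g(2)]] .
  ultimately show thesis by (rule that[rotated])
qed

end

context module_class
begin

text \<open>
  After Bergman's theorem that every module is an inverse limit of injectives. Given
  \<open>0 \<rightarrow> A \<rightarrow> B \<rightarrow> L \<rightarrow> 0\<close> with \<open>f : B \<rightarrow> L\<close>, let \<open>P = B \<oplus> L \<oplus> L \<oplus> \<dots>\<close> and
  \<open>T (b, c\<^sub>0, c\<^sub>1, \<dots>) = (b, f b, c\<^sub>0, c\<^sub>1, \<dots>)\<close>. A compatible sequence for \<open>P \<leftarrow> P \<leftarrow> \<dots>\<close> consists of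
  elements \<open>(b, f b, f b, \<dots>)\<close>, and finiteness of the supports forces \<open>f b = 0\<close>. Hence the limit is \<open>A\<close>.
\<close>

lemma inverse_limit_closed_eq_Mods:
  assumes cot: "complete_cotorsion_pair R U X (right_perp R U X)"
    and sub: "right_perp R U X \<subseteq> X"
    and lim: "closed_under_inverse_limits R U (C_star R U X)"
  shows "Mods R U \<subseteq> X"
proof
  fix A assume A: "A \<in> Mods R U"
  note mA = Mods_left_module[OF A]
  \<comment> \<open>The orthogonality lemmas are also applied to the class
    \<open>right_perp R U X\<close>, whose left orthogonal is \<open>X\<close>. This is how closure
    of \<open>X\<close> under direct sums is obtained.\<close>
  interpret Z: module_class R U "right_perp R U X"
    by unfold_locales (auto simp: right_perp_def)
  have Xeq: "left_perp R U (right_perp R U X) = X"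
    using cot by (simp add: complete_cotorsion_pair_def cotorsion_pair_def)
  obtain B L i f where B: "B \<in> right_perp R U X" and L: "L \<in> X" and s: "ses R A i B f L"
    using cot A unfolding complete_cotorsion_pair_def short_exact_eq_ses by blast
  note mB = right_perp_left_module[OF B] and mL = X_left_module[OF L]
  note ih = ses_hom1[OF s] and fh = ses_hom2[OF s]
  interpret B: left_module R B by fact
  interpret L: left_module R L by fact
  define G where "G = case_nat B (\<lambda>_. L)"
  have G [simp]: "G 0 = B" "G (Suc k) = L" for k by (simp_all add: G_def)
  \<comment> \<open>The summand \<open>B\<close> belongs to \<open>X\<close> because it is
    \<open>X\<close>-injective; this is where \<open>sub\<close> enters.\<close>
  have G_X: "G k \<in> left_perp R U (right_perp R U X)" for k
    unfolding Xeq using B L sub by (cases k) auto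
  have mG: "left_module R (G k)" for k using mB mL by (cases k) auto
  interpret D: module_family R "UNIV :: nat set" G
    by (rule module_family.intro) (use ring mG in auto)
  let ?D = "direct_sum (UNIV :: nat set) G"
  note mD = D.direct_sum_left_module
  have x0: "x 0 \<in> carrier B" and xS: "x (Suc k) \<in> carrier L" if "x \<in> carrier ?D" for x k
    using D.dsumD[OF that, of 0] D.dsumD[OF that, of "Suc k"] by simp_all
  have "carrier (G k) \<subseteq> carrier B \<union> carrier L" for k by (cases k) auto
  moreover have "small U (carrier B \<union> carrier L)"
    by (rule small_Un[OF Mods_small[OF right_perp_Mods[OF B]] Mods_small[OF X_in_Mods[OF L]]
          B.zero_closed L.zero_closed])
  ultimately have "small U (carrier ?D)"
    unfolding direct_sum_simps by (intro small_finsupp[OF small_countable]) auto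
  then obtain P e e' where P: "P \<in> Mods R U" and e: "e \<in> rmod_hom R ?D P" "e' \<in> rmod_hom R P ?D"
    "\<And>x. x \<in> carrier ?D \<Longrightarrow> e' (e x) = x" "\<And>y. y \<in> carrier P \<Longrightarrow> e (e' y) = y"
    using obtain_Mods_iso[OF mD] by metis
  note mP = Mods_left_module[OF P]
  have "P \<in> X"
    using Z.left_perp_direct_sum[OF G_X P e(1,2,4)] unfolding Xeq .
  then have PX: "const_cplx P \<in> C_star R U X"
    using const_cplx[OF P] by (simp add: C_star_def)

  define T where "T x = case_nat (x 0) (case_nat (f (x 0)) (\<lambda>j. x (Suc j)))" for x
  have T [simp]: "T x 0 = x 0" "T x (Suc 0) = f (x 0)" "T x (Suc (Suc j)) = x (Suc j)" for x j
    by (simp_all add: T_def)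
  have T_hom: "T \<in> rmod_hom R ?D ?D"
  proof (rule homI)
    fix x assume x: "x \<in> carrier ?D"
    have "(\<lambda>k\<in>UNIV. T x k) \<in> carrier ?D"
    proof (rule D.dsumI)
      show "T x k \<in> carrier (G k)" for k
        using x0[OF x] xS[OF x] hom_closed[OF fh x0[OF x]] by (auto simp: T_def split: nat.split)
      \<comment> \<open>Positive coordinates move up by one; coordinates 0 and 1 of
        \<open>T x\<close> are \<open>x 0\<close> and \<open>f (x 0)\<close>.\<close>
      show "finite ({0, Suc 0} \<union> Suc ` supp UNIV G x)" using D.dsum_finite[OF x] by simp
      show "T x k = \<zero>\<^bsub>G k\<^esub>" if "k \<notin> {0, Suc 0} \<union> Suc ` supp UNIV G x" for k
      proof -
        have "k \<noteq> 0" "k \<noteq> Suc 0" and k: "k \<notin> Suc ` supp UNIV G x" using that by auto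
        then obtain j where j: "k = Suc (Suc j)" by (metis not0_implies_Suc)
        then have "Suc j \<notin> supp UNIV G x" using k by (simp add: inj_image_mem_iff)
        then show ?thesis by (simp add: j supp_def)
      qed
    qed
    then show "T x \<in> carrier ?D" by (simp only: restrict_UNIV)
    show "T (x \<oplus>\<^bsub>?D\<^esub> y) = T x \<oplus>\<^bsub>?D\<^esub> T y" if y: "y \<in> carrier ?D" for y
      using x0[OF x] x0[OF y] by (auto simp: T_def fun_eq_iff hom_add[OF fh] split: nat.split)
    show "T (r \<odot>\<^bsub>?D\<^esub> x) = r \<odot>\<^bsub>?D\<^esub> T x" if "r \<in> carrier R" for r
      using x0[OF x] that by (auto simp: T_def fun_eq_iff hom_smult[OF fh] split: nat.split)
  qed
  define \<tau> where "\<tau> = (\<lambda>w. e (T (e' w)))"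
  have \<tau>: "\<tau> \<in> rmod_hom R P P" unfolding \<tau>_def by (rule hom_comp[OF hom_comp[OF e(2) T_hom] e(1)])
  have \<tau>k: "\<tau> ^^ k \<in> rmod_hom R P P" for k
  proof (induction k)
    case 0 show ?case by (rule homI) auto
  next
    case (Suc k) then show ?case using hom_comp[OF Suc.IH \<tau>] by (simp add: comp_def)
  qed
  obtain I :: "'m set" and \<nu> where I: "I \<in> U" and \<nu>: "bij_betw \<nu> I (UNIV :: nat set)"
    by (rule obtain_nat_index)
  define at where "at = inv_into I \<nu>"
  have at: "at k \<in> I" "\<nu> (at k) = k" for k
    using \<nu> by (auto simp: at_def bij_betw_def inv_into_into f_inv_into_f)
  have at_\<nu>: "at (\<nu> j) = j" if "j \<in> I" for j using \<nu> that by (simp add: at_def bij_betw_def)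
  define leq where "leq j k \<longleftrightarrow> \<nu> j \<le> \<nu> k" for j k
  \<comment> \<open>All stages are the same module, and passing from stage \<open>k\<close> down to
    stage \<open>j\<close> iterates \<open>\<tau>\<close> as often as the indices differ.\<close>
  define \<phi> where "\<phi> j k = (\<lambda>_::int. \<tau> ^^ (\<nu> k - \<nu> j))" for j k
  let ?F = "\<lambda>_::'m. const_cplx P"
  have "directed_poset I leq"
    unfolding directed_poset_def leq_def using at(1) \<nu>
    by (auto simp: bij_betw_def inj_on_def) (meson linear)
  moreover have "\<phi> j k \<in> chain_maps R (const_cplx P) (const_cplx P)" for j k
    using \<tau>k hom_zero[OF \<tau>k mP mP] by (simp add: chain_maps_def \<phi>_def)
  moreover have "\<phi> j k n (\<phi> k l n x) = \<phi> j l n x" if "leq j k \<and> leq k l" for j k l n x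
  proof -
    have "(\<nu> k - \<nu> j) + (\<nu> l - \<nu> k) = \<nu> l - \<nu> j" using that by (auto simp: leq_def)
    then show ?thesis by (metis \<phi>_def comp_apply funpow_add)
  qed
  ultimately have sys: "inverse_system R I leq ?F \<phi>"
    using Cplxs_cplx[OF const_cplx[OF P]] by (auto simp: inverse_system_def \<phi>_def)
  let ?L = "inverse_limit I leq ?F \<phi>"

  define w where "w a = e (single UNIV G 0 (i a))" for a
  have w_hom: "w \<in> rmod_hom R A P"
    unfolding w_def by (rule hom_comp[OF hom_comp[OF ih] e(1)]) (use D.single_hom[of 0] in simp)
  have single_i: "single UNIV G 0 (i a) \<in> carrier ?D" if "a \<in> carrier A" for a
    using hom_closed[OF D.single_hom[of 0]] hom_closed[OF ih that] by simp
  have \<tau>w: "(\<tau> ^^ k) (w a) = w a" if a: "a \<in> carrier A" for k a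
  proof (induction k)
    case (Suc k)
    \<comment> \<open>Elements of \<open>A\<close> sit in coordinate 0, where \<open>f i = 0\<close>
      makes them fixed points of \<open>T\<close>; so they give constant compatible
      sequences.\<close>
    have "T (single UNIV G 0 (i a)) = single UNIV G 0 (i a)"
      using ses_zero[OF s a] by (auto simp: T_def single_def fun_eq_iff split: nat.split)
    then have "\<tau> (w a) = w a" by (simp add: \<tau>_def w_def e(3)[OF single_i[OF a]])
    then show ?case using Suc by simp
  qed simp
  define \<psi> where "\<psi> = (\<lambda>_::int. \<lambda>a. \<lambda>j\<in>I. w a)"
  have L_simps: "carrier (obj ?L n) = {x \<in> (\<Pi>\<^sub>E j\<in>I. carrier P). \<forall>j\<in>I. \<forall>k\<in>I. leq j k \<longrightarrow> \<phi> j k n (x k) = x j}"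
    "x \<oplus>\<^bsub>obj ?L n\<^esub> y = (\<lambda>j\<in>I. x j \<oplus>\<^bsub>P\<^esub> y j)" "r \<odot>\<^bsub>obj ?L n\<^esub> x = (\<lambda>j\<in>I. r \<odot>\<^bsub>P\<^esub> x j)"
    "dif ?L n x = (\<lambda>j\<in>I. \<zero>\<^bsub>P\<^esub>)" for n x y r
    by (simp_all add: inverse_limit_def)
  have "\<psi> n \<in> rmod_hom R A (obj ?L n)" for n
    by (rule homI) (auto simp: L_simps \<psi>_def \<phi>_def \<tau>w hom_closed[OF w_hom] hom_add[OF w_hom] hom_smult[OF w_hom])
  then have "\<psi> \<in> chain_maps R (const_cplx A) ?L"
    by (simp add: chain_maps_def L_simps(4) \<psi>_def hom_zero[OF w_hom mA mP])
  moreover have "bij_betw (\<psi> n) (carrier A) (carrier (obj ?L n))" for n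
    unfolding bij_betw_def
  proof (intro conjI equalityI subsetI)
    show "inj_on (\<psi> n) (carrier A)"
    proof (rule inj_onI)
      fix a b assume ab: "a \<in> carrier A" "b \<in> carrier A" "\<psi> n a = \<psi> n b"
      have "w a = w b" using fun_cong[OF ab(3), of "at 0"] unfolding \<psi>_def restrict_apply'[OF at(1)] .
      have e'w: "e' (w c) = single UNIV G 0 (i c)" if "c \<in> carrier A" for c
        unfolding w_def by (rule e(3)[OF single_i[OF that]])
      have "single UNIV G 0 (i a) = single UNIV G 0 (i b)"
        unfolding e'w[OF ab(1), symmetric] e'w[OF ab(2), symmetric] \<open>w a = w b\<close> ..
      from fun_cong[OF this, of 0] have "i a = i b" by (simp add: single_def)
      then show "a = b" using ses_inj[OF s] ab by (auto dest: inj_onD)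
    qed
    show "x \<in> carrier (obj ?L n)" if "x \<in> \<psi> n ` carrier A" for x
      using that hom_closed[OF \<open>\<psi> n \<in> rmod_hom R A (obj ?L n)\<close>] by blast
    fix x assume "x \<in> carrier (obj ?L n)"
    then have x: "x \<in> (\<Pi>\<^sub>E j\<in>I. carrier P)" and comp: "\<And>j k. \<lbrakk>j \<in> I; k \<in> I; leq j k\<rbrakk> \<Longrightarrow> \<phi> j k n (x k) = x j"
      unfolding L_simps by auto
    define y where "y m = e' (x (at m))" for m
    have xP: "x (at m) \<in> carrier P" for m using x at(1) by auto
    have y: "y m \<in> carrier ?D" for m unfolding y_def by (rule hom_closed[OF e(2) xP])
    \<comment> \<open>Compatibility between neighbouring stages, moved from \<open>P\<close> to the
      direct sum. It expresses each stage by the next one, so coordinate \<open>Suc (Suc k)\<close>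
      at stage \<open>m\<close> equals coordinate \<open>Suc k\<close> at stage
      \<open>m + 1\<close>.\<close>
    have yT: "y m = T (y (Suc m))" for m
    proof -
      have "\<tau> (x (at (Suc m))) = x (at m)"
        using comp[OF at(1) at(1), of m "Suc m"] by (simp add: leq_def \<phi>_def at(2))
      then have "y m = e' (e (T (y (Suc m))))" by (simp add: y_def \<tau>_def)
      then show ?thesis by (simp only: e(3)[OF hom_closed[OF T_hom y]])
    qed
    have y_0: "y m 0 = y 0 0" for m
    proof (induction m)
      case (Suc m) then show ?case using yT[of m] by (metis T(1))
    qed simp
    \<comment> \<open>The induction descends in the coordinate while the stage grows, so the stage
      has to remain arbitrary.\<close>
    have y_Suc: "y m (Suc k) = f (y 0 0)" for m k
    proof (induction k arbitrary: m)
      case 0 show ?case using yT[of m] y_0[of "Suc m"] by (metis T(2))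
    next
      case (Suc k) show ?case using yT[of m] Suc[of "Suc m"] by (metis T(3))
    qed
    have "finite (supp UNIV G (y 0))" by (rule D.dsum_finite[OF y])
    then have "finite (Suc -` supp UNIV G (y 0))" by (rule finite_vimageI) simp
    then obtain k where "k \<notin> Suc -` supp UNIV G (y 0)" using ex_new_if_finite infinite_UNIV_nat by blast
    then have "f (y 0 0) = \<zero>\<^bsub>L\<^esub>" using y_Suc[of 0 k] by (simp add: supp_def)
    then obtain a where a: "a \<in> carrier A" "y 0 0 = i a" using ses_ker[OF s x0[OF y]] by blast
    have "y m k = single UNIV G 0 (i a) k" for m k
      using y_0[of m] y_Suc[of m] a(2) \<open>f (y 0 0) = \<zero>\<^bsub>L\<^esub>\<close> by (cases k) (simp_all add: single_def)
    then have "y m = single UNIV G 0 (i a)" for m by blast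
    then have "x (at m) = w a" for m using e(4)[OF xP] by (simp add: w_def y_def)
    then have "x j = w a" if "j \<in> I" for j using at_\<nu>[OF that] by metis
    then have "x = \<psi> n a" using x unfolding \<psi>_def by (intro ext) (auto simp: PiE_def extensional_def)
    then show "x \<in> \<psi> n ` carrier A" using a(1) by blast
  qed
  ultimately have "cplx_iso R (const_cplx A) ?L"
    unfolding cplx_iso_def by (intro bexI[of _ \<psi>]) auto
  then have "const_cplx A \<in> C_star R U X"
    using lim I sys PX const_cplx[OF A] unfolding closed_under_inverse_limits_def by blast
  then show "A \<in> X" using C_star_obj[of "const_cplx A" 0] by simp
qed

end

section \<open>Divisible groups and injective modules\<close>

definition int_module :: "('a, 'b) ring_scheme \<Rightarrow> (int, 'a) module" where
  "int_module G = \<lparr>carrier = carrier G, monoid.mult = undefined, one = undefined,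
     zero = \<zero>\<^bsub>G\<^esub>, add = (\<oplus>\<^bsub>G\<^esub>), smult = (\<lambda>k x. [k] \<cdot>\<^bsub>G\<^esub> x)\<rparr>"

lemma int_module_simps [simp]:
  "carrier (int_module G) = carrier G" "\<zero>\<^bsub>int_module G\<^esub> = \<zero>\<^bsub>G\<^esub>"
  "x \<oplus>\<^bsub>int_module G\<^esub> y = x \<oplus>\<^bsub>G\<^esub> y" "k \<odot>\<^bsub>int_module G\<^esub> x = [k] \<cdot>\<^bsub>G\<^esub> x"
  by (simp_all add: int_module_def)

lemma int_ring: "ring int_ring"
  using int_is_cring cring.axioms(1) by blast

lemma int_left_module:
  assumes "abelian_group G" shows "left_module int_ring (int_module G)"
proof -
  interpret abelian_group G by fact
  show ?thesis
  proof (rule left_moduleI[OF int_ring])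
    show "abelian_group (int_module G)"
    proof (rule abelian_groupI)
      fix x assume "x \<in> carrier (int_module G)"
      then show "\<exists>y\<in>carrier (int_module G). y \<oplus>\<^bsub>int_module G\<^esub> x = \<zero>\<^bsub>int_module G\<^esub>"
        by (intro bexI[of _ "\<ominus>\<^bsub>G\<^esub> x"]) (auto simp: l_neg)
    qed (auto simp: a_ac)
  qed (simp_all add: add.int_pow_mult add.int_pow_distrib add.int_pow_pow add.int_pow_1 mult.commute)
qed

text \<open>Over the integers linearity reduces to additivity, by induction upwards and downwards
  from 0. This lets maps of \<open>R\<close>-modules be treated as maps of their underlying
  groups.\<close>

lemma additive_int_hom:
  assumes M: "left_module int_ring M" and N: "left_module int_ring N"
    and f: "\<And>x. x \<in> carrier M \<Longrightarrow> f x \<in> carrier N"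
    and add: "\<And>x y. \<lbrakk>x \<in> carrier M; y \<in> carrier M\<rbrakk> \<Longrightarrow> f (x \<oplus>\<^bsub>M\<^esub> y) = f x \<oplus>\<^bsub>N\<^esub> f y"
  shows "f \<in> rmod_hom int_ring M N"
proof (rule homI)
  interpret M: left_module int_ring M by fact
  interpret N: left_module int_ring N by fact
  have M_step: "(k + 1) \<odot>\<^bsub>M\<^esub> x = k \<odot>\<^bsub>M\<^esub> x \<oplus>\<^bsub>M\<^esub> x" and M_cl: "k \<odot>\<^bsub>M\<^esub> x \<in> carrier M"
    and M_zero: "0 \<odot>\<^bsub>M\<^esub> x = \<zero>\<^bsub>M\<^esub>" if "x \<in> carrier M" for k :: int and x
    using M.smult_l_distr[of k 1 x] M.smult_one[of x] M.smult_closed[of k x] M.smult_zero_left[of x] that by simp_all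
  have N_step: "(k + 1) \<odot>\<^bsub>N\<^esub> x = k \<odot>\<^bsub>N\<^esub> x \<oplus>\<^bsub>N\<^esub> x" and N_cl: "k \<odot>\<^bsub>N\<^esub> x \<in> carrier N"
    and N_zero: "0 \<odot>\<^bsub>N\<^esub> x = \<zero>\<^bsub>N\<^esub>" if "x \<in> carrier N" for k :: int and x
    using N.smult_l_distr[of k 1 x] N.smult_one[of x] N.smult_closed[of k x] N.smult_zero_left[of x] that by simp_all
  fix k x assume x: "x \<in> carrier M"
  have "f (k \<odot>\<^bsub>M\<^esub> x) = k \<odot>\<^bsub>N\<^esub> f x"
  proof (induction k rule: int_induct[where k = 0])
    case base
    have "f \<zero>\<^bsub>M\<^esub> \<oplus>\<^bsub>N\<^esub> f \<zero>\<^bsub>M\<^esub> = f \<zero>\<^bsub>M\<^esub>" using add[of "\<zero>\<^bsub>M\<^esub>" "\<zero>\<^bsub>M\<^esub>"] by simp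
    then have "f \<zero>\<^bsub>M\<^esub> = \<zero>\<^bsub>N\<^esub>" using f[OF M.zero_closed] N.add.l_cancel_one by blast
    then show ?case using x f by (simp add: M_zero N_zero)
  next
    case (step1 k) then show ?case using x f by (simp add: M_step N_step M_cl add)
  next
    case (step2 k)
    have "f ((k - 1) \<odot>\<^bsub>M\<^esub> x) \<oplus>\<^bsub>N\<^esub> f x = (k - 1) \<odot>\<^bsub>N\<^esub> f x \<oplus>\<^bsub>N\<^esub> f x"
      using step2 M_step[OF x, of "k - 1"] N_step[OF f[OF x], of "k - 1"] x add[OF M_cl[OF x] x] by simp
    then show ?case
      using f[OF x] f[OF M_cl[OF x, of "k - 1"]] N_cl[OF f[OF x], of "k - 1"] by (simp add: N.add.right_cancel)
  qed
  then show "f (k \<odot>\<^bsub>M\<^esub> x) = k \<odot>\<^bsub>N\<^esub> f x" .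
qed (fact f add)+

text \<open>Baer's argument for the integers: a maximal partial extension of \<open>g\<close>, which
  exists by Zorn's lemma, is total, since divisibility allows a value to be assigned to any further
  element.\<close>

lemma divisible_extend:
  assumes M: "left_module int_ring M" and N: "left_module int_ring N" and D: "left_module int_ring D"
    and div: "\<And>k d. \<lbrakk>k \<noteq> 0; d \<in> carrier D\<rbrakk> \<Longrightarrow> \<exists>e\<in>carrier D. k \<odot>\<^bsub>D\<^esub> e = d"
    and j: "j \<in> rmod_hom int_ring M N" "inj_on j (carrier M)" and g: "g \<in> rmod_hom int_ring M D"
  obtains h where "h \<in> rmod_hom int_ring N D" "\<And>m. m \<in> carrier M \<Longrightarrow> h (j m) = g m"
proof -
  interpret M: left_module int_ring M by fact
  interpret N: left_module int_ring N by fact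
  interpret D: left_module int_ring D by fact
  have smult_cl [simp]: "x \<in> carrier N \<Longrightarrow> k \<odot>\<^bsub>N\<^esub> x \<in> carrier N" "d \<in> carrier D \<Longrightarrow> k \<odot>\<^bsub>D\<^esub> d \<in> carrier D"
    for k x d using N.smult_closed[of k x] D.smult_closed[of k d] by simp_all
  have smult_add: "x \<in> carrier N \<Longrightarrow> (k + l) \<odot>\<^bsub>N\<^esub> x = k \<odot>\<^bsub>N\<^esub> x \<oplus>\<^bsub>N\<^esub> l \<odot>\<^bsub>N\<^esub> x"
    "d \<in> carrier D \<Longrightarrow> (k + l) \<odot>\<^bsub>D\<^esub> d = k \<odot>\<^bsub>D\<^esub> d \<oplus>\<^bsub>D\<^esub> l \<odot>\<^bsub>D\<^esub> d"
    and smult_mult: "x \<in> carrier N \<Longrightarrow> (k * l) \<odot>\<^bsub>N\<^esub> x = k \<odot>\<^bsub>N\<^esub> (l \<odot>\<^bsub>N\<^esub> x)"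
    "d \<in> carrier D \<Longrightarrow> (k * l) \<odot>\<^bsub>D\<^esub> d = k \<odot>\<^bsub>D\<^esub> (l \<odot>\<^bsub>D\<^esub> d)"
    and smult_neg: "x \<in> carrier N \<Longrightarrow> (- 1) \<odot>\<^bsub>N\<^esub> x = \<ominus>\<^bsub>N\<^esub> x" "d \<in> carrier D \<Longrightarrow> (- 1) \<odot>\<^bsub>D\<^esub> d = \<ominus>\<^bsub>D\<^esub> d"
    and smult_01: "x \<in> carrier N \<Longrightarrow> 0 \<odot>\<^bsub>N\<^esub> x = \<zero>\<^bsub>N\<^esub>" "d \<in> carrier D \<Longrightarrow> 0 \<odot>\<^bsub>D\<^esub> d = \<zero>\<^bsub>D\<^esub>"
      "x \<in> carrier N \<Longrightarrow> 1 \<odot>\<^bsub>N\<^esub> x = x" "d \<in> carrier D \<Longrightarrow> 1 \<odot>\<^bsub>D\<^esub> d = d"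
    and smult_r: "\<lbrakk>x \<in> carrier N; y \<in> carrier N\<rbrakk> \<Longrightarrow> k \<odot>\<^bsub>N\<^esub> (x \<oplus>\<^bsub>N\<^esub> y) = k \<odot>\<^bsub>N\<^esub> x \<oplus>\<^bsub>N\<^esub> k \<odot>\<^bsub>N\<^esub> y"
      "\<lbrakk>d \<in> carrier D; e \<in> carrier D\<rbrakk> \<Longrightarrow> k \<odot>\<^bsub>D\<^esub> (d \<oplus>\<^bsub>D\<^esub> e) = k \<odot>\<^bsub>D\<^esub> d \<oplus>\<^bsub>D\<^esub> k \<odot>\<^bsub>D\<^esub> e"
    for k l x d y e
    using N.smult_l_distr[of k l x] D.smult_l_distr[of k l d] N.smult_assoc[of k l x] D.smult_assoc[of k l d]
      N.neg_eq_smult[of x] D.neg_eq_smult[of d] N.smult_zero_left[of x] D.smult_zero_left[of d]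
      N.smult_one[of x] D.smult_one[of d] N.smult_r_distr[of k x y] D.smult_r_distr[of k d e]
    by (simp_all add: int_a_inv_eq)
  \<comment> \<open>Partial extensions are represented by their graphs, subgroups of the product.
    For a subgroup, being single-valued amounts to the condition over 0, and unions of chains stay
    in the family.\<close>
  define \<G> where "\<G> = {S. S \<subseteq> carrier N \<times> carrier D \<and> (\<forall>m\<in>carrier M. (j m, g m) \<in> S) \<and>
    (\<forall>a b c d. (a, b) \<in> S \<and> (c, d) \<in> S \<longrightarrow> (a \<oplus>\<^bsub>N\<^esub> c, b \<oplus>\<^bsub>D\<^esub> d) \<in> S) \<and>
    (\<forall>k a b. (a, b) \<in> S \<longrightarrow> (k \<odot>\<^bsub>N\<^esub> a, k \<odot>\<^bsub>D\<^esub> b) \<in> S) \<and>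
    (\<forall>d. (\<zero>\<^bsub>N\<^esub>, d) \<in> S \<longrightarrow> d = \<zero>\<^bsub>D\<^esub>)}"
  have "\<exists>S\<in>\<G>. \<forall>T\<in>\<G>. S \<subseteq> T \<longrightarrow> T = S"
  proof (rule subset_Zorn_nonempty)
    let ?S = "(\<lambda>m. (j m, g m)) ` carrier M"
    have "?S \<in> \<G>"
      unfolding \<G>_def mem_Collect_eq
    proof (intro conjI allI impI)
      show "?S \<subseteq> carrier N \<times> carrier D" using hom_closed[OF j(1)] hom_closed[OF g] by auto
      fix a b c d assume "(a, b) \<in> ?S \<and> (c, d) \<in> ?S"
      then obtain m m' where m: "m \<in> carrier M" "m' \<in> carrier M" "a = j m" "b = g m" "c = j m'" "d = g m'" by auto
      show "(a \<oplus>\<^bsub>N\<^esub> c, b \<oplus>\<^bsub>D\<^esub> d) \<in> ?S"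
        using m by (intro image_eqI[of _ _ "m \<oplus>\<^bsub>M\<^esub> m'"]) (auto simp: hom_add[OF j(1)] hom_add[OF g])
    next
      fix k a b assume "(a, b) \<in> ?S"
      then obtain m where m: "m \<in> carrier M" "a = j m" "b = g m" by auto
      then show "(k \<odot>\<^bsub>N\<^esub> a, k \<odot>\<^bsub>D\<^esub> b) \<in> ?S"
        using hom_smult[OF j(1), of k m] hom_smult[OF g, of k m] M.smult_closed[of k m]
        by (intro image_eqI[of _ _ "k \<odot>\<^bsub>M\<^esub> m"]) simp_all
    next
      fix d assume "(\<zero>\<^bsub>N\<^esub>, d) \<in> ?S"
      then show "d = \<zero>\<^bsub>D\<^esub>" using j(2) hom_inj_iff[OF j(1) M N] hom_zero[OF g M D] by auto
    qed auto
    then show "\<G> \<noteq> {}" by blast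
  next
    fix \<C> assume ne: "\<C> \<noteq> {}" and ch: "subset.chain \<G> \<C>"
    have mem: "S \<in> \<G>" if "S \<in> \<C>" for S using ch that by (auto simp: subset.chain_def)
    have pair: "\<exists>S\<in>\<C>. u \<in> S \<and> v \<in> S" if uv: "u \<in> \<Union>\<C>" "v \<in> \<Union>\<C>" for u v
    proof -
      obtain S T where ST: "S \<in> \<C>" "u \<in> S" "T \<in> \<C>" "v \<in> T" using uv by blast
      then have "S \<subseteq> T \<or> T \<subseteq> S" using ch by (auto simp: subset_chain_def)
      then show ?thesis using ST by blast
    qed
    show "\<Union>\<C> \<in> \<G>"
      unfolding \<G>_def mem_Collect_eq
    proof (intro conjI allI impI)
      show "\<Union>\<C> \<subseteq> carrier N \<times> carrier D" using mem unfolding \<G>_def by blast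
      show "\<forall>m\<in>carrier M. (j m, g m) \<in> \<Union>\<C>" using mem ne unfolding \<G>_def by blast
      fix a b c d assume *: "(a, b) \<in> \<Union>\<C> \<and> (c, d) \<in> \<Union>\<C>"
      then obtain S where "S \<in> \<C>" "(a, b) \<in> S" "(c, d) \<in> S" using pair[of "(a, b)" "(c, d)"] by blast
      then show "(a \<oplus>\<^bsub>N\<^esub> c, b \<oplus>\<^bsub>D\<^esub> d) \<in> \<Union>\<C>" using mem unfolding \<G>_def by blast
    next
      fix k a b assume "(a, b) \<in> \<Union>\<C>"
      then show "(k \<odot>\<^bsub>N\<^esub> a, k \<odot>\<^bsub>D\<^esub> b) \<in> \<Union>\<C>" using mem unfolding \<G>_def by blast
    next
      fix d assume "(\<zero>\<^bsub>N\<^esub>, d) \<in> \<Union>\<C>"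
      then show "d = \<zero>\<^bsub>D\<^esub>" using mem unfolding \<G>_def by blast
    qed
  qed
  then obtain S where S: "S \<in> \<G>" and max: "\<And>T. \<lbrakk>T \<in> \<G>; S \<subseteq> T\<rbrakk> \<Longrightarrow> T = S" by blast
  have S_sub: "S \<subseteq> carrier N \<times> carrier D" and S_g: "\<And>m. m \<in> carrier M \<Longrightarrow> (j m, g m) \<in> S"
    and S_add: "\<And>a b c d. \<lbrakk>(a, b) \<in> S; (c, d) \<in> S\<rbrakk> \<Longrightarrow> (a \<oplus>\<^bsub>N\<^esub> c, b \<oplus>\<^bsub>D\<^esub> d) \<in> S"
    and S_smult: "\<And>k a b. (a, b) \<in> S \<Longrightarrow> (k \<odot>\<^bsub>N\<^esub> a, k \<odot>\<^bsub>D\<^esub> b) \<in> S"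
    and S_0: "\<And>d. (\<zero>\<^bsub>N\<^esub>, d) \<in> S \<Longrightarrow> d = \<zero>\<^bsub>D\<^esub>"
    using S unfolding \<G>_def by blast+
  have S_cl: "a \<in> carrier N" "b \<in> carrier D" if "(a, b) \<in> S" for a b using S_sub that by auto
  have S_fun: "b = c" if "(a, b) \<in> S" "(a, c) \<in> S" for a b c
  proof -
    have "(a \<oplus>\<^bsub>N\<^esub> (- 1) \<odot>\<^bsub>N\<^esub> a, b \<oplus>\<^bsub>D\<^esub> (- 1) \<odot>\<^bsub>D\<^esub> c) \<in> S" by (intro S_add S_smult that)
    then have "b \<ominus>\<^bsub>D\<^esub> c = \<zero>\<^bsub>D\<^esub>"
      using S_0 S_cl[OF that(1)] S_cl[OF that(2)] by (simp add: smult_neg N.r_neg a_minus_def)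
    then show ?thesis using S_cl(2) that D.minus_eq_zero_iff by blast
  qed
  have total: "\<exists>d. (x, d) \<in> S" if x: "x \<in> carrier N" for x
  proof -
    \<comment> \<open>The element \<open>e\<close> is to become the value at \<open>x\<close>, so it
      has to agree with \<open>S\<close> on all multiples of \<open>x\<close> already in the
      domain.\<close>
    have "\<exists>e\<in>carrier D. \<forall>k d. (k \<odot>\<^bsub>N\<^esub> x, d) \<in> S \<longrightarrow> d = k \<odot>\<^bsub>D\<^esub> e"
    proof (cases "\<exists>k. k \<noteq> 0 \<and> (\<exists>d. (k \<odot>\<^bsub>N\<^esub> x, d) \<in> S)")
      case False
      then have "d = k \<odot>\<^bsub>D\<^esub> \<zero>\<^bsub>D\<^esub>" if "(k \<odot>\<^bsub>N\<^esub> x, d) \<in> S" for k d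
        using that S_0[of d] by (cases "k = 0") (auto simp: smult_01 x)
      then show ?thesis by blast
    next
      case True
      then obtain k0 d0 where k0: "k0 \<noteq> 0" "(k0 \<odot>\<^bsub>N\<^esub> x, d0) \<in> S" by blast
      \<comment> \<open>The integers that multiply \<open>x\<close> into the domain form a subgroup;
        its least positive element \<open>n\<close> generates it, so \<open>e\<close> only has to
        solve \<open>n e = c\<close> for the value \<open>c\<close> at \<open>n x\<close>.\<close>
      let ?P = "\<lambda>n::nat. n > 0 \<and> (\<exists>d. (int n \<odot>\<^bsub>N\<^esub> x, d) \<in> S)"
      have "?P (nat \<bar>k0\<bar>)"
      proof (cases "k0 > 0")
        case True then show ?thesis using k0 by auto
      next
        case False
        have "((- 1) \<odot>\<^bsub>N\<^esub> (k0 \<odot>\<^bsub>N\<^esub> x), (- 1) \<odot>\<^bsub>D\<^esub> d0) \<in> S" by (rule S_smult[OF k0(2)])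
        then have "((- k0) \<odot>\<^bsub>N\<^esub> x, (- 1) \<odot>\<^bsub>D\<^esub> d0) \<in> S" using smult_mult(1)[OF x, of "- 1" k0] by simp
        then show ?thesis using False k0 by auto
      qed
      then have P: "?P (LEAST n. ?P n)" by (rule LeastI)
      define n where "n = (LEAST n. ?P n)"
      obtain c where n: "n > 0" "(int n \<odot>\<^bsub>N\<^esub> x, c) \<in> S" using P unfolding n_def by blast
      have least: "m \<ge> n" if "?P m" for m unfolding n_def by (rule Least_le) (rule that)
      obtain e where e: "e \<in> carrier D" "int n \<odot>\<^bsub>D\<^esub> e = c" using div[of "int n" c] n S_cl by auto
      have "d = k \<odot>\<^bsub>D\<^esub> e" if d: "(k \<odot>\<^bsub>N\<^esub> x, d) \<in> S" for k d
      proof -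
        \<comment> \<open>Division with remainder: the remainder also multiplies \<open>x\<close>
          into the domain, so it is 0 by minimality of \<open>n\<close>.\<close>
        define t where "t = k div int n"
        have "(k \<odot>\<^bsub>N\<^esub> x \<oplus>\<^bsub>N\<^esub> (- t) \<odot>\<^bsub>N\<^esub> (int n \<odot>\<^bsub>N\<^esub> x), d \<oplus>\<^bsub>D\<^esub> (- t) \<odot>\<^bsub>D\<^esub> c) \<in> S"
          by (intro S_add S_smult n d)
        moreover have "k \<odot>\<^bsub>N\<^esub> x \<oplus>\<^bsub>N\<^esub> (- t) \<odot>\<^bsub>N\<^esub> (int n \<odot>\<^bsub>N\<^esub> x) = (k mod int n) \<odot>\<^bsub>N\<^esub> x"
        proof -
          have "k mod int n = k + (- t) * int n" by (simp add: t_def minus_div_mult_eq_mod[symmetric])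
          then show ?thesis by (simp only: smult_add(1)[OF x] smult_mult(1)[OF x])
        qed
        ultimately have m: "(int (nat (k mod int n)) \<odot>\<^bsub>N\<^esub> x, d \<oplus>\<^bsub>D\<^esub> (- t) \<odot>\<^bsub>D\<^esub> c) \<in> S" using n(1) by simp
        have "nat (k mod int n) < n" using n(1) by (simp add: nat_less_iff)
        then have "k mod int n = 0" using least[of "nat (k mod int n)"] m n(1)
          by (metis leD neq0_conv nat_eq_iff2 of_nat_0_less_iff of_nat_0 pos_mod_sign order_antisym nat_0_iff)
        then have k: "k = t * int n" by (simp add: t_def minus_mod_eq_div_mult[symmetric])
        have "(t \<odot>\<^bsub>N\<^esub> (int n \<odot>\<^bsub>N\<^esub> x), t \<odot>\<^bsub>D\<^esub> c) \<in> S" by (rule S_smult[OF n(2)])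
        then have "(k \<odot>\<^bsub>N\<^esub> x, t \<odot>\<^bsub>D\<^esub> c) \<in> S" unfolding k smult_mult(1)[OF x] .
        then have "d = t \<odot>\<^bsub>D\<^esub> c" using S_fun d by blast
        then show ?thesis unfolding k smult_mult(2)[OF e(1)] e(2) .
      qed
      then show ?thesis using e(1) by blast
    qed
    then obtain e where e: "e \<in> carrier D" and xe: "\<And>k d. (k \<odot>\<^bsub>N\<^esub> x, d) \<in> S \<Longrightarrow> d = k \<odot>\<^bsub>D\<^esub> e" by blast
    \<comment> \<open>The graph of the extension to the subgroup generated by the old domain and
      \<open>x\<close>, with value \<open>e\<close> at \<open>x\<close>.\<close>
    define T where "T = {(a \<oplus>\<^bsub>N\<^esub> k \<odot>\<^bsub>N\<^esub> x, b \<oplus>\<^bsub>D\<^esub> k \<odot>\<^bsub>D\<^esub> e) | a b k. (a, b) \<in> S}"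
    have TI: "(a', b') \<in> T" if "(a, b) \<in> S" "a' = a \<oplus>\<^bsub>N\<^esub> k \<odot>\<^bsub>N\<^esub> x" "b' = b \<oplus>\<^bsub>D\<^esub> k \<odot>\<^bsub>D\<^esub> e" for a b k a' b'
      using that unfolding T_def by blast
    have ST: "S \<subseteq> T"
    proof
      fix u assume "u \<in> S"
      then show "u \<in> T" using S_cl x e by (cases u) (auto intro!: TI[of _ _ _ 0] simp: smult_01)
    qed
    have "T \<in> \<G>"
      unfolding \<G>_def mem_Collect_eq
    proof (intro conjI allI impI)
      show "T \<subseteq> carrier N \<times> carrier D" using S_cl x e by (auto simp: T_def)
      show "\<forall>m\<in>carrier M. (j m, g m) \<in> T" using S_g ST by blast
      fix a' b' c' d' assume "(a', b') \<in> T \<and> (c', d') \<in> T"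
      then obtain a b k c d l where *: "(a, b) \<in> S" "a' = a \<oplus>\<^bsub>N\<^esub> k \<odot>\<^bsub>N\<^esub> x" "b' = b \<oplus>\<^bsub>D\<^esub> k \<odot>\<^bsub>D\<^esub> e"
        "(c, d) \<in> S" "c' = c \<oplus>\<^bsub>N\<^esub> l \<odot>\<^bsub>N\<^esub> x" "d' = d \<oplus>\<^bsub>D\<^esub> l \<odot>\<^bsub>D\<^esub> e" unfolding T_def by blast
      then show "(a' \<oplus>\<^bsub>N\<^esub> c', b' \<oplus>\<^bsub>D\<^esub> d') \<in> T"
        using S_cl[OF *(1)] S_cl[OF *(4)] x e
        by (intro TI[OF S_add[OF *(1,4)], of _ "k + l"]) (simp_all add: smult_add N.add.m_ac D.add.m_ac)
    next
      fix l a' b' assume "(a', b') \<in> T"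
      then obtain a b k where *: "(a, b) \<in> S" "a' = a \<oplus>\<^bsub>N\<^esub> k \<odot>\<^bsub>N\<^esub> x" "b' = b \<oplus>\<^bsub>D\<^esub> k \<odot>\<^bsub>D\<^esub> e"
        unfolding T_def by blast
      then show "(l \<odot>\<^bsub>N\<^esub> a', l \<odot>\<^bsub>D\<^esub> b') \<in> T"
        using S_cl[OF *(1)] x e
        by (intro TI[OF S_smult[OF *(1), of l], of _ "l * k"]) (simp_all add: smult_mult smult_r)
    next
      fix b' assume "(\<zero>\<^bsub>N\<^esub>, b') \<in> T"
      then obtain a b k where *: "(a, b) \<in> S" "\<zero>\<^bsub>N\<^esub> = a \<oplus>\<^bsub>N\<^esub> k \<odot>\<^bsub>N\<^esub> x" "b' = b \<oplus>\<^bsub>D\<^esub> k \<odot>\<^bsub>D\<^esub> e"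
        unfolding T_def by blast
      note c = S_cl[OF *(1)]
      \<comment> \<open>Single-valuedness: here \<open>a\<close> is the multiple of \<open>x\<close>
        by \<open>- k\<close>, so the choice of \<open>e\<close> gives \<open>b = (- k) e\<close>
        and the second component vanishes.\<close>
      have "a = \<ominus>\<^bsub>N\<^esub> (k \<odot>\<^bsub>N\<^esub> x)" using *(2) c x N.minus_equality smult_cl by metis
      also have "\<dots> = (- k) \<odot>\<^bsub>N\<^esub> x" using smult_mult(1)[OF x, of "- 1" k] smult_neg(1)[of "k \<odot>\<^bsub>N\<^esub> x"] x by simp
      finally have "b = (- k) \<odot>\<^bsub>D\<^esub> e" using xe *(1) by blast
      then show "b' = \<zero>\<^bsub>D\<^esub>" using *(3) smult_add(2)[OF e, of "- k" k] smult_01(2)[OF e] by simp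
    qed
    then have "T = S" using max ST by blast
    moreover have "(x, e) \<in> T"
    proof (rule TI[of "\<zero>\<^bsub>N\<^esub>" "\<zero>\<^bsub>D\<^esub>" _ 1])
      show "(\<zero>\<^bsub>N\<^esub>, \<zero>\<^bsub>D\<^esub>) \<in> S" using S_g[OF M.zero_closed] by (simp add: hom_zero[OF j(1) M N] hom_zero[OF g M D])
    qed (use x e in \<open>simp_all add: smult_01\<close>)
    ultimately show ?thesis by blast
  qed
  then obtain h where h: "\<And>x. x \<in> carrier N \<Longrightarrow> (x, h x) \<in> S" by metis
  have "h \<in> rmod_hom int_ring N D"
  proof (rule homI)
    fix x assume x: "x \<in> carrier N"
    show "h x \<in> carrier D" using h[OF x] S_cl by blast
    show "h (x \<oplus>\<^bsub>N\<^esub> y) = h x \<oplus>\<^bsub>D\<^esub> h y" if y: "y \<in> carrier N" for y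
      using S_fun[OF h S_add[OF h[OF x] h[OF y]]] x y by simp
    show "h (k \<odot>\<^bsub>N\<^esub> x) = k \<odot>\<^bsub>D\<^esub> h x" for k
      using S_fun[OF h S_smult[OF h[OF x]]] x by simp
  qed
  moreover have "h (j m) = g m" if "m \<in> carrier M" for m
    using S_fun[OF h[OF hom_closed[OF j(1) that]] S_g[OF that]] .
  ultimately show thesis by (rule that)
qed

section \<open>Embedding of abelian groups into divisible ones\<close>

definition rat_module :: "(int, rat) module" where
  "rat_module = \<lparr>carrier = UNIV, monoid.mult = undefined, one = undefined, zero = 0, add = (+),
     smult = (\<lambda>k x. of_int k * x)\<rparr>"

lemma rat_module_simps [simp]:
  "carrier rat_module = UNIV" "\<zero>\<^bsub>rat_module\<^esub> = 0" "x \<oplus>\<^bsub>rat_module\<^esub> y = x + y"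
  "k \<odot>\<^bsub>rat_module\<^esub> x = of_int k * x"
  by (simp_all add: rat_module_def)

lemma rat_left_module: "left_module int_ring rat_module"
proof (rule left_moduleI[OF int_ring])
  show "abelian_group rat_module"
    by (rule abelian_groupI) (auto intro: exI[of _ "- x" for x])
qed (auto simp: algebra_simps)

text \<open>A divisible group containing \<open>M\<close>: the pushout of \<open>\<Z>\<^sup>(\<^sup>M\<^sup>) \<rightarrow> \<rat>\<^sup>(\<^sup>M\<^sup>)\<close> along \<open>\<Z>\<^sup>(\<^sup>M\<^sup>) \<rightarrow> M\<close>.\<close>

lemma (in module_universe) obtain_divisible_extension:
  fixes M :: "(int, 'a) module"
  assumes M: "left_module int_ring M" and sm: "small U (carrier M)"
  obtains D :: "(int, (('a \<Rightarrow> rat) \<times> 'a) set) module" and \<eta> where "left_module int_ring D"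
    "\<eta> \<in> rmod_hom int_ring M D" "inj_on \<eta> (carrier M)" "small U (carrier D)"
    "\<And>k d. \<lbrakk>k \<noteq> 0; d \<in> carrier D\<rbrakk> \<Longrightarrow> \<exists>e\<in>carrier D. k \<odot>\<^bsub>D\<^esub> e = d"
proof -
  let ?S = "carrier M"
  let ?F = "direct_sum ?S (\<lambda>_. regular_module int_ring)" and ?Q = "direct_sum ?S (\<lambda>_. rat_module)"
  interpret F: module_family int_ring ?S "\<lambda>_. regular_module int_ring"
    by (rule module_family.intro) (use int_ring regular_left_module in auto)
  interpret Q: module_family int_ring ?S "\<lambda>_. rat_module"
    by (rule module_family.intro) (use int_ring rat_left_module in auto)
  interpret M: left_module int_ring M by fact
  note mF = F.direct_sum_left_module and mQ = Q.direct_sum_left_module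
  interpret Fm: left_module int_ring ?F by (rule mF)
  interpret Qm: left_module int_ring ?Q by (rule mQ)
  obtain \<theta> where \<theta>: "\<theta> \<in> rmod_hom int_ring ?F M"
    and \<theta>_single: "\<And>m k. \<lbrakk>m \<in> ?S; k \<in> carrier int_ring\<rbrakk>
      \<Longrightarrow> \<theta> (single ?S (\<lambda>_. regular_module int_ring) m k) = k \<odot>\<^bsub>M\<^esub> m"
    by (rule obtain_free_hom[OF M, of ?S "\<lambda>m. m"]) (assumption, rule that)
  define \<iota> where "\<iota> x = (\<lambda>i\<in>?S. rat_of_int (x i))" for x
  have \<iota>: "\<iota> \<in> rmod_hom int_ring ?F ?Q"
  proof (rule homI)
    show "\<iota> x \<in> carrier ?Q" if "x \<in> carrier ?F" for x
      unfolding \<iota>_def by (rule Q.dsumI[OF _ F.dsum_finite[OF that]]) (auto simp: supp_def)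
  qed (auto simp: \<iota>_def fun_eq_iff)
  have \<iota>_inj: "x = \<zero>\<^bsub>?F\<^esub>" if x: "x \<in> carrier ?F" "\<iota> x = \<zero>\<^bsub>?Q\<^esub>" for x
  proof (rule F.dsum_eqI[OF x(1) Fm.M.zero_closed])
    fix i assume "i \<in> ?S"
    then show "x i = \<zero>\<^bsub>?F\<^esub> i" using fun_cong[OF x(2), of i] by (simp add: \<iota>_def)
  qed
  obtain D q where po: "pushout int_ring ?F \<iota> ?Q \<theta> M q (D :: (int, (('a \<Rightarrow> rat) \<times> 'a) set) module)"
    by (rule obtain_pushout[OF mF mQ M \<iota> \<theta>])
  have D: "left_module int_ring D" and q: "q \<in> rmod_hom int_ring (dprod ?Q M) D"
    and q_surj: "q ` carrier (dprod ?Q M) = carrier D" using po by (auto simp: pushout_def)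
  interpret D: left_module int_ring D by (rule D)
  define \<eta> where "\<eta> y = q (\<zero>\<^bsub>?Q\<^esub>, y)" for y
  have \<eta>: "\<eta> \<in> rmod_hom int_ring M D"
    unfolding \<eta>_def by (intro hom_comp[OF hom_Pair[OF hom_const_zero[OF mQ] hom_id] q])
  show thesis
  proof (rule that[OF D \<eta>])
    show "inj_on \<eta> (carrier M)"
      unfolding hom_inj_iff[OF \<eta> M D]
    proof (intro ballI impI)
      fix y assume y: "y \<in> carrier M" "\<eta> y = \<zero>\<^bsub>D\<^esub>"
      then obtain k where k: "k \<in> carrier ?F" "\<zero>\<^bsub>?Q\<^esub> = \<iota> k" "y = \<ominus>\<^bsub>M\<^esub> \<theta> k"
        using po Qm.M.zero_closed unfolding pushout_def \<eta>_def by blast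
      then have "k = \<zero>\<^bsub>?F\<^esub>" by (intro \<iota>_inj) simp_all
      then show "y = \<zero>\<^bsub>M\<^esub>" using k(3) hom_zero[OF \<theta> mF M] by (simp only: M.neg_zero)
    qed
    have "small U (carrier ?Q)"
      unfolding direct_sum_simps by (rule small_finsupp[OF sm small_countable[of "UNIV :: rat set"]]) auto
    then have "small U (carrier (dprod ?Q M))" using small_times sm by (simp only: dprod_simps)
    then show "small U (carrier D)" unfolding q_surj[symmetric] using small_lepoll image_lepoll by blast
    fix k :: int and d assume k: "k \<noteq> 0" and "d \<in> carrier D"
    then obtain x y where xy: "x \<in> carrier ?Q" "y \<in> carrier M" "d = q (x, y)"
      unfolding q_surj[symmetric] dprod_simps by blast
    \<comment> \<open>The basis element indexed by \<open>y\<close> maps to \<open>y\<close>, so the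
      class of \<open>(0, y)\<close> is also that of \<open>(\<iota> ?z, 0)\<close>. Hence every
      element of the pushout comes from the rational part, where division by \<open>k\<close> is
      possible.\<close>
    let ?z = "single ?S (\<lambda>_. regular_module int_ring) y 1"
    have z: "?z \<in> carrier ?F" using hom_closed[OF F.single_hom[OF xy(2)], of 1] by simp
    have "\<theta> ?z = y" using \<theta>_single[OF xy(2), of 1] M.smult_one[OF xy(2)] by simp
    then have y: "q (\<zero>\<^bsub>?Q\<^esub>, y) = q (\<iota> ?z, \<zero>\<^bsub>M\<^esub>)" using pushout_comm[OF mF mQ M \<iota> \<theta> po z] by simp
    define u where "u = x \<oplus>\<^bsub>?Q\<^esub> \<iota> ?z"
    have u: "u \<in> carrier ?Q" unfolding u_def by (rule Qm.M.a_closed[OF xy(1) hom_closed[OF \<iota> z]])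
    have "q (x, y) = q (x, \<zero>\<^bsub>M\<^esub>) \<oplus>\<^bsub>D\<^esub> q (\<zero>\<^bsub>?Q\<^esub>, y)"
      using hom_add[OF q, of "(x, \<zero>\<^bsub>M\<^esub>)" "(\<zero>\<^bsub>?Q\<^esub>, y)"] xy(1,2) Qm.M.zero_closed Qm.M.r_zero[OF xy(1)]
      by (simp only: dprod_simps fst_conv snd_conv M.zero_closed M.l_zero mem_Times_iff simp_thms)
    also have "\<dots> = q (u, \<zero>\<^bsub>M\<^esub>)"
      using hom_add[OF q, of "(x, \<zero>\<^bsub>M\<^esub>)" "(\<iota> ?z, \<zero>\<^bsub>M\<^esub>)"] xy(1) hom_closed[OF \<iota> z]
      unfolding y u_def
      by (simp only: dprod_simps fst_conv snd_conv M.zero_closed M.l_zero mem_Times_iff simp_thms)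
    finally have d: "d = q (u, \<zero>\<^bsub>M\<^esub>)" using xy(3) by simp
    define v where "v = (\<lambda>i\<in>?S. u i / of_int k)"
    have v: "v \<in> carrier ?Q"
      unfolding v_def by (rule Q.dsumI[OF _ Q.dsum_finite[OF u]]) (auto simp: supp_def)
    have kv: "k \<odot>\<^bsub>?Q\<^esub> v = u"
      by (rule Q.dsum_eqI[OF Qm.smult_closed[OF _ v] u]) (use k in \<open>simp_all add: v_def\<close>)
    have v0: "(v, \<zero>\<^bsub>M\<^esub>) \<in> carrier (dprod ?Q M)"
      using v M.zero_closed unfolding dprod_simps by blast
    have "q (k \<odot>\<^bsub>dprod ?Q M\<^esub> (v, \<zero>\<^bsub>M\<^esub>)) = k \<odot>\<^bsub>D\<^esub> q (v, \<zero>\<^bsub>M\<^esub>)"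
      by (rule hom_smult[OF q _ v0]) simp
    moreover have "k \<odot>\<^bsub>M\<^esub> \<zero>\<^bsub>M\<^esub> = \<zero>\<^bsub>M\<^esub>" by (rule M.smult_zero_right) simp
    ultimately have "k \<odot>\<^bsub>D\<^esub> q (v, \<zero>\<^bsub>M\<^esub>) = d"
      unfolding d dprod_simps fst_conv snd_conv kv by simp
    moreover have "q (v, \<zero>\<^bsub>M\<^esub>) \<in> carrier D" by (rule hom_closed[OF q v0])
    ultimately show "\<exists>e\<in>carrier D. k \<odot>\<^bsub>D\<^esub> e = d" by blast
  qed
qed

text \<open>The group of additive maps from \<open>R\<close> to \<open>D\<close>. Multiplying the
  argument on the right is what makes the action a left one: both \<open>(r s) \<phi>\<close> and
  \<open>r (s \<phi>)\<close> send \<open>x\<close> to \<open>\<phi> (x r s)\<close>.\<close>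

definition coinduced :: "('r, 'k) ring_scheme \<Rightarrow> (int, 'd) module \<Rightarrow> ('r, 'r \<Rightarrow> 'd) module" where
  "coinduced R D = \<lparr>carrier = {\<phi> \<in> carrier R \<rightarrow>\<^sub>E carrier D.
       \<forall>x\<in>carrier R. \<forall>y\<in>carrier R. \<phi> (x \<oplus>\<^bsub>R\<^esub> y) = \<phi> x \<oplus>\<^bsub>D\<^esub> \<phi> y},
     monoid.mult = undefined, one = undefined,
     zero = (\<lambda>x\<in>carrier R. \<zero>\<^bsub>D\<^esub>),
     add = (\<lambda>\<phi> \<psi>. \<lambda>x\<in>carrier R. \<phi> x \<oplus>\<^bsub>D\<^esub> \<psi> x),
     smult = (\<lambda>r \<phi>. \<lambda>x\<in>carrier R. \<phi> (x \<otimes>\<^bsub>R\<^esub> r))\<rparr>"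

lemma coinduced_simps [simp]:
  "carrier (coinduced R D) = {\<phi> \<in> carrier R \<rightarrow>\<^sub>E carrier D.
     \<forall>x\<in>carrier R. \<forall>y\<in>carrier R. \<phi> (x \<oplus>\<^bsub>R\<^esub> y) = \<phi> x \<oplus>\<^bsub>D\<^esub> \<phi> y}"
  "\<zero>\<^bsub>coinduced R D\<^esub> = (\<lambda>x\<in>carrier R. \<zero>\<^bsub>D\<^esub>)"
  "\<phi> \<oplus>\<^bsub>coinduced R D\<^esub> \<psi> = (\<lambda>x\<in>carrier R. \<phi> x \<oplus>\<^bsub>D\<^esub> \<psi> x)"
  "r \<odot>\<^bsub>coinduced R D\<^esub> \<phi> = (\<lambda>x\<in>carrier R. \<phi> (x \<otimes>\<^bsub>R\<^esub> r))"
  by (simp_all add: coinduced_def)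

lemma coinduced_left_module:
  assumes "ring R" and "abelian_group D"
  shows "left_module R (coinduced R D)"
proof -
  interpret R: ring R by fact
  interpret D: abelian_group D by fact
  let ?J = "coinduced R D"
  have mem: "\<phi> x \<in> carrier D" if "\<phi> \<in> carrier ?J" "x \<in> carrier R" for \<phi> x using that by auto
  have ext: "\<phi> = \<psi>" if "\<phi> \<in> carrier ?J" "\<psi> \<in> carrier ?J" "\<And>x. x \<in> carrier R \<Longrightarrow> \<phi> x = \<psi> x" for \<phi> \<psi>
    using that by (auto intro: PiE_ext)
  have I: "(\<lambda>x\<in>carrier R. f x) \<in> carrier ?J"
    if "\<And>x. x \<in> carrier R \<Longrightarrow> f x \<in> carrier D"
      "\<And>x y. \<lbrakk>x \<in> carrier R; y \<in> carrier R\<rbrakk> \<Longrightarrow> f (x \<oplus>\<^bsub>R\<^esub> y) = f x \<oplus>\<^bsub>D\<^esub> f y" for f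
    using that by auto
  have add: "\<phi> \<oplus>\<^bsub>?J\<^esub> \<psi> \<in> carrier ?J" if "\<phi> \<in> carrier ?J" "\<psi> \<in> carrier ?J" for \<phi> \<psi>
    unfolding coinduced_simps(3) by (rule I) (use that mem[OF that(1)] mem[OF that(2)] in \<open>auto simp: D.a_ac\<close>)
  have smult: "r \<odot>\<^bsub>?J\<^esub> \<phi> \<in> carrier ?J" if "r \<in> carrier R" "\<phi> \<in> carrier ?J" for r \<phi>
    unfolding coinduced_simps(4) by (rule I) (use that mem[OF that(2)] in \<open>auto simp: R.l_distr\<close>)
  have zero: "\<zero>\<^bsub>?J\<^esub> \<in> carrier ?J" unfolding coinduced_simps(2) by (rule I) auto
  have neg: "(\<lambda>x\<in>carrier R. \<ominus>\<^bsub>D\<^esub> \<phi> x) \<in> carrier ?J" if "\<phi> \<in> carrier ?J" for \<phi>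
    by (rule I) (use that mem[OF that] in \<open>auto simp: D.minus_add\<close>)
  show ?thesis
  proof (rule left_moduleI[OF assms(1)])
    show "abelian_group ?J"
    proof (rule abelian_groupI)
      fix \<phi> \<psi> \<chi> assume a: "\<phi> \<in> carrier ?J" and b: "\<psi> \<in> carrier ?J" and c: "\<chi> \<in> carrier ?J"
      show "\<phi> \<oplus>\<^bsub>?J\<^esub> \<psi> \<oplus>\<^bsub>?J\<^esub> \<chi> = \<phi> \<oplus>\<^bsub>?J\<^esub> (\<psi> \<oplus>\<^bsub>?J\<^esub> \<chi>)"
        using mem[OF a] mem[OF b] mem[OF c] by (auto intro!: restrict_ext simp: D.a_assoc)
      show "\<phi> \<oplus>\<^bsub>?J\<^esub> \<psi> = \<psi> \<oplus>\<^bsub>?J\<^esub> \<phi>"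
        using mem[OF a] mem[OF b] by (auto intro!: restrict_ext simp: D.a_comm)
      show "\<zero>\<^bsub>?J\<^esub> \<oplus>\<^bsub>?J\<^esub> \<phi> = \<phi>"
        by (rule ext[OF add[OF zero a] a]) (use mem[OF a] in auto)
      show "\<exists>\<psi>\<in>carrier ?J. \<psi> \<oplus>\<^bsub>?J\<^esub> \<phi> = \<zero>\<^bsub>?J\<^esub>"
        using neg[OF a] mem[OF a] by (intro bexI[of _ "\<lambda>x\<in>carrier R. \<ominus>\<^bsub>D\<^esub> \<phi> x"]) (auto intro!: restrict_ext simp: D.l_neg)
      show "\<phi> \<oplus>\<^bsub>?J\<^esub> \<psi> \<in> carrier ?J" by (rule add[OF a b])
    qed (rule zero)
  next
    fix \<phi> assume a: "\<phi> \<in> carrier ?J"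
    show "\<one>\<^bsub>R\<^esub> \<odot>\<^bsub>?J\<^esub> \<phi> = \<phi>" by (rule ext[OF smult[OF R.one_closed a] a]) simp
    fix r assume r: "r \<in> carrier R"
    show "r \<odot>\<^bsub>?J\<^esub> \<phi> \<in> carrier ?J" by (rule smult[OF r a])
    show "(r \<oplus>\<^bsub>R\<^esub> s) \<odot>\<^bsub>?J\<^esub> \<phi> = r \<odot>\<^bsub>?J\<^esub> \<phi> \<oplus>\<^bsub>?J\<^esub> s \<odot>\<^bsub>?J\<^esub> \<phi>" if "s \<in> carrier R" for s
      using a r that by (auto intro!: restrict_ext simp: R.r_distr)
    show "(r \<otimes>\<^bsub>R\<^esub> s) \<odot>\<^bsub>?J\<^esub> \<phi> = r \<odot>\<^bsub>?J\<^esub> (s \<odot>\<^bsub>?J\<^esub> \<phi>)" if "s \<in> carrier R" for s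
      using r that by (auto intro!: restrict_ext simp: R.m_assoc)
    show "r \<odot>\<^bsub>?J\<^esub> (\<phi> \<oplus>\<^bsub>?J\<^esub> \<psi>) = r \<odot>\<^bsub>?J\<^esub> \<phi> \<oplus>\<^bsub>?J\<^esub> r \<odot>\<^bsub>?J\<^esub> \<psi>" for \<psi>
      using r by (auto intro!: restrict_ext)
  qed
qed

context module_class
begin

text \<open>Embed the underlying group of \<open>M\<close> in a divisible group \<open>D\<close>.
  Then \<open>M\<close> embeds in the coinduced module of \<open>D\<close> by adjunction. The
  coinduced module is injective because extending linear maps into it amounts to extending additive
  maps into \<open>D\<close>; in particular it is orthogonal to any class \<open>X\<close>.\<close>

lemma enough_injectives:
  assumes M: "M \<in> Mods R U"
  shows "\<exists>J\<in>right_perp R U X. \<exists>i\<in>rmod_hom R M J. inj_on i (carrier M)"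
proof -
  note mM = Mods_left_module[OF M]
  interpret R: ring R by (rule ring)
  interpret M: left_module R M by (rule mM)
  note zM = int_left_module[OF left_module_group[OF mM]]
  obtain D :: "(int, (('m \<Rightarrow> rat) \<times> 'm) set) module" and \<eta> where D: "left_module int_ring D"
    and \<eta>: "\<eta> \<in> rmod_hom int_ring (int_module M) D" "inj_on \<eta> (carrier (int_module M))"
    and D_small: "small U (carrier D)"
    and div: "\<And>k d. \<lbrakk>k \<noteq> 0; d \<in> carrier D\<rbrakk> \<Longrightarrow> \<exists>e\<in>carrier D. k \<odot>\<^bsub>D\<^esub> e = d"
    using obtain_divisible_extension[OF zM] Mods_small[OF M] by (metis int_module_simps(1))
  let ?J = "coinduced R D"
  note mJ = coinduced_left_module[OF ring left_module_group[OF D]]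
  have "small U (carrier ?J)" by (rule small_subset[OF small_PiE[OF D_small]]) auto
  then obtain J e e' where J: "J \<in> Mods R U" and e: "e \<in> rmod_hom R ?J J" "e' \<in> rmod_hom R J ?J"
    "\<And>x. x \<in> carrier ?J \<Longrightarrow> e' (e x) = x" "\<And>y. y \<in> carrier J \<Longrightarrow> e (e' y) = y"
    using obtain_Mods_iso[OF mJ] by metis
  note mJ' = Mods_left_module[OF J]
  have JI: "(\<lambda>x\<in>carrier R. f x) \<in> carrier ?J"
    if "\<And>x. x \<in> carrier R \<Longrightarrow> f x \<in> carrier D"
      "\<And>x y. \<lbrakk>x \<in> carrier R; y \<in> carrier R\<rbrakk> \<Longrightarrow> f (x \<oplus>\<^bsub>R\<^esub> y) = f x \<oplus>\<^bsub>D\<^esub> f y" for f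
    using that by auto
  text \<open>Adjunction: an additive map \<open>h : N \<rightarrow> D\<close> corresponds to the linear map \<open>n \<mapsto> (x \<mapsto> h (x n))\<close>.\<close>
  have adj: "(\<lambda>n. \<lambda>x\<in>carrier R. h (x \<odot>\<^bsub>N\<^esub> n)) \<in> rmod_hom R N ?J"
    if N: "left_module R N" and h: "h \<in> rmod_hom int_ring (int_module N) D" for N :: "('r, 'm) module" and h
  proof -
    interpret N: left_module R N by (rule N)
    have hc: "h y \<in> carrier D" if "y \<in> carrier N" for y using hom_closed[OF h, of y] that by simp
    have ha: "h (y \<oplus>\<^bsub>N\<^esub> z) = h y \<oplus>\<^bsub>D\<^esub> h z" if "y \<in> carrier N" "z \<in> carrier N" for y z
      using hom_add[OF h, of y z] that by simp
    show ?thesis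
    proof (rule homI)
      show "(\<lambda>x\<in>carrier R. h (x \<odot>\<^bsub>N\<^esub> n)) \<in> carrier ?J" if "n \<in> carrier N" for n
        by (rule JI) (use that in \<open>auto simp: hc ha N.smult_closed N.smult_l_distr\<close>)
    qed (auto simp: fun_eq_iff ha N.smult_closed N.smult_r_distr N.smult_assoc)
  qed
  have "J \<in> right_perp R U X"
  proof (rule right_perpI[OF J])
    fix A N i p assume N: "N \<in> Mods R U" and s: "ses R J i N p A"
    note mN = Mods_left_module[OF N] and i = ses_hom1[OF s]
    interpret J: left_module R J by (rule mJ')
    have e'1: "e' w \<one>\<^bsub>R\<^esub> \<in> carrier D" if "w \<in> carrier J" for w
      using hom_closed[OF e(2) that] by auto
    note zJ = int_left_module[OF left_module_group[OF mJ']] and zN = int_left_module[OF left_module_group[OF mN]]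
    have iZ: "i \<in> rmod_hom int_ring (int_module J) (int_module N)"
      by (rule additive_int_hom[OF zJ zN]) (auto simp: hom_closed[OF i] hom_add[OF i])
    have i_inj: "inj_on i (carrier (int_module J))" using ses_inj[OF s] by simp
    \<comment> \<open>Evaluation at 1 is the additive map adjoint to the identity of the coinduced
      module; its extension \<open>h\<close> to \<open>N\<close> corresponds to a retraction of
      \<open>i\<close>.\<close>
    have gZ: "(\<lambda>w. e' w \<one>\<^bsub>R\<^esub>) \<in> rmod_hom int_ring (int_module J) D"
      by (rule additive_int_hom[OF zJ D]) (auto simp: e'1 hom_add[OF e(2)])
    obtain h where h: "h \<in> rmod_hom int_ring (int_module N) D"
      and hi: "\<And>w. w \<in> carrier (int_module J) \<Longrightarrow> h (i w) = e' w \<one>\<^bsub>R\<^esub>"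
      by (rule divisible_extend[OF zJ zN D div iZ i_inj gZ]) (assumption, assumption, rule that)
    have "e (\<lambda>x\<in>carrier R. h (x \<odot>\<^bsub>N\<^esub> i w)) = w" if w: "w \<in> carrier J" for w
    proof -
      \<comment> \<open>The scalar \<open>x\<close> is moved inside \<open>i\<close> and
        \<open>e'\<close>, after which evaluation of \<open>x (e' w)\<close> at 1 is
        \<open>e' w x\<close> by the definition of the action.\<close>
      have "h (x \<odot>\<^bsub>N\<^esub> i w) = e' w x" if x: "x \<in> carrier R" for x
        using hi[of "x \<odot>\<^bsub>J\<^esub> w"] hom_smult[OF i x w, symmetric] hom_smult[OF e(2) x w] x w
        by (simp add: J.smult_closed)
      then have "(\<lambda>x\<in>carrier R. h (x \<odot>\<^bsub>N\<^esub> i w)) = e' w"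
        using hom_closed[OF e(2) w] by (auto simp: fun_eq_iff PiE_def extensional_def)
      then show ?thesis using e(4)[OF w] by simp
    qed
    then show "(\<exists>r\<in>rmod_hom R N J. \<forall>a\<in>carrier J. r (i a) = a) \<or> (\<exists>s\<in>rmod_hom R A N. \<forall>c\<in>carrier A. p (s c) = c)"
      using hom_comp[OF adj[OF mN h] e(1)]
      by (intro disjI1 bexI[of _ "\<lambda>n. e (\<lambda>x\<in>carrier R. h (x \<odot>\<^bsub>N\<^esub> n))"]) auto
  qed
  moreover have "inj_on (\<lambda>m. e (\<lambda>x\<in>carrier R. \<eta> (x \<odot>\<^bsub>M\<^esub> m))) (carrier M)"
  proof (rule inj_onI)
    fix m m' assume m: "m \<in> carrier M" "m' \<in> carrier M"
      and eq: "e (\<lambda>x\<in>carrier R. \<eta> (x \<odot>\<^bsub>M\<^esub> m)) = e (\<lambda>x\<in>carrier R. \<eta> (x \<odot>\<^bsub>M\<^esub> m'))"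
    have "(\<lambda>x\<in>carrier R. \<eta> (x \<odot>\<^bsub>M\<^esub> m)) = (\<lambda>x\<in>carrier R. \<eta> (x \<odot>\<^bsub>M\<^esub> m'))"
      using e(3)[OF hom_closed[OF adj[OF mM \<eta>(1)] m(1)]] e(3)[OF hom_closed[OF adj[OF mM \<eta>(1)] m(2)]] eq
      by metis
    from fun_cong[OF this, of "\<one>\<^bsub>R\<^esub>"] have "\<eta> m = \<eta> m'" using m by (simp add: M.smult_one)
    then show "m = m'" using \<eta>(2) m by (simp add: inj_on_eq_iff)
  qed
  ultimately show ?thesis using hom_comp[OF adj[OF mM \<eta>(1)] e(1)] by blast
qed

end

theorem corollary3p8:
  fixes R :: "('r, 'k) ring_scheme"
    and U :: "'m set set"
    and X :: "('r, 'm) module set"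
  assumes "ring R"
    and "set_universe R U"
    and "X \<subseteq> Mods R U"
    and "right_perp R U X \<subseteq> X"
    and "left_perp R U X \<subseteq> X"
  shows
    "(closed_under_direct_sums R U X \<and> closed_under_extensions R U X \<and>
      special_precovering R U X \<and> special_preenveloping R U X \<longrightarrow>
        (\<forall>Y\<in>Cplxs R U. left_bounded Y \<longrightarrow>
          (\<exists>I f. is_preenvelope R (C_injective R U X) Y f I \<and> monic_map Y f \<and> exact_cplx I)) \<and>
        (\<forall>Y\<in>Cplxs R U. right_bounded Y \<longrightarrow>
          (\<exists>P f. is_precover R (C_projective R U X) P f Y \<and> epic_map P f Y \<and> exact_cplx P)))
     \<and>
     (complete_cotorsion_pair R U X (right_perp R U X) \<and>
      closed_under_inverse_limits R U (C_star R U X) \<longrightarrow>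
        (\<forall>Y\<in>Cplxs R U.
          (\<exists>I f. is_preenvelope R (C_injective R U X) Y f I \<and> monic_map Y f \<and> exact_cplx I \<and>
             I \<in> eps_injective R U X)) \<and>
        (\<forall>Y\<in>Cplxs R U.
          (\<exists>P f. is_precover R (C_projective R U X) P f Y \<and> epic_map P f Y \<and> exact_cplx P \<and>
             P \<in> eps_projective R U X)))"
proof -
  interpret module_class R U X
    using assms(1-3) by (intro module_class.intro module_universe.intro module_class_axioms.intro)
  note sub = assms(4,5)
  have part_i:
    "(\<exists>I f. is_preenvelope R (C_injective R U X) Y f I \<and> monic_map Y f \<and> exact_cplx I) \<and>
     (\<exists>P f. is_precover R (C_projective R U X) P f Y \<and> epic_map P f Y \<and> exact_cplx P)"
    if ext: "closed_under_extensions R U X" and cov: "special_precovering R U X"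
      and env: "special_preenveloping R U X" and Y: "Y \<in> Cplxs R U" for Y
  proof -
    \<comment> \<open>Salce's construction starts from any embedding into an
      \<open>X\<close>-injective module; enough injectives supply one.\<close>
    have "\<exists>E\<in>right_perp R U X. \<exists>L\<in>X. \<exists>f p. ses R M f E p L" if "M \<in> Mods R U" for M
      using enough_injectives[OF that] special_right_perp_preenvelope[OF cov that] by blast
    moreover have "\<exists>P\<in>left_perp R U X. \<exists>K\<in>X. \<exists>i p. ses R K i P p M" if "M \<in> Mods R U" for M
      using enough_projectives[OF that] special_left_perp_precover[OF env that] by blast
    ultimately show ?thesis
      using C_injective_preenvelope[OF ext sub(1) _ Y] C_projective_precover[OF ext sub(2) _ Y] by blast
  qed
  have part_ii:
    "(\<exists>I f. is_preenvelope R (C_injective R U X) Y f I \<and> monic_map Y f \<and> exact_cplx I \<and>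
        I \<in> eps_injective R U X) \<and>
     (\<exists>P f. is_precover R (C_projective R U X) P f Y \<and> epic_map P f Y \<and> exact_cplx P \<and>
        P \<in> eps_projective R U X)"
    if cot: "complete_cotorsion_pair R U X (right_perp R U X)"
      and lim: "closed_under_inverse_limits R U (C_star R U X)" and Y: "Y \<in> Cplxs R U" for Y
  proof -
    have X: "Mods R U \<subseteq> X" by (rule inverse_limit_closed_eq_Mods[OF cot sub(1) lim])
    \<comment> \<open>Closure under extensions, on which the disc argument relies, comes for free
      once \<open>X\<close> is the class of all modules.\<close>
    then have ext: "closed_under_extensions R U X" by (auto simp: closed_under_extensions_def)
    have "\<exists>E\<in>right_perp R U X. \<exists>L\<in>X. \<exists>f p. ses R M f E p L" if "M \<in> Mods R U" for M
      using cot that unfolding complete_cotorsion_pair_def short_exact_eq_ses by blast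
    moreover have "\<exists>P\<in>left_perp R U X. \<exists>K\<in>X. \<exists>i p. ses R K i P p M" if M: "M \<in> Mods R U" for M
    proof -
      obtain F \<phi> where F: "F \<in> left_perp R U X" "\<phi> \<in> rmod_hom R F M" "\<phi> ` carrier F = carrier M"
        using enough_projectives[OF M] by blast
      \<comment> \<open>The kernel of a surjection from a free module lies in \<open>X\<close>
        simply because every module does.\<close>
      then obtain K where "K \<in> Mods R U" "ses R K (\<lambda>x. x) F \<phi> M"
        using obtain_kernel[OF left_perp_Mods[OF F(1)] Mods_left_module[OF M] F(2,3)] by blast
      then show ?thesis using F(1) X by blast
    qed
    ultimately show ?thesis
      using C_injective_preenvelope[OF ext sub(1) _ Y] C_projective_precover[OF ext sub(2) _ Y] by blast
  qed
  show ?thesis using part_i part_ii by blast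
qed

end
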